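(* Fix a dimension $d\ge2$ and one of the types A, B, D below. For each $n$ (large enough to satisfy the size condition of that type) let $(\xi_1,\dots,\xi_n)$ be a tuple of random vectors in $\mathbb{R}^d$ satisfying all assumptions of that type, with associated convex hull $H_{n,d}$. Then as $n\to\infty$, $$\mathbb{P}[0\notin H_{n,d}]\sim\frac{2(\log n)^{d-1}}{(d-1)!\,n}\ \text{ in type A},\qquad \mathbb{P}[0\notin H_{n,d}]\sim\frac{(\log n)^{d-1}}{2^{d-2}(d-1)!\sqrt{\pi n}}\ \text{ in types B and D}.$$
   Context: $x_n\sim y_n$ means $x_n/y_n\to1$. For a tuple $(\xi_1,\dots,\xi_n)$ of random vectors in $\mathbb{R}^d$, put $S_k=\xi_1+\dots+\xi_k$ and $S_n^*=S_{n-1}-\xi_n$. Type A: $n\ge d+1$; the tuple is exchangeable ($(\xi_1,\dots,\xi_n)\stackrel{d}{=}(\xi_{\sigma(1)},\dots,\xi_{\sigma(n)})$ for all permutations $\sigma$); $S_n=0$ a.s.; any $d$ vectors among $S_1,\dots,S_{n-1}$ are linearly independent a.s.; $H_{n,d}=\mathrm{Conv}(S_1,\dots,S_{n-1})$. Type B: $n\ge d$; $(\xi_1,\dots,\xi_n)\stackrel{d}{=}(\varepsilon_1\xi_{\sigma(1)},\dots,\varepsilon_n\xi_{\sigma(n)})$ for all permutations $\sigma$ and all signs $\varepsilon_i\in\{-1,1\}$; any $d$ vectors among $S_1,\dots,S_n$ are linearly independent a.s.; $H_{n,d}=\mathrm{Conv}(S_1,\dots,S_n)$. Type D: $n\ge\max\{2,d\}$;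 the same invariance as type B but only for signs with $\varepsilon_1\cdots\varepsilon_n=1$; any $d$ vectors from either collection $S_1,\dots,S_n$ or $S_1,\dots,S_{n-1},S_n^*$ are linearly independent a.s.; $H_{n,d}=\mathrm{Conv}(S_1,\dots,S_n,S_n^* )$. *)

theory Defs
  imports "HOL-Probability.Probability" "HOL-Library.Landau_Symbols"
begin

text \<open>A tuple (xi_1,...,xi_n) of random vectors is modelled by a function
  xi :: nat => 'w => 'a on the probability space M, with indices 1..n.\<close>

definition psum :: "(nat \<Rightarrow> 'w \<Rightarrow> 'a::euclidean_space) \<Rightarrow> nat \<Rightarrow> 'w \<Rightarrow> 'a" where
  "psum \<xi> k \<omega> = (\<Sum>i\<in>{1..k}. \<xi> i \<omega>)"

definition psum_star :: "(nat \<Rightarrow> 'w \<Rightarrow> 'a::euclidean_space) \<Rightarrow> nat \<Rightarrow> 'w \<Rightarrow> 'a" where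
  "psum_star \<xi> n \<omega> = psum \<xi> (n - 1) \<omega> - \<xi> n \<omega>"

definition joint_law :: "'w measure \<Rightarrow> nat \<Rightarrow> (nat \<Rightarrow> 'w \<Rightarrow> 'a::euclidean_space)
    \<Rightarrow> (nat \<Rightarrow> nat) \<Rightarrow> (nat \<Rightarrow> real) \<Rightarrow> (nat \<Rightarrow> 'a) measure" where
  "joint_law M n \<xi> \<sigma> \<epsilon> =
     distr M (\<Pi>\<^sub>M i\<in>{1..n}. borel) (\<lambda>\<omega>. \<lambda>i\<in>{1..n}. \<epsilon> i *\<^sub>R \<xi> (\<sigma> i) \<omega>)"

definition any_d_indep :: "(nat \<Rightarrow> 'a::euclidean_space) \<Rightarrow> nat set \<Rightarrow> bool" where
  "any_d_indep v I \<longleftrightarrow>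
     (\<forall>K\<subseteq>I. card K = DIM('a) \<longrightarrow> inj_on v K \<and> independent (v ` K))"

definition rand_vectors :: "'w measure \<Rightarrow> nat \<Rightarrow> (nat \<Rightarrow> 'w \<Rightarrow> 'a::euclidean_space) \<Rightarrow> bool" where
  "rand_vectors M n \<xi> \<longleftrightarrow> prob_space M \<and> (\<forall>i\<in>{1..n}. \<xi> i \<in> borel_measurable M)"

definition typeA :: "'w measure \<Rightarrow> nat \<Rightarrow> (nat \<Rightarrow> 'w \<Rightarrow> 'a::euclidean_space) \<Rightarrow> bool" where
  "typeA M n \<xi> \<longleftrightarrow> n \<ge> DIM('a) + 1 \<and> rand_vectors M n \<xi> \<and>
     (\<forall>\<sigma>. \<sigma> permutes {1..n} \<longrightarrow> joint_law M n \<xi> \<sigma> (\<lambda>_. 1) = joint_law M n \<xi> id (\<lambda>_. 1)) \<and>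
     (AE \<omega> in M. psum \<xi> n \<omega> = 0) \<and>
     (AE \<omega> in M. any_d_indep (\<lambda>k. psum \<xi> k \<omega>) {1..n-1})"

definition typeB :: "'w measure \<Rightarrow> nat \<Rightarrow> (nat \<Rightarrow> 'w \<Rightarrow> 'a::euclidean_space) \<Rightarrow> bool" where
  "typeB M n \<xi> \<longleftrightarrow> n \<ge> DIM('a) \<and> rand_vectors M n \<xi> \<and>
     (\<forall>\<sigma> \<epsilon>. \<sigma> permutes {1..n} \<longrightarrow> (\<forall>i\<in>{1..n}. \<epsilon> i \<in> {-1, 1}) \<longrightarrow>
        joint_law M n \<xi> \<sigma> \<epsilon> = joint_law M n \<xi> id (\<lambda>_. 1)) \<and>
     (AE \<omega> in M. any_d_indep (\<lambda>k. psum \<xi> k \<omega>) {1..n})"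

definition typeD :: "'w measure \<Rightarrow> nat \<Rightarrow> (nat \<Rightarrow> 'w \<Rightarrow> 'a::euclidean_space) \<Rightarrow> bool" where
  "typeD M n \<xi> \<longleftrightarrow> n \<ge> max 2 DIM('a) \<and> rand_vectors M n \<xi> \<and>
     (\<forall>\<sigma> \<epsilon>. \<sigma> permutes {1..n} \<longrightarrow> (\<forall>i\<in>{1..n}. \<epsilon> i \<in> {-1, 1}) \<longrightarrow>
        (\<Prod>i\<in>{1..n}. \<epsilon> i) = 1 \<longrightarrow>
        joint_law M n \<xi> \<sigma> \<epsilon> = joint_law M n \<xi> id (\<lambda>_. 1)) \<and>
     (AE \<omega> in M. any_d_indep (\<lambda>k. psum \<xi> k \<omega>) {1..n}) \<and>
     (AE \<omega> in M. any_d_indep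
        (\<lambda>k. if k = n then psum_star \<xi> n \<omega> else psum \<xi> k \<omega>) {1..n})"

definition hullA :: "nat \<Rightarrow> (nat \<Rightarrow> 'w \<Rightarrow> 'a::euclidean_space) \<Rightarrow> 'w \<Rightarrow> 'a set" where
  "hullA n \<xi> \<omega> = convex hull ((\<lambda>k. psum \<xi> k \<omega>) ` {1..n-1})"

definition hullB :: "nat \<Rightarrow> (nat \<Rightarrow> 'w \<Rightarrow> 'a::euclidean_space) \<Rightarrow> 'w \<Rightarrow> 'a set" where
  "hullB n \<xi> \<omega> = convex hull ((\<lambda>k. psum \<xi> k \<omega>) ` {1..n})"

definition hullD :: "nat \<Rightarrow> (nat \<Rightarrow> 'w \<Rightarrow> 'a::euclidean_space) \<Rightarrow> 'w \<Rightarrow> 'a set" where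
  "hullD n \<xi> \<omega> = convex hull (insert (psum_star \<xi> n \<omega>) ((\<lambda>k. psum \<xi> k \<omega>) ` {1..n}))"

end

theory Submission
  imports Defs "HOL-Real_Asymp.Real_Asymp"
begin

text \<open>
  Summation by parts turns a vanishing combination of the partial sums with positive coefficients into
  a relation \<open>\<Sum> b\<^sub>i \<xi>\<^sub>i = 0\<close> whose coefficients decrease strictly. So, averaging over the symmetry
  group, the absorption probability is the proportion of Weyl chambers met by the linear space \<open>L\<close> of
  relations between the \<open>\<xi>\<^sub>i\<close>, and their number is the same for all \<open>L\<close> in general position.
  To count them, forget the last coordinate: over a chamber of the smaller arrangement met by \<open>L\<close>, the
  last coordinate cuts a convex set into one more piece than the number of walls it crosses, and each
  crossed wall is a chamber met by \<open>L \<inter> {b\<^sub>n = b\<^sub>i}\<close>. With \<open>s = 1\<close> for type A and \<open>s = 2\<close> for type B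
  this gives the recursion \<open>c(n, d) = c(n - 1, d - 1) + (s n - 1) c(n - 1, d)\<close>, which for the
  nonabsorption probability is solved by a product times iterated sums of \<open>1 / (s k - 1)\<close>; the
  asymptotics follow from Wallis' product and the Stolz-Cesaro theorem.

  In type D, flipping the last sign by a fair coin yields type B. The nonabsorption events of the two
  walks ending in \<open>S\<^sub>n\<close> and in \<open>S\<^sub>n\<^sup>*\<close> have the nonabsorption event of \<open>S\<^sub>1, \<dots>, S\<^bsub>n-1\<^esub>\<close> as union and that of
  the type D hull as intersection, so \<open>P\<^sub>D(n) = 2 P\<^sub>B(n) - P\<^sub>B(n - 1)\<close>.
\<close>

subsection \<open>Cutting a convex set by one more coordinate\<close>

text \<open>That the count depends only on \<open>n\<close> and \<open>d\<close> is proved by the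
  induction itself, so general position must pass to both spaces in the recursion: the projection of
  \<open>L\<close> that forgets the last coordinate, where the codimension drops by one, and the
  section by a wall, where one coordinate and one equation disappear together and the codimension
  stays. Expressing general position by the number of distinct values of a vector, and codimension
  by testing \<open>d + 1\<close> arbitrary vectors, turns both passages into cardinality estimates.

  The factor \<open>s n - 1\<close> is the number of coordinates of the smaller arrangement, one
  wall for each. The case \<open>d = 0\<close> counts all \<open>s ^ n * n!\<close> chambers; after
  division by this number the proportion \<open>q\<close> of missed chambers satisfies \<open>q(n,
  d) = q(n - 1, d - 1) / (s n) + (1 - 1 / (s n)) q(n - 1, d)\<close>. Dividing by the product of the
  factors \<open>1 - 1 / (s k)\<close> leaves pure summation with weights
  \<open>1 / (s k - 1)\<close>. Each summation contributes a factor of order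
  \<open>log n / s\<close>, and their nesting produces the factorial; in dimension \<open>d\<close>
  there are \<open>d - 1\<close> of them.\<close>

definition order_type :: "int set \<Rightarrow> (int \<Rightarrow> real) \<Rightarrow> (int \<times> int) set" where
  "order_type E b = {(i, j). i \<in> E \<and> j \<in> E \<and> b i < b j}"

text \<open>A region is encoded by the strict order that its points induce on the coordinates.\<close>

definition regions :: "int set \<Rightarrow> (int \<Rightarrow> real) set \<Rightarrow> (int \<times> int) set set" where
  "regions E L = order_type E ` {b \<in> L. inj_on b E}"

definition lin_closed :: "('i \<Rightarrow> real) set \<Rightarrow> bool" where
  "lin_closed L \<longleftrightarrow> (\<forall>b\<in>L. \<forall>c\<in>L. \<forall>x y. (\<lambda>i. x * b i + y * c i) \<in> L)"

lemma lin_closedD: "lin_closed L \<Longrightarrow> b \<in> L \<Longrightarrow> c \<in> L \<Longrightarrow> (\<lambda>i. x * b i + y * c i) \<in> L"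
  by (simp add: lin_closed_def)

lemma order_type_eqD:
  "order_type E b = order_type E c \<Longrightarrow> i \<in> E \<Longrightarrow> j \<in> E \<Longrightarrow> b i < b j \<longleftrightarrow> c i < c j"
  by (auto simp: order_type_def set_eq_iff)

lemma order_type_eqI:
  "(\<And>i j. i \<in> E \<Longrightarrow> j \<in> E \<Longrightarrow> b i < b j \<longleftrightarrow> c i < c j) \<Longrightarrow> order_type E b = order_type E c"
  by (auto simp: order_type_def)

lemma order_type_inj: "order_type E b = order_type E c \<Longrightarrow> inj_on b E \<Longrightarrow> inj_on c E"
proof (rule inj_onI)
  fix i j assume *: "order_type E b = order_type E c" "inj_on b E" "i \<in> E" "j \<in> E" "c i = c j"
  then have "\<not> b i < b j" "\<not> b j < b i" using order_type_eqD[of E b c i j] order_type_eqD[of E b c j i] by auto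
  then show "i = j" using inj_onD[OF *(2) _ *(3,4)] by simp
qed

lemma finite_regions: "finite E \<Longrightarrow> finite (regions E L)"
  by (rule finite_subset[of _ "Pow (E \<times> E)"]) (auto simp: regions_def order_type_def)

text \<open>Finitely many strict inequalities survive a small perturbation. The bound
  \<open>e < 1\<close> allows \<open>e\<close> to serve as the weight of a convex
  combination.\<close>

lemma exists_small_pos:
  fixes f g :: "'i \<Rightarrow> real"
  assumes "finite I" "\<And>i. i \<in> I \<Longrightarrow> 0 < f i"
  shows "\<exists>e. 0 < e \<and> e < 1 \<and> (\<forall>i\<in>I. 0 < f i + e * g i)"
proof -
  have "eventually (\<lambda>e. \<forall>i\<in>I. 0 < f i + e * g i) (at_right 0)"
  proof (intro eventually_ball_finite ballI assms(1))
    fix i assume "i \<in> I"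
    have "((\<lambda>e. f i + e * g i) \<longlongrightarrow> f i + 0 * g i) (at_right 0)"
      by (intro tendsto_intros)
    then show "eventually (\<lambda>e. 0 < f i + e * g i) (at_right 0)"
      using assms(2)[OF \<open>i \<in> I\<close>] by (intro order_tendstoD(1)[of _ "f i"]) auto
  qed
  moreover have "eventually (\<lambda>e::real. 0 < e \<and> e < 1) (at_right 0)"
    using eventually_at_right_real[of 0 1] by simp
  ultimately have "eventually (\<lambda>e. 0 < e \<and> e < 1 \<and> (\<forall>i\<in>I. 0 < f i + e * g i)) (at_right 0)"
    by eventually_elim auto
  then show ?thesis
    using eventually_happens' trivial_limit_at_right_real by blast
qed

lemma finite_arg_min_real:
  fixes f :: "'i \<Rightarrow> real"
  assumes "finite S" "S \<noteq> {}"
  shows "\<exists>z\<in>S. \<forall>i\<in>S. f z \<le> f i"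
proof (intro bexI ballI)
  show "arg_min_on f S \<in> S" by (rule arg_min_if_finite(1)[OF assms])
  show "f (arg_min_on f S) \<le> f i" if "i \<in> S" for i by (rule arg_min_least[OF assms that])
qed

text \<open>
  Apart from the topmost piece, every piece lies immediately below exactly one crossed wall; \<open>D z\<close> is the
  piece below the wall \<open>z\<close>, reached from a zero of \<open>b p - b z\<close> by a small perturbation.
\<close>

lemma piece_count:
  fixes R :: "(int \<Rightarrow> real) set"
  assumes fin: "finite E" and ne: "R \<noteq> {}"
    and conv: "\<And>b c t. b \<in> R \<Longrightarrow> c \<in> R \<Longrightarrow> 0 \<le> t \<Longrightarrow> t \<le> 1 \<Longrightarrow> (\<lambda>i. (1 - t) * b i + t * c i) \<in> R"
    and inj: "\<And>b. b \<in> R \<Longrightarrow> inj_on b E"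
    and ord: "\<And>b c i j. b \<in> R \<Longrightarrow> c \<in> R \<Longrightarrow> i \<in> E \<Longrightarrow> j \<in> E \<Longrightarrow> b i < b j \<longleftrightarrow> c i < c j"
    and cross: "\<And>b i. b \<in> R \<Longrightarrow> i \<in> E \<Longrightarrow> b p = b i \<Longrightarrow> (\<exists>c\<in>R. c p < c i) \<and> (\<exists>c\<in>R. c i < c p)"
  shows "card ((\<lambda>b. {i \<in> E. b i < b p}) ` {b \<in> R. b p \<notin> b ` E}) = 1 + card {i \<in> E. \<exists>b\<in>R. b p = b i}"
proof -
  define Z where "Z = {i \<in> E. \<exists>b\<in>R. b p = b i}"
  \<comment> \<open>\<open>T\<close> encodes the topmost piece: it collects the coordinates that lie
    below \<open>p\<close> somewhere in \<open>R\<close>, and one point of \<open>R\<close> turns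
    out to lie above all of them at once.\<close>
  define T where "T = {i \<in> E. \<exists>b\<in>R. b i < b p}"
  obtain b0 where b0: "b0 \<in> R" using ne by blast
  define D where "D z = {i \<in> E. b0 i < b0 z}" for z
  have zero: "i \<in> Z" if "i \<in> E" "b \<in> R" "c \<in> R" "b p < b i" "c i < c p" for i b c
  proof -
    define u v where "u = b i - b p" and "v = c p - c i"
    have uv: "u > 0" "v > 0" using that by (auto simp: u_def v_def)
    \<comment> \<open>The two differences have opposite signs, so this weight makes the
      \<open>p\<close>- and \<open>i\<close>-coordinates of the combination equal.\<close>
    define t where "t = u / (u + v)"
    have t: "0 \<le> t" "t \<le> 1" using uv by (auto simp: t_def)
    have "(1 - t) * u = t * v" using uv by (simp add: t_def field_simps)
    then have "(1 - t) * b p + t * c p = (1 - t) * b i + t * c i"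
      by (simp add: u_def v_def algebra_simps)
    then show ?thesis
      using conv[OF that(2,3) t] that(1) unfolding Z_def by (intro CollectI conjI bexI[of _ "\<lambda>i. (1 - t) * b i + t * c i"])
  qed
  have "(\<lambda>b. {i \<in> E. b i < b p}) ` {b \<in> R. b p \<notin> b ` E} = insert T (D ` Z)" (is "?I = _")
  proof (intro subset_antisym subsetI)
    fix X assume "X \<in> ?I"
    then obtain b where b: "b \<in> R" "b p \<notin> b ` E" and X: "X = {i \<in> E. b i < b p}" by blast
    \<comment> \<open>\<open>W\<close> holds the walls above \<open>b\<close> that can still be
      passed inside \<open>R\<close>. If there are none, \<open>b\<close> lies in the topmost piece;
      otherwise the lowest of them is the wall just above \<open>b\<close>.\<close>
    define W where "W = {i \<in> T. b p < b i}"
    show "X \<in> insert T (D ` Z)"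
    proof (cases "W = {}")
      case True
      have "X = T"
      proof (intro subset_antisym subsetI)
        fix i assume "i \<in> T"
        then have "\<not> b p < b i" "i \<in> E" using True by (auto simp: W_def T_def)
        then show "i \<in> X" using b(2) unfolding X by force
      qed (use b(1) X T_def in auto)
      then show ?thesis by simp
    next
      case False
      have finW: "finite W" using fin by (auto simp: W_def T_def)
      obtain z where z: "z \<in> W" and zmin: "\<And>i. i \<in> W \<Longrightarrow> b z \<le> b i"
        using finite_arg_min_real[OF finW False, of b] by blast
      obtain c where c: "c \<in> R" "c z < c p" and zE: "z \<in> E" using z by (auto simp: W_def T_def)
      have "z \<in> Z" using zero[OF zE b(1) c(1) _ c(2)] z by (auto simp: W_def)
      moreover have "X = D z"
      proof (intro subset_antisym subsetI)
        fix i assume "i \<in> X"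
        then have "i \<in> E" "b i < b z" using z by (auto simp: X W_def)
        then show "i \<in> D z" using ord[OF b0 b(1)] zE by (auto simp: D_def)
      next
        fix i assume "i \<in> D z"
        then have i: "i \<in> E" "b i < b z" "c i < c z"
          using ord[OF b0 b(1)] ord[OF b0 c(1)] zE by (auto simp: D_def)
        then have "i \<in> T" using c unfolding T_def by (intro CollectI conjI bexI[of _ c]) linarith+
        then have "\<not> b p < b i" using zmin[of i] i by (auto simp: W_def)
        moreover have "b p \<noteq> b i" using b(2) i by auto
        ultimately show "i \<in> X" using i by (auto simp: X)
      qed
      ultimately show ?thesis by blast
    qed
  next
    fix X assume "X \<in> insert T (D ` Z)"
    then consider "X = T" | z where "z \<in> Z" "X = D z" by blast
    then show "X \<in> ?I"
    proof cases
      case 1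
      \<comment> \<open>Outside \<open>T\<close> not even contact is possible: by
        \<open>cross\<close>, a point with \<open>b p = b i\<close> would put \<open>i\<close> into
        \<open>T\<close>.\<close>
      have off: "i \<notin> T \<Longrightarrow> i \<in> E \<Longrightarrow> b \<in> R \<Longrightarrow> b p < b i" for i b
        using cross[of b i] by (force simp: T_def)
      show ?thesis
      proof (cases "T = {}")
        case True
        have "{i \<in> E. b0 i < b0 p} = {}" using True b0 by (auto simp: T_def)
        moreover have "b0 p \<notin> b0 ` E" using off[OF _ _ b0] True by (metis empty_iff image_iff less_irrefl)
        ultimately show ?thesis using b0 1 True by (intro image_eqI[of _ _ b0]) auto
      next
        case False
        have finT: "finite T" using fin by (auto simp: T_def)
        \<comment> \<open>The coordinates in \<open>E\<close> are ordered alike throughout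
          \<open>R\<close>, so a point above the highest member of \<open>T\<close> is above all of
          \<open>T\<close>.\<close>
        obtain z where z: "z \<in> T" and zmax: "\<And>i. i \<in> T \<Longrightarrow> - b0 z \<le> - b0 i"
          using finite_arg_min_real[OF finT False, of "\<lambda>i. - b0 i"] by blast
        obtain c where c: "c \<in> R" "c z < c p" and zE: "z \<in> E" using z by (auto simp: T_def)
        have lt: "c i < c p" if "i \<in> T" for i
        proof -
          have "\<not> b0 z < b0 i" "i \<in> E" using zmax[OF that] that by (auto simp: T_def)
          then have "\<not> c z < c i" using ord[OF b0 c(1) zE] by blast
          then show ?thesis using c(2) by simp
        qed
        have "c p \<notin> c ` E"
        proof
          assume "c p \<in> c ` E"
          then obtain i where "i \<in> E" "c p = c i" by blast
          then show False using lt[of i] off[of i c] c(1) by fastforce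
        qed
        moreover have "X = {i \<in> E. c i < c p}"
        proof -
          have "i \<in> T \<longleftrightarrow> i \<in> E \<and> c i < c p" for i
            using lt[of i] c(1) by (auto simp: T_def)
          then show ?thesis using 1 by blast
        qed
        ultimately show ?thesis using c(1) by blast
      qed
    next
      case 2
      then obtain a where a: "a \<in> R" "a p = a z" and zE: "z \<in> E" by (auto simp: Z_def)
      obtain c where c: "c \<in> R" "c p < c z" using cross[OF a(1) zE a(2)] by blast
      \<comment> \<open>For \<open>i \<noteq> z\<close>, \<open>f i + t * h i\<close> is
        \<open>e p - e i\<close> times the sign of \<open>a p - a i\<close>, so its positivity says
        that the move from \<open>a\<close> towards \<open>c\<close> alters no comparison with
        \<open>p\<close>. At \<open>z\<close> the difference vanishes, so \<open>z\<close> gets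
        dummy values here; its sign after the move comes from \<open>c\<close>.\<close>
      define f where "f i = (if i = z then 1 else \<bar>a p - a i\<bar>)" for i
      define h where "h i = (if i = z then 0 else sgn (a p - a i) * ((c p - c i) - (a p - a i)))" for i
      have "0 < f i" if "i \<in> E" for i
        using inj_onD[OF inj[OF a(1)], of i z] a(2) that zE by (auto simp: f_def)
      then obtain t where t: "0 < t" "t < 1" and tp: "\<And>i. i \<in> E \<Longrightarrow> 0 < f i + t * h i"
        using exists_small_pos[OF fin, of f h] by blast
      define e where "e = (\<lambda>i. (1 - t) * a i + t * c i)"
      have eR: "e \<in> R" unfolding e_def using conv[OF a(1) c(1)] t by simp
      have diff: "e p - e i = (a p - a i) + t * ((c p - c i) - (a p - a i))" for i
        by (simp add: e_def algebra_simps)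
      have ez: "e p < e z"
      proof -
        have "e p - e z = t * (c p - c z)" using diff[of z] a(2) by (simp add: algebra_simps)
        moreover have "t * (c p - c z) < 0" using t c by (simp add: mult_pos_neg)
        ultimately show ?thesis by simp
      qed
      have pos: "0 < e p - e i" if "i \<in> E" "a i < a p" for i
        using tp[OF that(1)] that a(2) diff[of i] by (auto simp: f_def h_def split: if_splits)
      have neg: "e p - e i < 0" if "i \<in> E" "i \<noteq> z" "\<not> a i < a p" for i
      proof -
        have "a i \<noteq> a p" using inj_onD[OF inj[OF a(1)], of i z] a(2) that zE by auto
        then show ?thesis using tp[OF that(1)] that diff[of i]
          by (auto simp: f_def h_def algebra_simps split: if_splits)
      qed
      have "e p \<notin> e ` E"
      proof
        assume "e p \<in> e ` E"
        then obtain i where "i \<in> E" "e p = e i" by blast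
        then show False using pos[of i] neg[of i] ez by (cases "i = z"; cases "a i < a p") auto
      qed
      moreover have "X = {i \<in> E. e i < e p}"
      proof -
        have "i \<in> D z \<longleftrightarrow> e i < e p" if i: "i \<in> E" for i
        proof -
          have "i \<in> D z \<longleftrightarrow> a i < a p" using ord[OF b0 a(1) i zE] a(2) i by (simp add: D_def)
          also have "\<dots> \<longleftrightarrow> e i < e p"
            using pos[OF i] neg[OF i] ez a(2) by (cases "i = z"; cases "a i < a p") simp_all
          finally show ?thesis .
        qed
        then show ?thesis using 2(2) by (auto simp: D_def)
      qed
      ultimately show ?thesis using eR by blast
    qed
  qed
  moreover have "T \<notin> D ` Z"
  proof
    assume "T \<in> D ` Z"
    then obtain z where z: "z \<in> Z" "T = D z" by blast
    then obtain a where "a \<in> R" "a p = a z" "z \<in> E" by (auto simp: Z_def)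
    then have "z \<in> T" using cross[of a z] by (auto simp: T_def)
    then show False using z by (simp add: D_def)
  qed
  moreover have "inj_on D Z"
  proof (rule inj_onI)
    fix y z assume yz: "y \<in> Z" "z \<in> Z" "D y = D z"
    then have E: "y \<in> E" "z \<in> E" by (auto simp: Z_def)
    have "\<not> b0 y < b0 z" "\<not> b0 z < b0 y" using yz(3) E by (auto simp: D_def set_eq_iff)
    then show "y = z" using inj_onD[OF inj[OF b0]] E by force
  qed
  moreover have "finite Z" using fin by (simp add: Z_def)
  ultimately have "card ((\<lambda>b. {i \<in> E. b i < b p}) ` {b \<in> R. b p \<notin> b ` E}) = 1 + card Z"
    by (simp add: card_image)
  then show ?thesis by (simp only: Z_def)
qed

subsection \<open>The chamber recursion\<close>

text \<open>
  For type A (\<open>s = 1\<close>) the coordinates are indexed by \<open>1, \<dots>, n\<close>. For type B (\<open>s = 2\<close>) they are indexed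
  by \<open>-n, \<dots>, n\<close> and odd, so that the walls \<open>b\<^sub>i = b\<^sub>j\<close>, \<open>b\<^sub>i = - b\<^sub>j\<close> and \<open>b\<^sub>i = 0\<close> all take the form
  \<open>b\<^sub>p = b\<^sub>q\<close> and order types of injective \<open>b\<close> are Weyl chambers in both cases.
\<close>

definition index_set :: "nat \<Rightarrow> nat \<Rightarrow> int set" where
  "index_set s n = (if s = 1 then {1..int n} else {- int n..int n})"

definition ambient :: "nat \<Rightarrow> (int \<Rightarrow> real) set" where
  "ambient s = (if s = 1 then UNIV else {b. \<forall>i. b (- i) = - b i})"

lemma finite_index_set [simp]: "finite (index_set s n)" by (simp add: index_set_def)

lemma index_set_mono: "index_set s n \<subseteq> index_set s (Suc n)" by (auto simp: index_set_def)

lemma last_in_index_set: "int (Suc n) \<in> index_set s (Suc n)" by (auto simp: index_set_def)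

lemma lin_closed_ambient: "lin_closed (ambient s)"
  by (auto simp: lin_closed_def ambient_def algebra_simps)

lemma ambient_neg: "b \<in> ambient s \<Longrightarrow> s \<noteq> 1 \<Longrightarrow> b (- i) = - b i"
  by (simp add: ambient_def)

lemma ambient_0: "b \<in> ambient s \<Longrightarrow> s \<noteq> 1 \<Longrightarrow> b 0 = 0"
  using ambient_neg[of b s 0] by simp

lemma index_set_Suc:
  "index_set s (Suc n) = (if s = 1 then insert (int (Suc n)) (index_set s n)
     else insert (int (Suc n)) (insert (- int (Suc n)) (index_set s n)))"
  by (auto simp: index_set_def)

lemma index_set_neg: "s \<noteq> 1 \<Longrightarrow> i \<in> index_set s n \<Longrightarrow> - i \<in> index_set s n"
  by (auto simp: index_set_def)

lemma index_set_0: "s \<noteq> 1 \<Longrightarrow> 0 \<in> index_set s n"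
  by (auto simp: index_set_def)

text \<open>In type B the new coordinate \<open>-p\<close> needs no condition of its own: a
  collision of \<open>-p\<close> with \<open>i\<close> reflects to one of \<open>p\<close> with
  \<open>-i\<close>, and \<open>b p = b (-p)\<close> forces \<open>b p = 0 = b 0\<close>.\<close>

lemma inj_on_index_set_Suc:
  assumes "b \<in> ambient s"
  shows "inj_on b (index_set s (Suc n)) \<longleftrightarrow> inj_on b (index_set s n) \<and> b (int (Suc n)) \<notin> b ` index_set s n"
proof (cases "s = 1")
  case True
  have "int (Suc n) \<notin> index_set s n" using True by (simp add: index_set_def)
  then show ?thesis using True unfolding index_set_Suc if_P[OF True] by (subst inj_on_insert) simp
next
  case False
  define p where "p = int (Suc n)"
  have p: "p \<notin> index_set s n" "- p \<notin> index_set s n" "p \<noteq> - p" using False by (auto simp: index_set_def p_def)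
  have "b (- p) \<notin> b ` index_set s n \<and> b p \<noteq> b (- p)" if *: "b p \<notin> b ` index_set s n"
  proof
    show "b (- p) \<notin> b ` index_set s n"
    proof
      assume "b (- p) \<in> b ` index_set s n"
      then obtain i where i: "i \<in> index_set s n" "b (- p) = b i" by blast
      then have "b p = b (- i)" using ambient_neg[OF assms False, of i] ambient_neg[OF assms False, of p] by simp
      then show False using * index_set_neg[OF False i(1)] by blast
    qed
    show "b p \<noteq> b (- p)"
    proof
      assume "b p = b (- p)"
      then have "b p = b 0" using ambient_neg[OF assms False, of p] ambient_0[OF assms False] by simp
      then show False using * index_set_0[OF False] by blast
    qed
  qed
  moreover have "index_set s n - {p} = index_set s n" "insert (- p) (index_set s n) - {p} = insert (- p) (index_set s n)"
      "index_set s n - {- p} = index_set s n" using p by auto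
  ultimately show ?thesis unfolding index_set_Suc p_def[symmetric] if_not_P[OF False]
    by (auto simp: inj_on_insert)
qed

text \<open>Comparisons with \<open>-p\<close> reflect to comparisons with \<open>p\<close>, and
  \<open>p\<close> against \<open>-p\<close> is decided by the coordinate 0. Hence a region upstairs
  is a region downstairs together with one piece of its fibre.\<close>

lemma order_type_index_set_Suc:
  assumes b: "b \<in> ambient s" "b (int (Suc n)) \<notin> b ` index_set s n"
    and c: "c \<in> ambient s" "c (int (Suc n)) \<notin> c ` index_set s n"
  shows "order_type (index_set s (Suc n)) b = order_type (index_set s (Suc n)) c \<longleftrightarrow>
    order_type (index_set s n) b = order_type (index_set s n) c \<and>
    {i \<in> index_set s n. b i < b (int (Suc n))} = {i \<in> index_set s n. c i < c (int (Suc n))}"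
proof -
  define p where "p = int (Suc n)"
  note b = b[folded p_def] and c = c[folded p_def]
  have "order_type (index_set s (Suc n)) b = order_type (index_set s (Suc n)) c \<longleftrightarrow>
    order_type (index_set s n) b = order_type (index_set s n) c \<and>
    {i \<in> index_set s n. b i < b p} = {i \<in> index_set s n. c i < c p}" (is "?A \<longleftrightarrow> ?B")
  proof
    assume A: ?A
    have "order_type (index_set s n) b = order_type (index_set s n) c"
      using order_type_eqD[OF A] index_set_mono[of s n] by (intro order_type_eqI) blast
    moreover have "b i < b p \<longleftrightarrow> c i < c p" if "i \<in> index_set s n" for i
      using order_type_eqD[OF A, of i p] that index_set_mono[of s n] last_in_index_set[of n s] unfolding p_def by blast
    ultimately show ?B by blast
  next
    assume B: ?B
    have lt: "b i < b p \<longleftrightarrow> c i < c p" if "i \<in> index_set s n" for i using B that by blast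
    have gt: "b p < b i \<longleftrightarrow> c p < c i" if i: "i \<in> index_set s n" for i
    proof -
      have "b p \<noteq> b i" "c p \<noteq> c i" using b(2) c(2) i by auto
      then show ?thesis using lt[OF i] by linarith
    qed
    have old: "b i < b j \<longleftrightarrow> c i < c j" if "i \<in> index_set s n" "j \<in> index_set s n" for i j
      using B that order_type_eqD by blast
    show ?A
    proof (rule order_type_eqI)
      fix i j assume ij: "i \<in> index_set s (Suc n)" "j \<in> index_set s (Suc n)"
      show "b i < b j \<longleftrightarrow> c i < c j"
      proof (cases "s = 1")
        case True
        then show ?thesis using ij lt gt old unfolding index_set_Suc p_def[symmetric] by auto
      next
        case False
        have neg: "b (- p) = - b p" "c (- p) = - c p" using b(1) c(1) False by (auto simp: ambient_neg)
        have "- b p < b i \<longleftrightarrow> - c p < c i" "b i < - b p \<longleftrightarrow> c i < - c p" if i: "i \<in> index_set s n" for i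
          using lt[OF index_set_neg[OF False i]] gt[OF index_set_neg[OF False i]]
            ambient_neg[OF b(1) False, of i] ambient_neg[OF c(1) False, of i] by auto
        moreover have "- b p < b p \<longleftrightarrow> - c p < c p" "b p < - b p \<longleftrightarrow> c p < - c p"
          using lt[OF index_set_0[OF False]] gt[OF index_set_0[OF False]] ambient_0[OF b(1) False] ambient_0[OF c(1) False]
          by auto
        ultimately show ?thesis
          using ij lt gt old False neg unfolding index_set_Suc p_def[symmetric] by auto
      qed
    qed
  qed
  then show ?thesis unfolding p_def .
qed

section \<open>Counting regions fibre by fibre\<close>

lemma perturb:
  assumes "lin_closed L" "b \<in> L" "e \<in> L" "finite E" "inj_on b E"
  shows "\<exists>t>0. (\<lambda>i. b i + t * e i) \<in> L \<and> order_type E (\<lambda>i. b i + t * e i) = order_type E b"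
proof -
  define I where "I = {(i, j). i \<in> E \<and> j \<in> E \<and> b i < b j}"
  have "finite I" by (rule finite_subset[of _ "E \<times> E"]) (use assms in \<open>auto simp: I_def\<close>)
  moreover have "0 < b (snd x) - b (fst x)" if "x \<in> I" for x using that by (auto simp: I_def)
  ultimately obtain t where t: "0 < t"
      "\<And>x. x \<in> I \<Longrightarrow> 0 < b (snd x) - b (fst x) + t * (e (snd x) - e (fst x))"
    using exists_small_pos[of I "\<lambda>x. b (snd x) - b (fst x)" "\<lambda>x. e (snd x) - e (fst x)"] by blast
  have mono: "b i + t * e i < b j + t * e j" if "i \<in> E" "j \<in> E" "b i < b j" for i j
    using t(2)[of "(i, j)"] that by (simp add: I_def algebra_simps)
  have "order_type E (\<lambda>i. b i + t * e i) = order_type E b"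
  proof (rule order_type_eqI)
    fix i j assume ij: "i \<in> E" "j \<in> E"
    show "(b i + t * e i < b j + t * e j) = (b i < b j)"
      using mono[OF ij] mono[OF ij(2,1)] inj_onD[OF assms(5) _ ij]
      by (cases "b i" "b j" rule: linorder_cases) auto
  qed
  moreover have "(\<lambda>i. b i + t * e i) \<in> L" using lin_closedD[OF assms(1-3), of 1 t] by simp
  ultimately show ?thesis using t(1) by blast
qed

lemma card_image_eq_kernel:
  assumes "\<And>b c. b \<in> X \<Longrightarrow> c \<in> X \<Longrightarrow> f b = f c \<longleftrightarrow> g b = g c"
  shows "card (f ` X) = card (g ` X)"
proof -
  have "bij_betw (\<lambda>y. g (inv_into X f y)) (f ` X) (g ` X)"
  proof (rule bij_betw_imageI)
    have eq: "g (inv_into X f (f b)) = g b" if "b \<in> X" for b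
      using assms[of "inv_into X f (f b)" b] that by (simp add: inv_into_into f_inv_into_f)
    then show "inj_on (\<lambda>y. g (inv_into X f y)) (f ` X)"
      using assms by (intro inj_onI) (auto simp del: inv_into_f_f)
    show "(\<lambda>y. g (inv_into X f y)) ` f ` X = g ` X"
      unfolding image_image using eq by (intro image_cong) auto
  qed
  then show ?thesis by (rule bij_betw_same_card)
qed

text \<open>The points of \<open>L\<close> over one region of the smaller arrangement form a convex
  set, to which \<open>piece_count\<close> applies. The hypothesis \<open>cross\<close> states that
  a wall which is met is met transversally, so that points on both sides exist.\<close>

lemma regions_Suc:
  assumes "L \<subseteq> ambient s" and lin: "lin_closed L"
    and cross: "\<And>i b. i \<in> index_set s n \<Longrightarrow> b \<in> L \<Longrightarrow> inj_on b (index_set s n) \<Longrightarrow> b (int (Suc n)) = b i \<Longrightarrow>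
      \<exists>e\<in>L. e (int (Suc n)) \<noteq> e i"
  shows "card (regions (index_set s (Suc n)) L) = card (regions (index_set s n) L) +
    (\<Sum>i\<in>index_set s n. card (regions (index_set s n) {b \<in> L. b (int (Suc n)) = b i}))"
proof -
  define p where "p = int (Suc n)"
  define E where "E = index_set s n"
  define X where "X = {b \<in> L. inj_on b E \<and> b p \<notin> b ` E}"
  define Rg where "Rg r = {b \<in> L. inj_on b E \<and> order_type E b = r}" for r
  define pr where "pr b = (order_type E b, {i \<in> E. b i < b p})" for b
  define ds where "ds r = (\<lambda>b. {i \<in> E. b i < b p}) ` {b \<in> Rg r. b p \<notin> b ` E}" for r
  have finE: "finite E" by (simp add: E_def)
  have X_eq: "X = {b \<in> L. inj_on b (index_set s (Suc n))}"
    using inj_on_index_set_Suc assms(1) unfolding X_def E_def p_def by blast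
  have ker: "order_type (index_set s (Suc n)) b = order_type (index_set s (Suc n)) c \<longleftrightarrow> pr b = pr c"
    if "b \<in> X" "c \<in> X" for b c
    using that order_type_index_set_Suc[of b s n c] assms(1) unfolding X_def E_def p_def pr_def by blast
  have "card (regions (index_set s (Suc n)) L) = card (pr ` X)"
    using card_image_eq_kernel[of X, OF ker] by (simp add: regions_def X_eq)
  also have "pr ` X = Sigma (regions E L) ds"
  proof (intro subset_antisym subsetI)
    fix z assume "z \<in> pr ` X"
    then obtain b where b: "b \<in> X" "z = pr b" by blast
    then have "b \<in> {b \<in> Rg (order_type E b). b p \<notin> b ` E}" "order_type E b \<in> regions E L"
      by (auto simp: X_def Rg_def regions_def)
    then show "z \<in> Sigma (regions E L) ds" unfolding b(2) pr_def ds_def by blast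
  next
    fix z assume "z \<in> Sigma (regions E L) ds"
    then obtain b where b: "b \<in> Rg (fst z)" "b p \<notin> b ` E" "snd z = {i \<in> E. b i < b p}"
      by (auto simp: ds_def)
    then have "b \<in> X" "z = pr b" by (auto simp: X_def Rg_def pr_def prod_eq_iff)
    then show "z \<in> pr ` X" by blast
  qed
  also have "card \<dots> = (\<Sum>r\<in>regions E L. card (ds r))"
    by (rule card_SigmaI) (auto simp: finite_regions finE ds_def intro!: finite_subset[of _ "Pow E"])
  also have "\<dots> = (\<Sum>r\<in>regions E L. 1 + card {i \<in> E. \<exists>b\<in>Rg r. b p = b i})"
  proof (rule sum.cong[OF refl])
    fix r assume r: "r \<in> regions E L"
    show "card (ds r) = 1 + card {i \<in> E. \<exists>b\<in>Rg r. b p = b i}"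
      unfolding ds_def
    proof (rule piece_count[OF finE])
      show "Rg r \<noteq> {}" using r by (auto simp: regions_def Rg_def)
      show "inj_on b E" if "b \<in> Rg r" for b using that by (simp add: Rg_def)
      show ord: "b i < b j \<longleftrightarrow> c i < c j" if "b \<in> Rg r" "c \<in> Rg r" "i \<in> E" "j \<in> E" for b c i j
        using that order_type_eqD[of E b c i j] by (simp add: Rg_def)
      show "(\<lambda>i. (1 - t) * b i + t * c i) \<in> Rg r"
        if *: "b \<in> Rg r" "c \<in> Rg r" "0 \<le> t" "t \<le> 1" for b c and t :: real
      proof -
        have lt: "(1 - t) * b i + t * c i < (1 - t) * b j + t * c j"
          if "i \<in> E" "j \<in> E" "b i < b j" for i j
        proof (cases "t = 0")
          case False
          have "c i < c j" using ord[OF *(1,2) that(1,2)] that(3) by simp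
          then have "t * c i < t * c j" using False *(3) by simp
          moreover have "(1 - t) * b i \<le> (1 - t) * b j" using *(4) that(3) by (simp add: mult_left_mono)
          ultimately show ?thesis by simp
        qed (use that in simp)
        have inj: "inj_on b E" using *(1) by (simp add: Rg_def)
        have "order_type E b = order_type E (\<lambda>i. (1 - t) * b i + t * c i)"
        proof (rule order_type_eqI)
          fix i j assume ij: "i \<in> E" "j \<in> E"
          show "(b i < b j) = ((1 - t) * b i + t * c i < (1 - t) * b j + t * c j)"
            using lt[OF ij] lt[OF ij(2,1)] inj_onD[OF inj _ ij]
            by (cases "b i" "b j" rule: linorder_cases) auto
        qed
        moreover have "(\<lambda>i. (1 - t) * b i + t * c i) \<in> L"
          using *(1,2) lin_closedD[OF lin] by (simp add: Rg_def)
        ultimately show ?thesis using order_type_inj[OF _ inj] *(1) by (simp add: Rg_def)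
      qed
      show "(\<exists>c\<in>Rg r. c p < c i) \<and> (\<exists>c\<in>Rg r. c i < c p)"
        if *: "b \<in> Rg r" "i \<in> E" "b p = b i" for b i
      proof -
        have b: "b \<in> L" "inj_on b E" using *(1) by (auto simp: Rg_def)
        obtain e where e: "e \<in> L" "e p \<noteq> e i"
          using cross[of i b] * b unfolding p_def E_def by blast
        \<comment> \<open>Since \<open>b\<close> is injective on \<open>E\<close>, small steps along
          any direction of \<open>L\<close> stay in the region. A direction separating
          \<open>p\<close> from \<open>i\<close>, together with its negative, reaches both sides of
          the wall.\<close>
        have move: "\<exists>t>0. (\<lambda>i. b i + t * f i) \<in> Rg r" if f: "f \<in> L" for f
        proof -
          obtain t where t: "t > 0" "(\<lambda>i. b i + t * f i) \<in> L" "order_type E (\<lambda>i. b i + t * f i) = order_type E b"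
            using perturb[OF lin b(1) f finE b(2)] by blast
          then show ?thesis using order_type_inj[OF t(3)[symmetric] b(2)] *(1) by (auto simp: Rg_def)
        qed
        have "\<exists>e\<in>L. e p < e i" "\<exists>e\<in>L. e i < e p"
        proof -
          have "(\<lambda>i. - e i) \<in> L" using lin_closedD[OF lin e(1) e(1), of "-1" 0] by simp
          then have neg: "\<exists>f\<in>L. f p = - e p \<and> f i = - e i" by (intro bexI[of _ "\<lambda>i. - e i"]) auto
          show "\<exists>e\<in>L. e p < e i" "\<exists>e\<in>L. e i < e p"
          proof (atomize (full), cases "e p < e i")
            case True
            then show "(\<exists>e\<in>L. e p < e i) \<and> (\<exists>e\<in>L. e i < e p)"
              using neg e(1) by (metis neg_less_iff_less)
          next
            case False
            then have "e i < e p" using e(2) by simp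
            then show "(\<exists>e\<in>L. e p < e i) \<and> (\<exists>e\<in>L. e i < e p)"
              using neg e(1) by (metis neg_less_iff_less)
          qed
        qed
        then obtain f g where fg: "f \<in> L" "f p < f i" "g \<in> L" "g i < g p" by blast
        obtain t where t: "t > 0" "(\<lambda>i. b i + t * f i) \<in> Rg r" using move[OF fg(1)] by blast
        obtain u where u: "u > 0" "(\<lambda>i. b i + u * g i) \<in> Rg r" using move[OF fg(3)] by blast
        have "b p + t * f p < b i + t * f i" "b i + u * g i < b p + u * g p"
          using *(3) t(1) u(1) fg by auto
        then show ?thesis
          by (intro conjI bexI[OF _ t(2)] bexI[OF _ u(2)])
      qed
    qed
  qed
  also have "\<dots> = card (regions E L) + (\<Sum>r\<in>regions E L. card {i \<in> E. \<exists>b\<in>Rg r. b p = b i})"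
    unfolding sum.distrib by simp
  also have "(\<Sum>r\<in>regions E L. card {i \<in> E. \<exists>b\<in>Rg r. b p = b i})
      = (\<Sum>r\<in>regions E L. \<Sum>i\<in>E. if \<exists>b\<in>Rg r. b p = b i then 1 else 0)"
    using finE by (intro sum.cong refl) (simp add: sum.If_cases Int_def)
  \<comment> \<open>Double counting: for a fixed wall, the regions that it crosses are exactly the
    regions of the section of \<open>L\<close> by that wall.\<close>
  also have "\<dots> = (\<Sum>i\<in>E. \<Sum>r\<in>regions E L. if \<exists>b\<in>Rg r. b p = b i then 1 else 0)"
    by (rule sum.swap)
  also have "\<dots> = (\<Sum>i\<in>E. card (regions E {b \<in> L. b p = b i}))"
  proof (rule sum.cong[OF refl])
    fix i assume "i \<in> E"
    have "regions E {b \<in> L. b p = b i} = {r \<in> regions E L. \<exists>b\<in>Rg r. b p = b i}"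
      by (auto simp: regions_def Rg_def)
    then show "(\<Sum>r\<in>regions E L. if \<exists>b\<in>Rg r. b p = b i then 1 else 0)
        = card (regions E {b \<in> L. b p = b i})"
      using finite_regions[OF finE] by (simp add: sum.If_cases Int_def)
  qed
  finally show ?thesis unfolding E_def p_def .
qed

text \<open>
  The last condition says that \<open>L\<close> has codimension at most \<open>d\<close>; the one before it says that \<open>L\<close> meets
  the flats of dimension at most \<open>d\<close> (modulo constants in type A) trivially, since a vector of such a flat takes at most \<open>s d + s\<close> values.
\<close>

definition generic :: "nat \<Rightarrow> nat \<Rightarrow> nat \<Rightarrow> (int \<Rightarrow> real) set \<Rightarrow> bool" where
  "generic s n d L \<longleftrightarrow> L \<subseteq> ambient s \<and> lin_closed L \<and>
    (\<forall>b\<in>L. \<forall>i\<in>index_set s n. \<forall>j\<in>index_set s n. b i \<noteq> b j \<longrightarrow> s * d + s + 1 \<le> card (b ` index_set s n)) \<and>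
    (\<forall>y. (\<forall>j\<le>d. y j \<in> ambient s) \<longrightarrow>
      (\<exists>l. (\<exists>j\<le>d. l j \<noteq> 0) \<and> (\<exists>b\<in>L. \<forall>i\<in>index_set s n. b i = (\<Sum>j\<le>d. l j * y j i))))"

text \<open>The entry -1 at \<open>-p\<close> makes the vector odd, as membership in
  \<open>ambient\<close> demands for type B.\<close>

definition unit_vec :: "nat \<Rightarrow> int \<Rightarrow> int \<Rightarrow> real" where
  "unit_vec s p i = (if i = p then 1 else if s \<noteq> 1 \<and> i = - p then -1 else 0)"

lemma genericD:
  assumes "generic s n d L"
  shows "L \<subseteq> ambient s" "lin_closed L"
    "\<And>b i j. b \<in> L \<Longrightarrow> i \<in> index_set s n \<Longrightarrow> j \<in> index_set s n \<Longrightarrow> b i \<noteq> b j \<Longrightarrow> s * d + s + 1 \<le> card (b ` index_set s n)"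
  using assms unfolding generic_def by blast+

lemma generic_codim:
  assumes "generic s n d L" "\<And>j. j \<le> d \<Longrightarrow> y j \<in> ambient s"
  obtains l b where "\<exists>j\<le>d. l j \<noteq> (0::real)" "b \<in> L" "\<And>i. i \<in> index_set s n \<Longrightarrow> b i = (\<Sum>j\<le>d. l j * y j i)"
proof -
  have "\<forall>y. (\<forall>j\<le>d. y j \<in> ambient s) \<longrightarrow>
      (\<exists>l. (\<exists>j\<le>d. l j \<noteq> 0) \<and> (\<exists>b\<in>L. \<forall>i\<in>index_set s n. b i = (\<Sum>j\<le>d. l j * y j i)))"
    using assms(1) unfolding generic_def by (elim conjE)
  from this[THEN spec, of y] have "\<exists>l. (\<exists>j\<le>d. l j \<noteq> 0) \<and> (\<exists>b\<in>L. \<forall>i\<in>index_set s n. b i = (\<Sum>j\<le>d. l j * y j i))"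
    using assms(2) by simp
  then obtain l where l: "(\<exists>j\<le>d. l j \<noteq> 0) \<and> (\<exists>b\<in>L. \<forall>i\<in>index_set s n. b i = (\<Sum>j\<le>d. l j * y j i))"
    by (rule exE)
  obtain b where b: "b \<in> L" "\<forall>i\<in>index_set s n. b i = (\<Sum>j\<le>d. l j * y j i)"
    using conjunct2[OF l] by (rule bexE)
  show thesis by (rule that[OF conjunct1[OF l] b(1) b(2)[THEN bspec]])
qed

lemma unit_vec_ambient: "p \<noteq> 0 \<Longrightarrow> unit_vec s p \<in> ambient s"
  by (auto simp: ambient_def unit_vec_def)

lemma unit_vec_self [simp]: "unit_vec s p p = 1"
  by (simp add: unit_vec_def)

lemma unit_vec_last: "i \<in> index_set s n \<Longrightarrow> unit_vec s (int (Suc n)) i = 0"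
  by (auto simp: unit_vec_def index_set_def split: if_splits)

lemma unit_vec_pos: "0 < p \<Longrightarrow> 0 < i \<Longrightarrow> unit_vec s p i = (if i = p then 1 else 0)"
  by (auto simp: unit_vec_def)

lemma card_index_set: "s \<in> {1, 2} \<Longrightarrow> card (index_set s n) = s * n + s - 1"
  by (auto simp: index_set_def)

section \<open>General position under deletion and wall sections; transversality\<close>

lemma card_symmetric:
  fixes V :: "real set"
  assumes "s \<in> {1, 2}" "finite V" "W \<subseteq> insert 0 (if s = 1 then V else V \<union> uminus ` V)"
  shows "card W \<le> s * card V + 1"
proof -
  have fin: "finite (if s = 1 then V else V \<union> uminus ` V)" using assms(2) by simp
  have "card W \<le> card (insert 0 (if s = 1 then V else V \<union> uminus ` V))"
    using assms(3) fin by (intro card_mono) auto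
  also have "\<dots> \<le> 1 + card (if s = 1 then V else V \<union> uminus ` V)"
    using fin by (simp add: card_insert_if)
  also have "card (if s = 1 then V else V \<union> uminus ` V) \<le> s * card V"
    using assms(1) card_Un_le[of V "uminus ` V"] card_image_le[OF assms(2), of uminus] by auto
  finally show ?thesis by simp
qed

text \<open>Deleting a coordinate, with its negative in type B, loses at most \<open>s\<close>
  values, which matches lowering \<open>d\<close> by one. The codimension drops because the unit
  vector of the deleted coordinate serves as an additional test vector.\<close>

lemma generic_restrict:
  assumes s: "s \<in> {1, 2}" and "n \<ge> 1" and g: "generic s (Suc n) (Suc d) L"
  shows "generic s n d L"
  unfolding generic_def
proof (intro conjI ballI allI impI)
  fix b i j assume *: "b \<in> L" "i \<in> index_set s n" "j \<in> index_set s n" "b i \<noteq> b j"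
  then have "s * Suc d + s + 1 \<le> card (b ` index_set s (Suc n))"
    using genericD(3)[OF g] index_set_mono[of s n] by blast
  also have "card (b ` index_set s (Suc n)) \<le> card (b ` index_set s n) + s"
    using s unfolding index_set_Suc by (auto simp: card_insert_if)
  finally show "s * d + s + 1 \<le> card (b ` index_set s n)" by simp
next
  fix y :: "nat \<Rightarrow> int \<Rightarrow> real" assume y: "\<forall>j\<le>d. y j \<in> ambient s"
  define z where "z j = (if j \<le> d then y j else unit_vec s (int (Suc n)))" for j
  have "z j \<in> ambient s" if "j \<le> Suc d" for j using y that unit_vec_ambient by (auto simp: z_def)
  then obtain l b where l: "\<exists>j\<le>Suc d. l j \<noteq> 0" and b: "b \<in> L"
      and eq: "\<And>i. i \<in> index_set s (Suc n) \<Longrightarrow> b i = (\<Sum>j\<le>Suc d. l j * z j i)"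
    using generic_codim[OF g, of z] by blast
  have eq': "b i = (\<Sum>j\<le>d. l j * y j i) + l (Suc d) * unit_vec s (int (Suc n)) i"
    if "i \<in> index_set s (Suc n)" for i
    using eq[OF that] by (simp add: z_def)
  \<comment> \<open>Otherwise a vector of \<open>L\<close> would be a nonzero multiple of that unit
    vector on the index set, with at most \<open>s + 1\<close> values.\<close>
  have "\<exists>j\<le>d. l j \<noteq> 0"
  proof (rule ccontr)
    assume "\<not> (\<exists>j\<le>d. l j \<noteq> 0)"
    then have zero: "\<And>j. j \<le> d \<Longrightarrow> l j = 0" by blast
    with l have l0: "l (Suc d) \<noteq> 0" by (metis le_SucE)
    have bi: "b i = l (Suc d) * unit_vec s (int (Suc n)) i" if "i \<in> index_set s (Suc n)" for i
      using eq'[OF that] zero by simp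
    have one: "1 \<in> index_set s n" using assms(2) by (auto simp: index_set_def)
    have "b (int (Suc n)) \<noteq> b 1"
      using bi[OF last_in_index_set] bi[of 1] one index_set_mono[of s n] unit_vec_last[OF one] l0 by auto
    then have "s * Suc d + s + 1 \<le> card (b ` index_set s (Suc n))"
      using genericD(3)[OF g b last_in_index_set] one index_set_mono[of s n] by blast
    also have "\<dots> \<le> s * card {l (Suc d)} + 1"
    proof (rule card_symmetric[OF s])
      have val: "unit_vec s p x = 0 \<or> unit_vec s p x = 1 \<or> s \<noteq> 1 \<and> unit_vec s p x = -1" for p x
        by (simp add: unit_vec_def)
      show "b ` index_set s (Suc n) \<subseteq> insert 0 (if s = 1 then {l (Suc d)} else {l (Suc d)} \<union> uminus ` {l (Suc d)})"
      proof (intro image_subsetI)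
        fix x assume "x \<in> index_set s (Suc n)"
        from bi[OF this] val[of "int (Suc n)" x]
        show "b x \<in> insert 0 (if s = 1 then {l (Suc d)} else {l (Suc d)} \<union> uminus ` {l (Suc d)})" by auto
      qed
    qed simp
    finally show False using s by auto
  qed
  moreover have "b i = (\<Sum>j\<le>d. l j * y j i)" if "i \<in> index_set s n" for i
    using eq'[of i] that index_set_mono[of s n] unit_vec_last[OF that] by auto
  ultimately show "\<exists>l. (\<exists>j\<le>d. l j \<noteq> 0) \<and> (\<exists>b\<in>L. \<forall>i\<in>index_set s n. b i = (\<Sum>j\<le>d. l j * y j i))"
    using b by blast
qed (use genericD[OF g] in auto)

lemma ambient_card_image:
  assumes s: "s \<in> {1, 2}" and ambient: "b \<in> ambient s" and ij: "i \<in> index_set s n" "j \<in> index_set s n" "b i \<noteq> b j"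
  shows "s + 1 \<le> card (b ` index_set s n)"
proof (cases "s = 1")
  case True
  have "card {b i, b j} \<le> card (b ` index_set s n)" using ij by (intro card_mono) auto
  then show ?thesis using ij True by simp
next
  case False
  obtain k where k: "k \<in> index_set s n" "b k \<noteq> 0" using ij by (cases "b i = 0") auto
  have "card {b k, b (- k), b 0} \<le> card (b ` index_set s n)"
    using k(1) index_set_neg[OF False k(1)] index_set_0[OF False] by (intro card_mono) auto
  then show ?thesis using k(2) ambient_neg[OF ambient False, of k] ambient_0[OF ambient False] s False by simp
qed

text \<open>Here the codimension cannot drop further. The required bound is \<open>s + 1\<close>,
  which every vector of \<open>ambient\<close> that is nonconstant on the index set
  satisfies.\<close>

lemma generic_restrict_0:
  assumes s: "s \<in> {1, 2}" and g: "generic s (Suc n) 0 L"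
  shows "generic s n 0 L"
  unfolding generic_def
proof (intro conjI ballI allI impI)
  fix b i j assume b: "b \<in> L" and ij: "i \<in> index_set s n" "j \<in> index_set s n" "b i \<noteq> b j"
  then show "s * 0 + s + 1 \<le> card (b ` index_set s n)"
    using ambient_card_image[OF s _ ij] genericD(1)[OF g] by auto
next
  fix y :: "nat \<Rightarrow> int \<Rightarrow> real" assume "\<forall>j\<le>0. y j \<in> ambient s"
  then obtain l b where "\<exists>j\<le>0. l j \<noteq> 0" "b \<in> L" "\<And>i. i \<in> index_set s (Suc n) \<Longrightarrow> b i = (\<Sum>j\<le>0. l j * y j i)"
    using generic_codim[OF g, of y] by blast
  then show "\<exists>l. (\<exists>j\<le>0. l j \<noteq> 0) \<and> (\<exists>b\<in>L. \<forall>i\<in>index_set s n. b i = (\<Sum>j\<le>0. l j * y j i))"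
    using index_set_mono[of s n] by blast
qed (use genericD[OF g] in auto)

text \<open>On the wall the last coordinate repeats the value at \<open>i\<close> (and its negative
  the value at \<open>-i\<close>), so forgetting it loses no value and no vector direction.\<close>

lemma generic_hyperplane:
  assumes s: "s \<in> {1, 2}" and g: "generic s (Suc n) d L" and i: "i \<in> index_set s n"
  shows "generic s n d {b \<in> L. b (int (Suc n)) = b i}"
  unfolding generic_def
proof (intro conjI ballI allI impI)
  fix b j k assume b: "b \<in> {b \<in> L. b (int (Suc n)) = b i}" and jk: "j \<in> index_set s n" "k \<in> index_set s n" "b j \<noteq> b k"
  have ambient: "b \<in> ambient s" using genericD(1)[OF g] b by blast
  have "s * d + s + 1 \<le> card (b ` index_set s (Suc n))"
    using genericD(3)[OF g] b jk index_set_mono[of s n] by blast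
  also have "b ` index_set s (Suc n) = b ` index_set s n"
  proof (cases "s = 1")
    case False
    have "b (- int (Suc n)) = b (- i)"
      using ambient_neg[OF ambient False, of i] ambient_neg[OF ambient False, of "int (Suc n)"] b by simp
    then show ?thesis using b i index_set_neg[OF False i] False unfolding index_set_Suc by auto
  qed (use b i in \<open>auto simp: index_set_Suc\<close>)
  finally show "s * d + s + 1 \<le> card (b ` index_set s n)" .
next
  define p where "p = int (Suc n)"
  fix y :: "nat \<Rightarrow> int \<Rightarrow> real" assume y: "\<forall>j\<le>d. y j \<in> ambient s"
  \<comment> \<open>Each test vector is extended to \<open>p\<close> by copying its value at
    \<open>i\<close>; any combination of the extensions that agrees with a vector of
    \<open>L\<close> puts that vector on the wall.\<close>
  define z where "z j k = (if k = p then y j i else if s \<noteq> 1 \<and> k = - p then - y j i else y j k)" for j k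
  have "z j \<in> ambient s" if "j \<le> d" for j
    using y that by (auto simp: z_def ambient_def p_def)
  then obtain l b where l: "\<exists>j\<le>d. l j \<noteq> 0" and b: "b \<in> L"
      and eq: "\<And>i. i \<in> index_set s (Suc n) \<Longrightarrow> b i = (\<Sum>j\<le>d. l j * z j i)"
    using generic_codim[OF g, of z] by blast
  have old: "z j k = y j k" if "k \<in> index_set s n" for j k
    using that by (auto simp: z_def p_def index_set_def split: if_splits)
  have eq': "b k = (\<Sum>j\<le>d. l j * y j k)" if "k \<in> index_set s n" for k
    using eq[of k] old[OF that] index_set_mono[of s n] that by auto
  moreover have "b p = b i" using eq'[OF i] eq[of p] last_in_index_set[of n s] by (simp add: z_def p_def)
  ultimately show "\<exists>l. (\<exists>j\<le>d. l j \<noteq> 0) \<and>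
      (\<exists>b\<in>{b \<in> L. b (int (Suc n)) = b i}. \<forall>i\<in>index_set s n. b i = (\<Sum>j\<le>d. l j * y j i))"
    using l b unfolding p_def by blast
next
  show "lin_closed {b \<in> L. b (int (Suc n)) = b i}"
    using genericD(2)[OF g] unfolding lin_closed_def by simp
qed (use genericD[OF g] in auto)

text \<open>Suppose \<open>L\<close> lies inside the wall. The codimension condition yields a vector
  of \<open>L\<close> supported on \<open>d + 1\<close> positive coordinates and their negatives;
  choosing \<open>p\<close> and the coordinate of \<open>i\<close> among them,
  \<open>e p = e i\<close> costs a value and the bound in \<open>generic\<close> fails. For
  \<open>d = 0\<close> a multiple of the unit vector at \<open>p\<close> is already off the
  wall.\<close>

lemma generic_crossing:
  assumes s: "s \<in> {1, 2}" and g: "generic s (Suc n) d L" and i: "i \<in> index_set s n"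
    and d: "d = 0 \<or> 3 - s \<le> n"
    and b: "b \<in> L" "inj_on b (index_set s n)" "b (int (Suc n)) = b i"
  shows "\<exists>e\<in>L. e (int (Suc n)) \<noteq> e i"
proof (rule ccontr)
  define p where "p = int (Suc n)"
  assume "\<not> ?thesis"
  then have flat: "e p = e i" if "e \<in> L" for e using that unfolding p_def by blast
  show False
  proof (cases "d = 0")
    case True
    obtain l e where l: "\<exists>j\<le>d. l j \<noteq> 0" and e: "e \<in> L"
      and eq: "\<And>i. i \<in> index_set s (Suc n) \<Longrightarrow> e i = (\<Sum>j\<le>d. l j * unit_vec s p i)"
      using generic_codim[OF g, of "\<lambda>_. unit_vec s p"] unit_vec_ambient[of p s] unfolding p_def by auto
    have "e p = l 0" "e i = 0"
      using eq[of p] eq[of i] True i index_set_mono[of s n] last_in_index_set[of n s] unit_vec_last[OF i]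
      unfolding p_def by auto
    then show False using flat[OF e] l True by simp
  next
    case False
    have ns: "3 - s \<le> n" using d False by simp
    have "generic s n d L"
    proof -
      have "{b \<in> L. b (int (Suc n)) = b i} = L" using flat p_def by blast
      then show ?thesis using generic_hyperplane[OF s g i] by simp
    qed
    note g' = this
    obtain j k where jk: "j \<in> index_set s n" "k \<in> index_set s n" "j \<noteq> k"
    proof (cases "s = 1")
      case True
      then have "1 \<in> index_set s n" "2 \<in> index_set s n" using ns by (auto simp: index_set_def)
      then show thesis using that[of 1 2] by simp
    next
      case F: False
      then have "0 \<in> index_set s n" "1 \<in> index_set s n" using ns s by (auto simp: index_set_def)
      then show thesis using that[of 0 1] by simp
    qed
    then have "b j \<noteq> b k" using inj_onD[OF b(2)] by blast
    then have "s * d + s + 1 \<le> card (b ` index_set s n)" using genericD(3)[OF g' b(1) jk(1,2)] by simp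
    also have "card (b ` index_set s n) = s * n + s - 1" using card_image[OF b(2)] card_index_set[OF s] by simp
    \<comment> \<open>The injective \<open>b\<close> shows that there is room: \<open>d < n\<close>
      leaves a coordinate \<open>q\<close> outside the support \<open>K\<close>, where
      \<open>e\<close> vanishes, so \<open>e\<close> is not constant.\<close>
    finally have dn: "d < n" using s by auto
    \<comment> \<open>The index 0 occurs only in type B, carries the value 0 and therefore takes no
      place in \<open>K\<close>.\<close>
    define B where "B = (if i = 0 then {} else {\<bar>i\<bar>})"
    have B: "B \<subseteq> {1..int n}" "card B \<le> d" "finite B" using i False by (auto simp: B_def index_set_def split: if_splits)
    obtain K where K: "B \<subseteq> K" "K \<subseteq> {1..int n}" "card K = d"
      using exists_subset_between[of B d "{1..int n}"] B dn by auto
    have finK: "finite K" using K(2) finite_subset by blast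
    have "p \<notin> K" using K(2) by (auto simp: p_def)
    then have "card (insert p K) = card {..d}" using K(3) finK by simp
    then obtain f where f: "bij_betw f {..d} (insert p K)"
      using finite_same_card_bij[of "{..d}" "insert p K"] finK by auto
    have fpos: "0 < f j" if "j \<le> d" for j
      using bij_betwE[OF f] that K(2) by (force simp: p_def)
    have "unit_vec s (f j) \<in> ambient s" if "j \<le> d" for j using fpos[OF that] unit_vec_ambient by force
    then obtain l e where l: "\<exists>j\<le>d. l j \<noteq> 0" and e: "e \<in> L"
      and eq: "\<And>i. i \<in> index_set s (Suc n) \<Longrightarrow> e i = (\<Sum>j\<le>d. l j * unit_vec s (f j) i)"
      using generic_codim[OF g, of "\<lambda>j. unit_vec s (f j)"] by blast
    have ambient: "e \<in> ambient s" using genericD(1)[OF g] e by blast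
    have posidx: "q \<in> index_set s (Suc n)" if "1 \<le> q" "q \<le> p" for q
      using that by (auto simp: index_set_def p_def)
    have off: "e q = 0" if "1 \<le> q" "q \<le> p" "q \<notin> insert p K" for q
    proof -
      have "unit_vec s (f j) q = 0" if "j \<le> d" for j
        using unit_vec_pos[OF fpos[OF that], of q s] \<open>1 \<le> q\<close> \<open>q \<notin> insert p K\<close> bij_betwE[OF f] that
        by auto
      then show ?thesis using eq[OF posidx[OF that(1,2)]] by simp
    qed
    have on: "e (f j) = l j" if j: "j \<le> d" for j
    proof -
      have "f j \<in> insert p K" using bij_betwE[OF f] j by blast
      then have "1 \<le> f j \<and> f j \<le> p" using K(2) by (auto simp: p_def)
      then have "e (f j) = (\<Sum>k\<le>d. l k * unit_vec s (f k) (f j))" using eq[OF posidx] by blast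
      also have "\<dots> = (\<Sum>k\<le>d. if k = j then l k else 0)"
      proof (rule sum.cong[OF refl])
        fix k assume "k \<in> {..d}"
        then have "f j = f k \<longleftrightarrow> k = j" using bij_betw_imp_inj_on[OF f] j by (auto dest: inj_onD)
        then show "l k * unit_vec s (f k) (f j) = (if k = j then l k else 0)"
          using unit_vec_pos[OF fpos[of k] fpos[OF j], of s] \<open>k \<in> {..d}\<close> by auto
      qed
      finally show ?thesis using j by simp
    qed
    obtain q where q: "1 \<le> q" "q \<le> int n" "q \<notin> K"
    proof -
      have "\<not> {1..int n} \<subseteq> K" using card_mono[OF finK, of "{1..int n}"] K(3) dn by auto
      then show thesis using that by (meson atLeastAtMost_iff subsetI)
    qed
    have q0: "e q = 0" "q \<in> index_set s (Suc n)" using off[of q] posidx[of q] q by (auto simp: p_def)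
    obtain j where j: "j \<le> d" "l j \<noteq> 0" using l by blast
    have "f j \<in> index_set s (Suc n)"
      using posidx[of "f j"] bij_betwE[OF f] j(1) K(2) fpos[OF j(1)] by (force simp: p_def)
    then have "s * d + s + 1 \<le> card (e ` index_set s (Suc n))"
      using genericD(3)[OF g e _ q0(2), of "f j"] on[OF j(1)] q0(1) j(2) by simp
    also have "\<dots> \<le> s * card (e ` K) + 1"
    proof (rule card_symmetric[OF s])
      have pos: "e x \<in> insert 0 (if s = 1 then e ` K else e ` K \<union> uminus ` e ` K)"
        if x: "1 \<le> x" "x \<le> p" for x
      proof (cases "x = p")
        case True
        show ?thesis
        proof (cases "i = 0")
          case True
          then have "s \<noteq> 1" using i by (auto simp: index_set_def)
          then show ?thesis using ambient_0[OF ambient] flat[OF e] True \<open>x = p\<close> by simp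
        next
          case i0: False
          then have iK: "\<bar>i\<bar> \<in> K" using K(1) by (simp add: B_def)
          show ?thesis
          proof (cases "s = 1")
            case True
            then have "\<bar>i\<bar> = i" using i by (auto simp: index_set_def)
            then show ?thesis using iK flat[OF e] \<open>x = p\<close> True by (metis imageI insertI2)
          next
            case F: False
            have "e i = e \<bar>i\<bar> \<or> e i = - e \<bar>i\<bar>" using ambient_neg[OF ambient F, of i] by (cases "i < 0") auto
            then show ?thesis using iK flat[OF e] \<open>x = p\<close> F by auto
          qed
        qed
      next
        case False
        then show ?thesis using off[OF x] by (cases "x \<in> K") auto
      qed
      show "e ` index_set s (Suc n) \<subseteq> insert 0 (if s = 1 then e ` K else e ` K \<union> uminus ` e ` K)"
      proof (intro image_subsetI)
        fix x assume x: "x \<in> index_set s (Suc n)"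
        consider "1 \<le> x" "x \<le> p" | "s \<noteq> 1" "x = 0" | "s \<noteq> 1" "1 \<le> - x" "- x \<le> p"
          using x by (force simp: index_set_def p_def split: if_splits)
        then show "e x \<in> insert 0 (if s = 1 then e ` K else e ` K \<union> uminus ` e ` K)"
        proof cases
          case 3
          have "e x = - e (- x)" using ambient_neg[OF ambient 3(1), of x] by simp
          then show ?thesis using pos[OF 3(2,3)] 3(1) by auto
        qed (use pos ambient_0[OF ambient] in auto)
      qed
    qed (use finK in simp)
    also have "\<dots> \<le> s * d + 1" using card_image_le[OF finK, of e] K(3) by simp
    finally show False using s by auto
  qed
qed

text \<open>
  The recursion starts at \<open>n = 3 - s\<close>, where the chambers are two rays: for smaller \<open>n\<close> the only chamber is
  a linear space, which contains the origin.
\<close>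

definition survival :: "nat \<Rightarrow> nat \<Rightarrow> real" where
  "survival s n = (\<Prod>k\<in>{3 - s<..n}. 1 - 1 / (real s * real k))"

primrec zeros_weight :: "nat \<Rightarrow> nat \<Rightarrow> nat \<Rightarrow> real" where
  "zeros_weight s 0 n = 0"
| "zeros_weight s (Suc d) n = 1 + (\<Sum>k\<in>{3 - s<..n}. zeros_weight s d (k - 1) / (real s * real k - 1))"

lemma regions_singleton: "L \<noteq> {} \<Longrightarrow> regions {x} L = {{}}"
  by (auto simp: regions_def order_type_def)

lemma card_regions_base:
  assumes s: "s \<in> {1, 2}" and g: "generic s (3 - s) d L"
  shows "card (regions (index_set s (3 - s)) L) = (if d = 0 then 2 else 0)"
proof (cases "d = 0")
  case True
  \<comment> \<open>One level lower a single coordinate remains, the index 1 in type A and 0 in type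
    B. It has one region, and so has its only wall section, which gives
    \<open>1 + 1 = 2\<close>.\<close>
  define n where "n = 2 - s"
  have n: "3 - s = Suc n" using s by (auto simp: n_def)
  obtain x where x: "index_set s n = {x}" using s by (auto simp: n_def index_set_def)
  obtain b where b: "b \<in> L" 
  proof -
    have "(\<lambda>_. 0) \<in> ambient s" by (simp add: ambient_def)
    then show thesis using generic_codim[OF g, of "\<lambda>_ _. 0"] that by blast
  qed
  have zero: "(\<lambda>_. 0) \<in> {b \<in> L. b (int (Suc n)) = b x}"
    using lin_closedD[OF genericD(2)[OF g] b b, of 0 0] by simp
  have "card (regions (index_set s (Suc n)) L) = card (regions (index_set s n) L) +
      (\<Sum>i\<in>index_set s n. card (regions (index_set s n) {b \<in> L. b (int (Suc n)) = b i}))"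
  proof (rule regions_Suc[OF genericD(1,2)[OF g]])
    show "\<exists>e\<in>L. e (int (Suc n)) \<noteq> e i"
      if "i \<in> index_set s n" "b \<in> L" "inj_on b (index_set s n)" "b (int (Suc n)) = b i" for i b
      using generic_crossing[OF s g[unfolded n] that(1) disjI1[OF True] that(2-4)] .
  qed
  moreover have "regions {x} L = {{}}" "regions {x} {b \<in> L. b (int (Suc n)) = b x} = {{}}"
    by (rule regions_singleton, rule ex_in_conv[THEN iffD1, OF exI], rule b zero)+
  ultimately show ?thesis using True unfolding n x by simp
next
  case False
  have "regions (index_set s (3 - s)) L = {}"
  proof (rule ccontr)
    assume "regions (index_set s (3 - s)) L \<noteq> {}"
    then obtain b where b: "b \<in> L" "inj_on b (index_set s (3 - s))" by (auto simp: regions_def)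
    obtain i j where "i \<in> index_set s (3 - s)" "j \<in> index_set s (3 - s)" "i \<noteq> j"
    proof (cases "s = 1")
      case True
      then show thesis using that[of 1 2] by (simp add: index_set_def)
    next
      case F: False
      then show thesis using that[of 0 1] s by (simp add: index_set_def)
    qed
    then have "s * d + s + 1 \<le> card (b ` index_set s (3 - s))"
      using genericD(3)[OF g b(1)] inj_onD[OF b(2)] by blast
    also have "card (b ` index_set s (3 - s)) = s * (3 - s) + s - 1"
      using card_image[OF b(2)] card_index_set[OF s] by simp
    finally show False using False s by auto
  qed
  then show ?thesis using False by simp
qed

text \<open>Writing the count as \<open>1 - survival * zeros_weight\<close> times its value at
  \<open>d = 0\<close> linearises the recursion. With \<open>w = s (n + 1)\<close>,
  \<open>survival\<close> absorbs the factor \<open>1 - 1 / w\<close>, and what is left is the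
  increment \<open>zeros_weight s (d - 1) n / (w - 1)\<close>.\<close>

theorem card_regions:
  assumes s: "s \<in> {1, 2}" and "3 - s \<le> n" "generic s n d L"
  shows "real (card (regions (index_set s n) L)) = real s ^ n * fact n * (1 - survival s n * zeros_weight s d n)"
  using assms(2,3)
proof (induction n arbitrary: d L rule: dec_induct)
  case base
  have "zeros_weight s d (3 - s) = (if d = 0 then 0 else 1)" by (cases d) auto
  moreover have "real s ^ (3 - s) * fact (3 - s) = 2" using s by (auto simp: numeral_2_eq_2)
  ultimately show ?case using card_regions_base[OF s base] by (simp add: survival_def)
next
  case (step n)
  note g = step.prems
  define w where "w = real s * real (Suc n)"
  have w: "w > 1" "real (card (index_set s n)) = w - 1" using s step.hyps(1)
    by (auto simp: w_def card_index_set of_nat_diff)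
  have surv: "survival s (Suc n) = survival s n * ((w - 1) / w)"
  proof -
    have "{3 - s<..Suc n} = insert (Suc n) {3 - s<..n}" using step.hyps(1) by auto
    then show ?thesis using w by (simp add: survival_def w_def field_simps)
  qed
  have fac: "real s ^ Suc n * fact (Suc n) = real s ^ n * fact n * w" by (simp add: w_def)
  have rec: "real (card (regions (index_set s (Suc n)) L)) = real (card (regions (index_set s n) L)) +
      (w - 1) * (real s ^ n * fact n * (1 - survival s n * zeros_weight s d n))"
  proof -
    have "card (regions (index_set s (Suc n)) L) = card (regions (index_set s n) L) +
      (\<Sum>i\<in>index_set s n. card (regions (index_set s n) {b \<in> L. b (int (Suc n)) = b i}))"
    proof (rule regions_Suc[OF genericD(1,2)[OF g]])
      show "\<exists>e\<in>L. e (int (Suc n)) \<noteq> e i"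
        if "i \<in> index_set s n" "b \<in> L" "inj_on b (index_set s n)" "b (int (Suc n)) = b i" for i b
        using generic_crossing[OF s g that(1) disjI2[OF step.hyps(1)] that(2-4)] .
    qed
    also have "real \<dots> = real (card (regions (index_set s n) L)) +
      (\<Sum>i\<in>index_set s n. real s ^ n * fact n * (1 - survival s n * zeros_weight s d n))"
      using step.IH[OF generic_hyperplane[OF s g]] by simp
    finally show ?thesis using w by simp
  qed
  show ?case
  proof (cases d)
    case 0
    have "real (card (regions (index_set s n) L)) = real s ^ n * fact n"
      using step.IH[OF generic_restrict_0[OF s g[unfolded 0]]] by simp
    then show ?thesis unfolding rec fac using 0 by (simp add: algebra_simps)
  next
    case (Suc d')
    have "n \<ge> 1" using step.hyps(1) s by auto
    have zw: "zeros_weight s d (Suc n) = zeros_weight s d n + zeros_weight s d' n / (w - 1)"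
    proof -
      have "{3 - s<..Suc n} = insert (Suc n) {3 - s<..n}" using step.hyps(1) by auto
      then show ?thesis using Suc by (simp add: w_def)
    qed
    show ?thesis unfolding rec fac surv zw step.IH[OF generic_restrict[OF s \<open>n \<ge> 1\<close> g[unfolded Suc]]]
      using w(1) by (simp add: field_simps)
  qed
qed

subsection \<open>Chambers and absorption\<close>

definition relation_space :: "nat \<Rightarrow> nat \<Rightarrow> (nat \<Rightarrow> 'a::euclidean_space) \<Rightarrow> (int \<Rightarrow> real) set" where
  "relation_space s n x = {b \<in> ambient s. (\<Sum>i\<in>{1..n}. b (int i) *\<^sub>R x i) = 0}"

definition signed_sum :: "(nat \<Rightarrow> nat) \<Rightarrow> (nat \<Rightarrow> real) \<Rightarrow> (nat \<Rightarrow> 'a::euclidean_space) \<Rightarrow> nat \<Rightarrow> 'a" where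
  "signed_sum \<sigma> \<epsilon> x k = (\<Sum>i\<in>{1..k}. \<epsilon> i *\<^sub>R x (\<sigma> i))"

text \<open>The Weyl groups: permutations for \<open>s = 1\<close>, signed permutations for
  \<open>s = 2\<close>. Fixing \<open>\<epsilon> i = 1\<close> off the range keeps the set
  finite.\<close>

definition signed_perms :: "nat \<Rightarrow> nat \<Rightarrow> ((nat \<Rightarrow> nat) \<times> (nat \<Rightarrow> real)) set" where
  "signed_perms s n = {(\<sigma>, \<epsilon>). \<sigma> permutes {1..n} \<and>
     (\<forall>i. if i \<in> {1..n} then \<epsilon> i \<in> (if s = 1 then {1} else {-1, 1}) else \<epsilon> i = 1)}"

text \<open>The walk has \<open>n + s - 2\<close> relevant partial sums: \<open>n - 1\<close> in type A and \<open>n\<close> in type B.\<close>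

definition general_position :: "nat \<Rightarrow> nat \<Rightarrow> (nat \<Rightarrow> 'a::euclidean_space) \<Rightarrow> bool" where
  "general_position s n x \<longleftrightarrow> (s = 1 \<longrightarrow> (\<Sum>i\<in>{1..n}. x i) = 0) \<and>
     (\<forall>(\<sigma>, \<epsilon>) \<in> signed_perms s n. any_d_indep (signed_sum \<sigma> \<epsilon> x) {1..n + s - 2})"

lemma finite_signed_perms: "finite (signed_perms s n)"
proof -
  have "finite {\<epsilon>. \<forall>i. if i \<in> {1..n} then \<epsilon> i \<in> (if s = 1 then {1} else {-1, 1::real}) else \<epsilon> i = 1}"
    unfolding if_bool_eq_conj[of "_ \<in> {1..n}"] by (intro finite_set_of_finite_funs) auto
  then show ?thesis unfolding signed_perms_def
    by (intro finite_subset[OF _ finite_cartesian_product[OF finite_permutations[of "{1..n}"]]]) auto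
qed

lemma any_d_indepD:
  fixes v :: "nat \<Rightarrow> 'a::euclidean_space"
  assumes "any_d_indep v I" "K \<subseteq> I" "card K = DIM('a)" "(\<Sum>k\<in>K. c k *\<^sub>R v k) = 0" "k \<in> K"
  shows "c k = 0"
proof -
  have inj: "inj_on v K" and ind: "independent (v ` K)"
    using assms(1-3) by (auto simp: any_d_indep_def)
  have "finite K" using assms(3) DIM_positive[where 'a='a] by (metis card.infinite less_irrefl)
  then have fin: "finite (v ` K)" by simp
  have "(\<Sum>y\<in>v ` K. c (inv_into K v y) *\<^sub>R y) = (\<Sum>k\<in>K. c k *\<^sub>R v k)"
    using inj by (simp add: sum.reindex)
  then have "(\<Sum>y\<in>v ` K. c (inv_into K v y) *\<^sub>R y) = 0" using assms(4) by simp
  then have "c (inv_into K v (v k)) = 0"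
    by (rule independentD[OF ind fin subset_refl, of "\<lambda>y. c (inv_into K v y)"]) (use assms(5) in simp)
  then show ?thesis using inj assms(5) by simp
qed

lemma any_d_indep_spans:
  fixes v :: "nat \<Rightarrow> 'a::euclidean_space"
  assumes "any_d_indep v I" "K \<subseteq> I" "card K = DIM('a)"
  shows "\<exists>a. t = (\<Sum>k\<in>K. a k *\<^sub>R v k)"
proof -
  have inj: "inj_on v K" and ind: "independent (v ` K)"
    using assms(1-3) by (auto simp: any_d_indep_def)
  have "finite K" using assms(3) DIM_positive[where 'a='a] by (metis card.infinite less_irrefl)
  then have fin: "finite (v ` K)" by simp
  have "card (v ` K) = DIM('a)" using card_image[OF inj] assms(3) by simp
  then have "span (v ` K) = UNIV"
    using card_eq_dim[of "v ` K" UNIV] ind fin by (auto simp: dim_UNIV)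
  then have "t \<in> range (\<lambda>u. \<Sum>y\<in>v ` K. u y *\<^sub>R y)" using span_finite[OF fin] by simp
  then obtain u where "t = (\<Sum>y\<in>v ` K. u y *\<^sub>R y)" by (rule rangeE)
  then show ?thesis using inj by (intro exI[of _ "u \<circ> v"]) (simp add: sum.reindex)
qed

lemma card_subset_extend:
  assumes "J \<subseteq> I" "finite I" "card J \<le> d" "d \<le> card I"
  obtains K where "J \<subseteq> K" "K \<subseteq> I" "card K = d"
  using exists_subset_between[of J d I] assms by blast

text \<open>A vanishing convex combination has at least \<open>DIM('a)\<close> nonzero coefficients
  by general position, and that many vectors span the space. The absent vectors can thus enter with
  a small coefficient, compensated by a small change of coefficients that are already
  positive.\<close>

lemma zero_in_hull_iff:
  fixes v :: "nat \<Rightarrow> 'a::euclidean_space"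
  assumes ind: "any_d_indep v I" and fin: "finite I" and cI: "DIM('a) \<le> card I"
  shows "0 \<in> convex hull (v ` I) \<longleftrightarrow> (\<exists>c. (\<forall>k\<in>I. 0 < c k) \<and> (\<Sum>k\<in>I. c k *\<^sub>R v k) = 0)"
proof
  assume "0 \<in> convex hull (v ` I)"
  then obtain u where u: "\<forall>y\<in>v ` I. 0 \<le> u y" "sum u (v ` I) = 1" "(\<Sum>y\<in>v ` I. u y *\<^sub>R y) = 0"
    using convex_hull_finite[of "v ` I"] fin by auto
  \<comment> \<open>Hull weights belong to points rather than indices; \<open>g\<close> assigns the
    weight of each point to one index, in case several indices give the same point.\<close>
  define g where "g = inv_into I v"
  define c where "c k = (if k \<in> g ` v ` I then u (v k) else 0)" for k
  have vg: "v (g y) = y" "g y \<in> I" if "y \<in> v ` I" for y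
    using that by (auto simp: g_def f_inv_into_f inv_into_into)
  have injg: "inj_on g (v ` I)" using vg(1) by (metis inj_onI)
  have sub: "g ` v ` I \<subseteq> I" using vg(2) by blast
  have c0: "0 \<le> c k" if "k \<in> I" for k using u(1) that by (auto simp: c_def)
  have "(\<Sum>k\<in>I. c k) = (\<Sum>k\<in>g ` v ` I. c k)"
    using fin sub by (intro sum.mono_neutral_right) (auto simp: c_def)
  also have "\<dots> = 1" using u(2) vg(1) injg by (simp add: sum.reindex c_def)
  finally have c1: "(\<Sum>k\<in>I. c k) = 1" .
  have "(\<Sum>k\<in>I. c k *\<^sub>R v k) = (\<Sum>k\<in>g ` v ` I. c k *\<^sub>R v k)"
    using fin sub by (intro sum.mono_neutral_right) (auto simp: c_def)
  also have "\<dots> = 0" using u(3) vg(1) injg by (simp add: sum.reindex c_def)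
  finally have cv: "(\<Sum>k\<in>I. c k *\<^sub>R v k) = 0" .
  define J where "J = {k \<in> I. c k \<noteq> 0}"
  have finJ: "finite J" and JI: "J \<subseteq> I" using fin by (auto simp: J_def)
  have dJ: "DIM('a) \<le> card J"
  proof (rule ccontr)
    assume "\<not> ?thesis"
    then obtain K where K: "J \<subseteq> K" "K \<subseteq> I" "card K = DIM('a)"
      using card_subset_extend[OF JI fin _ cI] by auto
    have "(\<Sum>k\<in>K. c k *\<^sub>R v k) = 0"
      using cv sum.mono_neutral_right[OF fin K(2), of "\<lambda>k. c k *\<^sub>R v k"] K(1) by (auto simp: J_def)
    then have "\<forall>k\<in>K. c k = 0" using any_d_indepD[OF ind K(2,3)] by blast
    then have "\<forall>k\<in>I. c k = 0" using K(1) by (auto simp: J_def)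
    then show False using c1 by simp
  qed
  obtain K where K: "K \<subseteq> J" "card K = DIM('a)" by (rule obtain_subset_with_card_n[OF dJ])
  have KI: "K \<subseteq> I" using K JI by blast
  \<comment> \<open>The compensation for adding every absent vector once, expressed through
    \<open>DIM('a)\<close> vectors of the support.\<close>
  obtain a where a: "- (\<Sum>k\<in>I - J. v k) = (\<Sum>k\<in>K. a k *\<^sub>R v k)"
    using any_d_indep_spans[OF ind KI K(2)] by (rule exE)
  have "0 < c k" if "k \<in> J" for k using c0[of k] that by (force simp: J_def)
  then obtain e where e: "0 < e" "\<And>k. k \<in> J \<Longrightarrow> 0 < c k + e * (if k \<in> K then a k else 0)"
    using exists_small_pos[OF finJ, of c "\<lambda>k. if k \<in> K then a k else 0"] by metis
  define c' where "c' k = (if k \<in> J then c k + e * (if k \<in> K then a k else 0) else e)" for k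
  have "(\<Sum>k\<in>I. c' k *\<^sub>R v k) = (\<Sum>k\<in>J. c' k *\<^sub>R v k) + (\<Sum>k\<in>I - J. c' k *\<^sub>R v k)"
    using sum.subset_diff[OF JI fin, of "\<lambda>k. c' k *\<^sub>R v k"] by simp
  also have "(\<Sum>k\<in>I - J. c' k *\<^sub>R v k) = e *\<^sub>R (\<Sum>k\<in>I - J. v k)"
    by (simp add: c'_def scaleR_sum_right)
  also have "(\<Sum>k\<in>J. c' k *\<^sub>R v k) = (\<Sum>k\<in>J. c k *\<^sub>R v k) + e *\<^sub>R (\<Sum>k\<in>J. (if k \<in> K then a k else 0) *\<^sub>R v k)"
    by (simp add: c'_def scaleR_sum_right sum.distrib[symmetric] scaleR_add_left)
  also have "(\<Sum>k\<in>J. (if k \<in> K then a k else 0) *\<^sub>R v k) = (\<Sum>k\<in>K. a k *\<^sub>R v k)"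
    using finJ K(1) by (intro sum.mono_neutral_cong_right) auto
  also have "(\<Sum>k\<in>J. c k *\<^sub>R v k) = 0"
    using cv sum.mono_neutral_right[OF fin JI, of "\<lambda>k. c k *\<^sub>R v k"] by (auto simp: J_def)
  finally have "(\<Sum>k\<in>I. c' k *\<^sub>R v k) = 0" by (simp add: a[symmetric])
  moreover have "\<forall>k\<in>I. 0 < c' k" using e by (auto simp: c'_def)
  ultimately show "\<exists>c. (\<forall>k\<in>I. 0 < c k) \<and> (\<Sum>k\<in>I. c k *\<^sub>R v k) = 0" by (intro exI[of _ c'] conjI)
next
  assume "\<exists>c. (\<forall>k\<in>I. 0 < c k) \<and> (\<Sum>k\<in>I. c k *\<^sub>R v k) = 0"
  then obtain c where c: "\<forall>k\<in>I. 0 < c k" "(\<Sum>k\<in>I. c k *\<^sub>R v k) = 0" by blast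
  have "I \<noteq> {}" using cI DIM_positive[where 'a='a] by (metis card.empty not_le)
  then have S: "sum c I > 0" using c(1) fin by (intro sum_pos) auto
  have "(\<Sum>k\<in>I. (c k / sum c I) *\<^sub>R v k) \<in> convex hull (v ` I)"
  proof (rule convex_sum[OF fin convex_convex_hull])
    show "(\<Sum>k\<in>I. c k / sum c I) = 1" using S by (simp flip: sum_divide_distrib)
    show "0 \<le> c k / sum c I" if "k \<in> I" for k using c(1) S that by (simp add: less_imp_le)
    show "v k \<in> convex hull (v ` I)" if "k \<in> I" for k using that by (simp add: hull_inc)
  qed
  moreover have "(\<Sum>k\<in>I. (c k / sum c I) *\<^sub>R v k) = (1 / sum c I) *\<^sub>R (\<Sum>k\<in>I. c k *\<^sub>R v k)"
    by (simp add: scaleR_sum_right)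
  ultimately show "0 \<in> convex hull (v ` I)" using c(2) by simp
qed

section \<open>Relations between steps as relations between partial sums\<close>

definition jump :: "nat \<Rightarrow> (nat \<Rightarrow> real) \<Rightarrow> nat \<Rightarrow> real" where
  "jump n \<beta> k = \<beta> k - (if k < n then \<beta> (Suc k) else 0)"

lemma summation_by_parts:
  fixes z :: "nat \<Rightarrow> 'a::real_vector"
  shows "(\<Sum>i\<in>{1..n}. \<beta> i *\<^sub>R z i) =
    (\<Sum>k\<in>{1..n}. (\<beta> k - \<beta> (Suc k)) *\<^sub>R (\<Sum>i\<in>{1..k}. z i)) + \<beta> (Suc n) *\<^sub>R (\<Sum>i\<in>{1..n}. z i)"
  by (induction n) (simp_all add: algebra_simps)

lemma sum_jumps:
  fixes z :: "nat \<Rightarrow> 'a::real_vector"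
  assumes s: "s \<in> {1, 2}" and n: "1 \<le> n" and z: "s = 1 \<Longrightarrow> (\<Sum>i\<in>{1..n}. z i) = 0"
  shows "(\<Sum>i\<in>{1..n}. \<beta> i *\<^sub>R z i) = (\<Sum>k\<in>{1..n + s - 2}. jump n \<beta> k *\<^sub>R (\<Sum>i\<in>{1..k}. z i))"
proof -
  \<comment> \<open>Continuing the coefficients by 0 past \<open>n\<close> removes the boundary
    term; this is the convention built into \<open>jump\<close> at the last index.\<close>
  define \<gamma> where "\<gamma> i = (if i \<le> n then \<beta> i else 0)" for i
  have "(\<Sum>i\<in>{1..n}. \<beta> i *\<^sub>R z i) = (\<Sum>i\<in>{1..n}. \<gamma> i *\<^sub>R z i)" by (simp add: \<gamma>_def)
  also have "\<dots> = (\<Sum>k\<in>{1..n}. (\<gamma> k - \<gamma> (Suc k)) *\<^sub>R (\<Sum>i\<in>{1..k}. z i))"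
    unfolding summation_by_parts[of \<gamma>] by (simp add: \<gamma>_def)
  also have "\<dots> = (\<Sum>k\<in>{1..n}. jump n \<beta> k *\<^sub>R (\<Sum>i\<in>{1..k}. z i))"
    by (intro sum.cong refl) (auto simp: jump_def \<gamma>_def Suc_le_eq)
  also have "\<dots> = (\<Sum>k\<in>{1..n + s - 2}. jump n \<beta> k *\<^sub>R (\<Sum>i\<in>{1..k}. z i))"
  proof (cases "s = 1")
    case True
    have "{1..n} = insert n {1..n + s - 2}" using n True by auto
    moreover have "n \<notin> {1..n + s - 2}" using n True by auto
    ultimately show ?thesis using z[OF True] by simp
  qed (use s in auto)
  finally show ?thesis .
qed

lemma sorting_permutation:
  fixes f :: "nat \<Rightarrow> real"
  obtains \<sigma> where "\<sigma> permutes {1..n}" "\<And>i j. 1 \<le> i \<Longrightarrow> i \<le> j \<Longrightarrow> j \<le> n \<Longrightarrow> f (\<sigma> j) \<le> f (\<sigma> i)"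
proof -
  define xs where "xs = sort_key (\<lambda>i. - f i) [1..<Suc n]"
  have xs: "set xs = {1..n}" "distinct xs" "length xs = n" "sorted (map (\<lambda>i. - f i) xs)"
    by (auto simp: xs_def)
  define \<sigma> where "\<sigma> i = (if i \<in> {1..n} then xs ! (i - 1) else i)" for i
  have "bij_betw (\<lambda>i. i - 1) {1..n} {..<n}"
    by (rule bij_betw_byWitness[of _ Suc]) auto
  moreover have "bij_betw ((!) xs) {..<n} {1..n}" using bij_betw_nth[OF xs(2)] xs(1,3) by simp
  ultimately have "bij_betw ((!) xs \<circ> (\<lambda>i. i - 1)) {1..n} {1..n}" by (rule bij_betw_trans)
  then have "bij_betw \<sigma> {1..n} {1..n}"
    by (rule bij_betw_cong[THEN iffD1, rotated]) (simp add: \<sigma>_def)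
  then have "\<sigma> permutes {1..n}" by (rule bij_imp_permutes) (auto simp: \<sigma>_def)
  moreover have "f (\<sigma> j) \<le> f (\<sigma> i)" if "1 \<le> i" "i \<le> j" "j \<le> n" for i j
    using sorted_nth_mono[OF xs(4), of "i - 1" "j - 1"] xs(3) that by (auto simp: \<sigma>_def)
  ultimately show thesis by (rule that)
qed

lemma signed_perms_signs:
  assumes "(\<sigma>, \<epsilon>) \<in> signed_perms s n"
  shows "\<sigma> permutes {1..n}" "\<epsilon> i = 1 \<or> \<epsilon> i = -1" "s = 1 \<Longrightarrow> \<epsilon> i = 1" "\<epsilon> i * \<epsilon> i = 1"
proof -
  have "if i \<in> {1..n} then \<epsilon> i \<in> (if s = 1 then {1} else {-1, 1}) else \<epsilon> i = 1"
    using assms unfolding signed_perms_def mem_Collect_eq prod.case by (elim conjE allE)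
  then show "\<epsilon> i = 1 \<or> \<epsilon> i = -1" "s = 1 \<Longrightarrow> \<epsilon> i = 1" "\<epsilon> i * \<epsilon> i = 1"
    by (auto split: if_splits)
  show "\<sigma> permutes {1..n}" using assms by (simp add: signed_perms_def)
qed

text \<open>Inserting each sign twice changes nothing, so a single relation between the steps can be
  read along every transformed walk, with the correspondingly transformed coefficients.\<close>

lemma relation_space_jumps:
  fixes x :: "nat \<Rightarrow> 'a::euclidean_space"
  assumes s: "s \<in> {1, 2}" and n: "1 \<le> n" and x: "s = 1 \<Longrightarrow> (\<Sum>i\<in>{1..n}. x i) = 0"
    and g: "(\<sigma>, \<epsilon>) \<in> signed_perms s n"
  shows "(\<Sum>i\<in>{1..n}. b (int i) *\<^sub>R x i) =
    (\<Sum>k\<in>{1..n + s - 2}. jump n (\<lambda>i. \<epsilon> i * b (int (\<sigma> i))) k *\<^sub>R signed_sum \<sigma> \<epsilon> x k)"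
proof -
  have "(\<Sum>i\<in>{1..n}. b (int i) *\<^sub>R x i) = (\<Sum>i\<in>{1..n}. b (int (\<sigma> i)) *\<^sub>R x (\<sigma> i))"
    using sum.permute[OF signed_perms_signs(1)[OF g], of "\<lambda>i. b (int i) *\<^sub>R x i"] by (simp add: o_def)
  also have "\<dots> = (\<Sum>i\<in>{1..n}. (\<epsilon> i * b (int (\<sigma> i))) *\<^sub>R (\<epsilon> i *\<^sub>R x (\<sigma> i)))"
  proof (intro sum.cong refl)
    fix i
    have "(\<epsilon> i * b (int (\<sigma> i))) * \<epsilon> i = b (int (\<sigma> i))"
      using signed_perms_signs(4)[OF g, of i] by (simp add: mult.commute mult.left_commute)
    then show "b (int (\<sigma> i)) *\<^sub>R x (\<sigma> i) = (\<epsilon> i * b (int (\<sigma> i))) *\<^sub>R (\<epsilon> i *\<^sub>R x (\<sigma> i))"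
      by simp
  qed
  also have "\<dots> = (\<Sum>k\<in>{1..n + s - 2}. jump n (\<lambda>i. \<epsilon> i * b (int (\<sigma> i))) k *\<^sub>R signed_sum \<sigma> \<epsilon> x k)"
    unfolding signed_sum_def
  proof (rule sum_jumps[OF s n])
    assume s1: "s = 1"
    then have "(\<Sum>i\<in>{1..n}. \<epsilon> i *\<^sub>R x (\<sigma> i)) = (\<Sum>i\<in>{1..n}. x (\<sigma> i))"
      using signed_perms_signs(3)[OF g] by simp
    also have "\<dots> = (\<Sum>i\<in>{1..n}. x i)"
      using sum.permute[OF signed_perms_signs(1)[OF g], of x] by (simp add: o_def)
    finally show "(\<Sum>i\<in>{1..n}. \<epsilon> i *\<^sub>R x (\<sigma> i)) = 0" using x[OF s1] by simp
  qed
  finally show ?thesis .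
qed

text \<open>Every orbit of the group meets the closed fundamental chamber: sort the coordinates, in
  type B by absolute value, and let the signs make them nonnegative.\<close>

lemma exists_sorting_symmetry:
  fixes b :: "int \<Rightarrow> real"
  assumes "s \<in> {1, 2}"
  obtains \<sigma> \<epsilon> where "(\<sigma>, \<epsilon>) \<in> signed_perms s n"
    "\<And>i j. 1 \<le> i \<Longrightarrow> i \<le> j \<Longrightarrow> j \<le> n \<Longrightarrow> \<epsilon> j * b (int (\<sigma> j)) \<le> \<epsilon> i * b (int (\<sigma> i))"
    "\<And>i. s \<noteq> 1 \<Longrightarrow> 1 \<le> i \<Longrightarrow> i \<le> n \<Longrightarrow> 0 \<le> \<epsilon> i * b (int (\<sigma> i))"
proof -
  define f where "f i = (if s = 1 then b (int i) else \<bar>b (int i)\<bar>)" for i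
  obtain \<sigma> where \<sigma>: "\<sigma> permutes {1..n}" "\<And>i j. 1 \<le> i \<Longrightarrow> i \<le> j \<Longrightarrow> j \<le> n \<Longrightarrow> f (\<sigma> j) \<le> f (\<sigma> i)"
    using sorting_permutation[of n f] by blast
  define \<epsilon> :: "nat \<Rightarrow> real"
    where "\<epsilon> i = (if i \<in> {1..n} \<and> s \<noteq> 1 \<and> b (int (\<sigma> i)) < 0 then -1 else 1)" for i
  have val: "\<epsilon> i * b (int (\<sigma> i)) = f (\<sigma> i)" if "1 \<le> i" "i \<le> n" for i
    using that by (auto simp: \<epsilon>_def f_def)
  have "(\<sigma>, \<epsilon>) \<in> signed_perms s n" using \<sigma>(1) by (auto simp: signed_perms_def \<epsilon>_def)
  moreover have "\<epsilon> j * b (int (\<sigma> j)) \<le> \<epsilon> i * b (int (\<sigma> i))" if "1 \<le> i" "i \<le> j" "j \<le> n" for i j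
    using \<sigma>(2)[OF that] val that by auto
  moreover have "0 \<le> \<epsilon> i * b (int (\<sigma> i))" if "s \<noteq> 1" "1 \<le> i" "i \<le> n" for i
    using val[OF that(2,3)] that(1) by (simp add: f_def)
  ultimately show thesis by (rule that)
qed

lemma exists_linear_relation:
  fixes w :: "nat \<Rightarrow> 'a::euclidean_space"
  shows "\<exists>l. (\<exists>j\<le>DIM('a). l j \<noteq> 0) \<and> (\<Sum>j\<le>DIM('a). l j *\<^sub>R w j) = 0"
proof (cases "inj_on w {..DIM('a)}")
  case True
  have "card (w ` {..DIM('a)}) > DIM('a)" using card_image[OF True] by simp
  then have "dependent (w ` {..DIM('a)})" by (intro dependent_biggerset) auto
  then obtain u y where y: "y \<in> w ` {..DIM('a)}" "u y \<noteq> 0"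
      and u: "(\<Sum>y\<in>w ` {..DIM('a)}. u y *\<^sub>R y) = 0"
    using dependent_finite[of "w ` {..DIM('a)}"] by auto
  show ?thesis
  proof (intro exI[of _ "u \<circ> w"] conjI)
    show "\<exists>j\<le>DIM('a). (u \<circ> w) j \<noteq> 0" using y by auto
    show "(\<Sum>j\<le>DIM('a). (u \<circ> w) j *\<^sub>R w j) = 0" using u True by (simp add: sum.reindex)
  qed
next
  case False
  then obtain i j where ij: "i \<le> DIM('a)" "j \<le> DIM('a)" "i \<noteq> j" "w i = w j"
    by (auto simp: inj_on_def)
  define l :: "nat \<Rightarrow> real" where "l k = (if k = i then 1 else 0) - (if k = j then 1 else 0)" for k
  have "(\<Sum>k\<le>DIM('a). l k *\<^sub>R w k) =
      (\<Sum>k\<le>DIM('a). (if k = i then w k else 0) - (if k = j then w k else 0))"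
    by (intro sum.cong refl) (auto simp: l_def)
  also have "\<dots> = w i - w j" using ij by (simp add: sum_subtractf)
  finally have "(\<Sum>k\<le>DIM('a). l k *\<^sub>R w k) = 0" using ij by simp
  moreover have "l i \<noteq> 0" using ij by (simp add: l_def)
  ultimately show ?thesis using ij by blast
qed

lemma lin_closed_relation_space: "lin_closed (relation_space s n x)"
  unfolding lin_closed_def
proof (intro ballI allI)
  fix b c u v assume b: "b \<in> relation_space s n x" and c: "c \<in> relation_space s n x"
  have "(\<Sum>i\<in>{1..n}. (u * b (int i) + v * c (int i)) *\<^sub>R x i) =
      u *\<^sub>R (\<Sum>i\<in>{1..n}. b (int i) *\<^sub>R x i) + v *\<^sub>R (\<Sum>i\<in>{1..n}. c (int i) *\<^sub>R x i)"
    by (simp add: scaleR_sum_right scaleR_add_left sum.distrib)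
  then show "(\<lambda>i. u * b i + v * c i) \<in> relation_space s n x"
    using b c lin_closedD[OF lin_closed_ambient, of b s c u v] by (simp add: relation_space_def)
qed

lemma generic_relation_space:
  fixes x :: "nat \<Rightarrow> 'a::euclidean_space"
  assumes s: "s \<in> {1, 2}" and dim: "DIM('a) \<le> n + s - 2" and x: "general_position s n x"
  shows "generic s n DIM('a) (relation_space s n x)"
  unfolding generic_def
proof (intro conjI ballI allI impI)
  show "relation_space s n x \<subseteq> ambient s" by (auto simp: relation_space_def)
  show "lin_closed (relation_space s n x)" by (rule lin_closed_relation_space)
next
  fix y :: "nat \<Rightarrow> int \<Rightarrow> real" assume y: "\<forall>j\<le>DIM('a). y j \<in> ambient s"
  \<comment> \<open>The \<open>DIM('a) + 1\<close> test vectors are mapped to as many points of a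
    space of dimension \<open>DIM('a)\<close>; a linear dependency there is a combination lying in
    the relation space.\<close>
  obtain l where l: "(\<exists>j\<le>DIM('a). l j \<noteq> 0) \<and>
      (\<Sum>j\<le>DIM('a). l j *\<^sub>R (\<Sum>i\<in>{1..n}. y j (int i) *\<^sub>R x i)) = 0"
    using exists_linear_relation[of "\<lambda>j. \<Sum>i\<in>{1..n}. y j (int i) *\<^sub>R x i"] by (rule exE)
  define b where "b i = (\<Sum>j\<le>DIM('a). l j * y j i)" for i
  have "(\<Sum>i\<in>{1..n}. b (int i) *\<^sub>R x i) = (\<Sum>i\<in>{1..n}. \<Sum>j\<le>DIM('a). (l j * y j (int i)) *\<^sub>R x i)"
    by (simp add: b_def scaleR_sum_left)
  also have "\<dots> = (\<Sum>j\<le>DIM('a). l j *\<^sub>R (\<Sum>i\<in>{1..n}. y j (int i) *\<^sub>R x i))"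
    by (subst sum.swap) (simp add: scaleR_sum_right)
  finally have "(\<Sum>i\<in>{1..n}. b (int i) *\<^sub>R x i) = 0" using l by simp
  moreover have "b \<in> ambient s" using y by (auto simp: ambient_def b_def sum_negf[symmetric])
  ultimately have "b \<in> relation_space s n x" by (simp add: relation_space_def)
  then show "\<exists>l. (\<exists>j\<le>DIM('a). l j \<noteq> 0) \<and>
      (\<exists>b\<in>relation_space s n x. \<forall>i\<in>index_set s n. b i = (\<Sum>j\<le>DIM('a). l j * y j i))"
    by (intro exI[of _ l] conjI conjunct1[OF l] bexI[of _ b] ballI b_def)
next
  \<comment> \<open>A relation with few values has at most \<open>DIM('a)\<close> nonzero jumps, hence gives a relation between that
    many partial sums.\<close>
  fix b p q assume b: "b \<in> relation_space s n x" and pq: "p \<in> index_set s n" "q \<in> index_set s n" "b p \<noteq> b q"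
  have n: "1 \<le> n" using dim DIM_positive[where 'a='a] s by (cases n) auto
  have ambient: "b \<in> ambient s" using b by (simp add: relation_space_def)
  obtain \<sigma> \<epsilon> where g: "(\<sigma>, \<epsilon>) \<in> signed_perms s n"
    and dec: "\<And>i j. 1 \<le> i \<Longrightarrow> i \<le> j \<Longrightarrow> j \<le> n \<Longrightarrow> \<epsilon> j * b (int (\<sigma> j)) \<le> \<epsilon> i * b (int (\<sigma> i))"
    and nonneg: "\<And>i. s \<noteq> 1 \<Longrightarrow> 1 \<le> i \<Longrightarrow> i \<le> n \<Longrightarrow> 0 \<le> \<epsilon> i * b (int (\<sigma> i))"
    using exists_sorting_symmetry[OF s, of n b] by metis
  define \<gamma> where "\<gamma> i = \<epsilon> i * b (int (\<sigma> i))" for i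
  define I where "I = {1..n + s - 2}"
  have I: "finite I" "card I = n + s - 2" "\<And>k. k \<in> I \<Longrightarrow> 1 \<le> k \<and> k \<le> n" using s by (auto simp: I_def)
  have jump_nonneg: "0 \<le> jump n \<gamma> k" if "1 \<le> k" "k \<le> n" "k = n \<Longrightarrow> s \<noteq> 1" for k
    using dec[of k "Suc k"] nonneg[of k] that by (auto simp: jump_def \<gamma>_def)
  define J where "J = {k \<in> I. jump n \<gamma> k \<noteq> 0}"
  have sum0: "(\<Sum>k\<in>I. jump n \<gamma> k *\<^sub>R signed_sum \<sigma> \<epsilon> x k) = 0"
    using relation_space_jumps[OF s n _ g, of x b] x b unfolding general_position_def relation_space_def \<gamma>_def[abs_def] I_def
    by simp
  have ind: "any_d_indep (signed_sum \<sigma> \<epsilon> x) I" using x g by (auto simp: general_position_def I_def)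
  have Jpos: "\<gamma> k > (if k < n then \<gamma> (Suc k) else 0)" if "k \<in> J" for k
  proof -
    have "k \<in> I" "jump n \<gamma> k \<noteq> 0" using that by (auto simp: J_def)
    moreover have "k = n \<Longrightarrow> s \<noteq> 1" using \<open>k \<in> I\<close> s n by (auto simp: I_def)
    ultimately have "0 < jump n \<gamma> k" using jump_nonneg[of k] I(3)[of k] by force
    then show ?thesis by (simp add: jump_def)
  qed
  have strict: "\<gamma> l < \<gamma> k" if "k \<in> J" "k < l" "l \<le> n" for k l
  proof -
    have "\<gamma> l \<le> \<gamma> (Suc k)" using dec[of "Suc k" l] that by (simp add: \<gamma>_def)
    also have "\<dots> < \<gamma> k" using Jpos[OF that(1)] that by simp
    finally show ?thesis .
  qed
  have inj: "inj_on \<gamma> J"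
  proof (rule linorder_inj_onI)
    fix k l assume "k < l" "k \<in> J" "l \<in> J"
    then show "\<gamma> k \<noteq> \<gamma> l" using strict[of k l] I(3)[of l] by (auto simp: J_def)
  qed auto
  have \<sigma>index_set: "int (\<sigma> i) \<in> index_set s n" if "1 \<le> i" "i \<le> n" for i
    using permutes_in_image[OF signed_perms_signs(1)[OF g], of i] that by (auto simp: index_set_def)
  have in_img: "\<gamma> i \<in> b ` index_set s n" if "1 \<le> i" "i \<le> n" for i
  proof (cases "\<epsilon> i = 1")
    case True
    then show ?thesis using \<sigma>index_set[OF that] by (simp add: \<gamma>_def)
  next
    case False
    then have "s \<noteq> 1" "\<epsilon> i = -1" using signed_perms_signs(2,3)[OF g, of i] by auto
    then have "\<gamma> i = b (- int (\<sigma> i))" using ambient_neg[OF ambient] by (simp add: \<gamma>_def)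
    then show ?thesis using index_set_neg[OF \<open>s \<noteq> 1\<close> \<sigma>index_set[OF that]] by blast
  qed
  show "s * DIM('a) + s + 1 \<le> card (b ` index_set s n)"
  proof (rule ccontr)
    assume "\<not> ?thesis"
    then have small: "card (b ` index_set s n) \<le> s * DIM('a) + s" by simp
    have finJ: "finite J" using I by (simp add: J_def)
    \<comment> \<open>A nonzero jump at \<open>k\<close> puts \<open>\<gamma> k\<close> strictly
      above all later values. Type A thus has at least \<open>card J + 1\<close> values, counting
      \<open>\<gamma> n\<close>; type B has \<open>2 * card J + 1\<close>, counting negatives and
      0.\<close>
    have "card J \<le> DIM('a)"
    proof (cases "s = 1")
      case True
      have "\<gamma> n \<notin> \<gamma> ` J"
      proof
        assume "\<gamma> n \<in> \<gamma> ` J"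
        then obtain k where "k \<in> J" "\<gamma> n = \<gamma> k" by blast
        moreover have "k < n" using \<open>k \<in> J\<close> True n by (auto simp: J_def I_def)
        ultimately show False using strict[of k n] by simp
      qed
      moreover have "insert (\<gamma> n) (\<gamma> ` J) \<subseteq> b ` index_set s n"
        using in_img I(3) n by (auto simp: J_def)
      then have "card (insert (\<gamma> n) (\<gamma> ` J)) \<le> card (b ` index_set s n)" by (intro card_mono) auto
      ultimately have "card J + 1 \<le> card (b ` index_set s n)"
        using finJ card_image[OF inj] by simp
      then show ?thesis using small True by simp
    next
      case False
      have pos: "0 < v" if "v \<in> \<gamma> ` J" for v
      proof -
        obtain k where k: "k \<in> J" "v = \<gamma> k" using \<open>v \<in> \<gamma> ` J\<close> by blast
        show ?thesis using Jpos[OF k(1)] nonneg[OF False, of "Suc k"] k(2)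
          by (auto simp: \<gamma>_def split: if_splits)
      qed
      let ?V = "\<gamma> ` J"
      have "v \<in> b ` index_set s n \<and> - v \<in> b ` index_set s n" if v: "v \<in> ?V" for v
      proof -
        obtain k where k: "k \<in> J" "v = \<gamma> k" using v by blast
        then have "v \<in> b ` index_set s n" using in_img[of k] I(3)[of k] by (auto simp: J_def)
        moreover from this obtain i where i: "i \<in> index_set s n" "v = b i" by blast
        then have "- v = b (- i)" using ambient_neg[OF ambient False, of i] by simp
        then have "- v \<in> b ` index_set s n" using index_set_neg[OF False i(1)] by blast
        ultimately show ?thesis by blast
      qed
      moreover have "0 \<in> b ` index_set s n" using ambient_0[OF ambient False] index_set_0[OF False, of n] by force
      ultimately have "insert 0 (?V \<union> uminus ` ?V) \<subseteq> b ` index_set s n" by auto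
      then have "card (insert 0 (?V \<union> uminus ` ?V)) \<le> card (b ` index_set s n)" by (intro card_mono) auto
      moreover have "card (insert 0 (?V \<union> uminus ` ?V)) = 2 * card J + 1"
      proof -
        have "0 \<notin> ?V" using pos[of 0] by blast
        moreover have "0 \<notin> uminus ` ?V"
        proof
          assume "0 \<in> uminus ` ?V"
          then obtain v where "v \<in> ?V" "0 = - v" by (rule imageE)
          then show False using pos[of v] by simp
        qed
        moreover have "?V \<inter> uminus ` ?V = {}"
        proof (rule equals0I)
          fix w assume w: "w \<in> ?V \<inter> uminus ` ?V"
          then obtain v where "v \<in> ?V" "w = - v" by auto
          then show False using pos[of v] pos[of w] w by simp
        qed
        ultimately show ?thesis using finJ card_image[OF inj] by (simp add: card_Un_disjoint card_image)
      qed
      ultimately show ?thesis using small s False by auto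
    qed
    then obtain K where K: "J \<subseteq> K" "K \<subseteq> I" "card K = DIM('a)"
      using card_subset_extend[of J I "DIM('a)"] I dim by (auto simp: J_def)
    have "(\<Sum>k\<in>K. jump n \<gamma> k *\<^sub>R signed_sum \<sigma> \<epsilon> x k) = 0"
      using sum0 sum.mono_neutral_right[OF I(1) K(2), of "\<lambda>k. jump n \<gamma> k *\<^sub>R signed_sum \<sigma> \<epsilon> x k"] K(1)
      by (auto simp: J_def)
    then have "jump n \<gamma> k = 0" if "k \<in> K" for k using any_d_indepD[OF ind K(2,3) _ that] by blast
    then have zero: "jump n \<gamma> k = 0" if "k \<in> I" for k using K(1) that by (auto simp: J_def)
    \<comment> \<open>With all jumps zero the sorted coefficients are constant, in type B equal to
      0, which contradicts \<open>b p \<noteq> b q\<close>.\<close>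
    have const: "\<gamma> i = \<gamma> n" if "1 \<le> i" "i \<le> n" for i
      using that(2,1)
    proof (induction i rule: inc_induct)
      case (step i)
      then have "i \<in> I" using s by (auto simp: I_def)
      then show ?case using zero[of i] step by (simp add: jump_def)
    qed simp
    have val: "b (int i) = \<gamma> n" if i: "1 \<le> i" "i \<le> n" "s = 1" for i
    proof -
      obtain j where j: "j \<in> {1..n}" "i = \<sigma> j"
        using permutes_image[OF signed_perms_signs(1)[OF g]] i by (metis atLeastAtMost_iff imageE)
      then show ?thesis using const[of j] signed_perms_signs(3)[OF g i(3), of j] by (simp add: \<gamma>_def)
    qed
    have val2: "b (int i) = 0" if i: "1 \<le> i" "i \<le> n" "s \<noteq> 1" for i
    proof -
      have "\<gamma> n = 0" using zero[of n] s i(3) n by (auto simp: I_def jump_def)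
      obtain j where j: "j \<in> {1..n}" "i = \<sigma> j"
        using permutes_image[OF signed_perms_signs(1)[OF g]] i by (metis atLeastAtMost_iff imageE)
      then show ?thesis using const[of j] \<open>\<gamma> n = 0\<close> signed_perms_signs(2)[OF g, of j] by (auto simp: \<gamma>_def)
    qed
    have "b r = (if s = 1 then \<gamma> n else 0)" if "r \<in> index_set s n" for r
    proof (cases "s = 1")
      case True
      then show ?thesis using that val[of "nat r"] by (auto simp: index_set_def)
    next
      case False
      have "b r = 0"
        using that val2[of "nat r"] val2[of "nat (- r)"] ambient_neg[OF ambient False, of r] ambient_0[OF ambient False] False
        by (cases r "0::int" rule: linorder_cases) (auto simp: index_set_def)
      then show ?thesis using False by simp
    qed
    then show False using pq by metis
  qed
qed

section \<open>Each chamber belongs to one transformed walk\<close>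

lemma less_iff_via_abs:
  fixes a a' c c' :: real
  assumes "sgn a = sgn a'" "sgn c = sgn c'"
    and "\<bar>a\<bar> < \<bar>c\<bar> \<longleftrightarrow> \<bar>a'\<bar> < \<bar>c'\<bar>" "\<bar>c\<bar> < \<bar>a\<bar> \<longleftrightarrow> \<bar>c'\<bar> < \<bar>a'\<bar>"
  shows "a < c \<longleftrightarrow> a' < c'"
  using assms by (auto simp: sgn_if abs_if split: if_splits)

text \<open>In type B signs and absolute values decide every comparison, so it is enough to compare
  on representatives \<open>u i\<close> at which both vectors are positive.\<close>

lemma order_type_eq_by_chain:
  assumes b: "b \<in> ambient s" and c: "c \<in> ambient s"
    and u: "\<And>q. q \<in> index_set s n \<Longrightarrow> (\<exists>i\<in>{1..n}. q = u i) \<or> s \<noteq> 1 \<and> (q = 0 \<or> (\<exists>i\<in>{1..n}. q = - u i))"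
    and ord: "\<And>i j. i \<in> {1..n} \<Longrightarrow> j \<in> {1..n} \<Longrightarrow> b (u i) < b (u j) \<longleftrightarrow> c (u i) < c (u j)"
    and pos: "\<And>i. s \<noteq> 1 \<Longrightarrow> i \<in> {1..n} \<Longrightarrow> 0 < b (u i) \<and> 0 < c (u i)"
  shows "order_type (index_set s n) b = order_type (index_set s n) c"
proof (rule order_type_eqI)
  fix q r assume qr: "q \<in> index_set s n" "r \<in> index_set s n"
  show "b q < b r \<longleftrightarrow> c q < c r"
  proof (cases "s = 1")
    case True
    then show ?thesis using u[OF qr(1)] u[OF qr(2)] ord by auto
  next
    case False
    have val: "b q = 0 \<and> c q = 0 \<or> (\<exists>i\<in>{1..n}. (b q = b (u i) \<and> c q = c (u i)) \<or> (b q = - b (u i) \<and> c q = - c (u i)))"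
      if "q \<in> index_set s n" for q
      using u[OF that] ambient_0[OF b False] ambient_0[OF c False] ambient_neg[OF b False] ambient_neg[OF c False] by auto
    show ?thesis
    proof (rule less_iff_via_abs)
      show "sgn (b q) = sgn (c q)" using val[OF qr(1)] pos[OF False] by fastforce
      show "sgn (b r) = sgn (c r)" using val[OF qr(2)] pos[OF False] by fastforce
      have abs: "\<bar>b q\<bar> < \<bar>b r\<bar> \<longleftrightarrow> \<bar>c q\<bar> < \<bar>c r\<bar>" if qr: "q \<in> index_set s n" "r \<in> index_set s n" for q r
      proof -
        have val': "b q = 0 \<and> c q = 0 \<or> (\<exists>i\<in>{1..n}. \<bar>b q\<bar> = b (u i) \<and> \<bar>c q\<bar> = c (u i))"
          if "q \<in> index_set s n" for q
          using val[OF that] pos[OF False] by fastforce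
        from val'[OF qr(1)] show ?thesis
        proof (elim disjE bexE)
          assume q: "b q = 0 \<and> c q = 0"
          from val'[OF qr(2)] show ?thesis
          proof (elim disjE bexE)
            fix j assume "j \<in> {1..n}" "\<bar>b r\<bar> = b (u j) \<and> \<bar>c r\<bar> = c (u j)"
            then show ?thesis using q pos[OF False, of j] by simp
          qed (use q in simp)
        next
          fix i assume i: "i \<in> {1..n}" "\<bar>b q\<bar> = b (u i) \<and> \<bar>c q\<bar> = c (u i)"
          from val'[OF qr(2)] show ?thesis
          proof (elim disjE bexE)
            fix j assume "j \<in> {1..n}" "\<bar>b r\<bar> = b (u j) \<and> \<bar>c r\<bar> = c (u j)"
            then show ?thesis using i ord[of i j] by simp
          qed simp
        qed
      qed
      show "\<bar>b q\<bar> < \<bar>b r\<bar> \<longleftrightarrow> \<bar>c q\<bar> < \<bar>c r\<bar>" "\<bar>b r\<bar> < \<bar>b q\<bar> \<longleftrightarrow> \<bar>c r\<bar> < \<bar>c q\<bar>"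
        using abs qr by blast+
    qed
  qed
qed

lemma decreasing_chain:
  fixes \<beta> :: "nat \<Rightarrow> real"
  assumes "\<And>k. 1 \<le> k \<Longrightarrow> k < n \<Longrightarrow> \<beta> (Suc k) < \<beta> k" "1 \<le> i" "i < j" "j \<le> n"
  shows "\<beta> j < \<beta> i"
  using assms(3,4)
proof (induction j)
  case (Suc j)
  show ?case
  proof (cases "i = j")
    case True
    then show ?thesis using assms(1)[of j] assms(2) Suc.prems by simp
  next
    case False
    then have "\<beta> j < \<beta> i" using Suc by simp
    moreover have "\<beta> (Suc j) < \<beta> j" using assms(1)[of j] assms(2) Suc.prems False by simp
    ultimately show ?thesis by simp
  qed
qed simp

lemma decreasing_chain_less_iff:
  fixes \<beta> :: "nat \<Rightarrow> real"
  assumes "\<And>k. 1 \<le> k \<Longrightarrow> k < n \<Longrightarrow> \<beta> (Suc k) < \<beta> k" "i \<in> {1..n}" "j \<in> {1..n}"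
  shows "\<beta> i < \<beta> j \<longleftrightarrow> j < i"
  using decreasing_chain[of n \<beta> i j, OF assms(1)] decreasing_chain[of n \<beta> j i, OF assms(1)] assms(2,3)
  by (cases i j rule: linorder_cases) auto

text \<open>After the group element that sorts \<open>b0\<close>, the chamber of \<open>b0\<close>
  consists of the vectors with positive jumps, and a relation with positive jumps is a strictly
  positive vanishing combination of partial sums. The group element depends on the chamber alone and
  serves all \<open>x\<close>, as the averaging argument requires.\<close>

lemma region_hit_iff:
  assumes s: "s \<in> {1, 2}" and dim: "DIM('a) \<le> n + s - 2"
    and b0: "b0 \<in> ambient s" "inj_on b0 (index_set s n)"
  obtains \<sigma> \<epsilon> where "(\<sigma>, \<epsilon>) \<in> signed_perms s n"
    "\<And>x :: nat \<Rightarrow> 'a::euclidean_space. general_position s n x \<Longrightarrow>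
       order_type (index_set s n) b0 \<in> regions (index_set s n) (relation_space s n x) \<longleftrightarrow>
       0 \<in> convex hull (signed_sum \<sigma> \<epsilon> x ` {1..n + s - 2})"
proof -
  obtain \<sigma> \<epsilon> where g: "(\<sigma>, \<epsilon>) \<in> signed_perms s n"
    and dec: "\<And>i j. 1 \<le> i \<Longrightarrow> i \<le> j \<Longrightarrow> j \<le> n \<Longrightarrow> \<epsilon> j * b0 (int (\<sigma> j)) \<le> \<epsilon> i * b0 (int (\<sigma> i))"
    and nonneg: "\<And>i. s \<noteq> 1 \<Longrightarrow> 1 \<le> i \<Longrightarrow> i \<le> n \<Longrightarrow> 0 \<le> \<epsilon> i * b0 (int (\<sigma> i))"
    using exists_sorting_symmetry[OF s, of n b0] by metis
  note perm = signed_perms_signs(1)[OF g] and sgns = signed_perms_signs(2)[OF g] and sgn1 = signed_perms_signs(3)[OF g]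
  have n: "1 \<le> n" using dim DIM_positive[where 'a='a] s by (cases n) auto
  define E where "E = index_set s n"
  define I where "I = {1..n + s - 2}"
  have I: "finite I" "card I = n + s - 2" "\<And>k. k \<in> I \<Longrightarrow> 1 \<le> k \<and> k \<le> n" using s by (auto simp: I_def)
  \<comment> \<open>\<open>u i\<close> is the index at which an odd vector takes the value
    \<open>\<epsilon> i * b (int (\<sigma> i))\<close>; it encodes the sign in the index.\<close>
  define u where "u i = (if \<epsilon> i = 1 then int (\<sigma> i) else - int (\<sigma> i))" for i
  have bu: "b (u i) = \<epsilon> i * b (int (\<sigma> i))" if "b \<in> ambient s" for b i
    using sgns[of i] sgn1[of i] ambient_neg[OF that, of "int (\<sigma> i)"] by (cases "s = 1") (auto simp: u_def)
  have \<sigma>in: "\<sigma> i \<in> {1..n}" if "i \<in> {1..n}" for i using permutes_in_image[OF perm] that by simp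
  have uE: "u i \<in> E" if "i \<in> {1..n}" for i
    using \<sigma>in[OF that] sgns[of i] sgn1[of i] by (cases "s = 1") (auto simp: u_def E_def index_set_def)
  have u_inj: "u i \<noteq> u j" if "i \<in> {1..n}" "j \<in> {1..n}" "i \<noteq> j" for i j
  proof -
    have "\<sigma> i \<noteq> \<sigma> j" using permutes_inj[OF perm] that(3) by (auto dest: injD)
    then show ?thesis using \<sigma>in[OF that(1)] by (auto simp: u_def)
  qed
  have u0: "u i \<noteq> 0" if "i \<in> {1..n}" for i using \<sigma>in[OF that] by (auto simp: u_def)
  have cover: "(\<exists>i\<in>{1..n}. q = u i) \<or> s \<noteq> 1 \<and> (q = 0 \<or> (\<exists>i\<in>{1..n}. q = - u i))"
    if q: "q \<in> index_set s n" for q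
  proof (cases "q = 0")
    case False
    then have "nat \<bar>q\<bar> \<in> {1..n}" using q by (auto simp: index_set_def split: if_splits)
    then obtain i where i: "i \<in> {1..n}" "nat \<bar>q\<bar> = \<sigma> i" using permutes_image[OF perm] by (metis imageE)
    then have "q = u i \<or> q = - u i" by (auto simp: u_def)
    moreover have "q = u i" if "s = 1"
      using that q i(2) sgn1[OF that, of i] by (auto simp: u_def index_set_def)
    ultimately show ?thesis using i(1) by blast
  qed (use q in \<open>auto simp: index_set_def split: if_splits\<close>)
  have chain0: "b0 (u (Suc k)) < b0 (u k)" if "1 \<le> k" "k < n" for k
  proof -
    have "b0 (u (Suc k)) \<le> b0 (u k)" using dec[of k "Suc k"] that by (simp add: bu[OF b0(1)])
    moreover have "b0 (u (Suc k)) \<noteq> b0 (u k)"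
      using inj_onD[OF b0(2), of "u (Suc k)" "u k"] uE u_inj[of "Suc k" k] that by (auto simp: E_def)
    ultimately show ?thesis by simp
  qed
  have pos0: "0 < b0 (u i)" if "s \<noteq> 1" "i \<in> {1..n}" for i
  proof -
    have "0 \<le> b0 (u i)" using nonneg[of i] that by (simp add: bu[OF b0(1)])
    moreover have "b0 (u i) \<noteq> b0 0"
      using inj_onD[OF b0(2), of "u i" 0] uE[OF that(2)] u0[OF that(2)] index_set_0[OF that(1)] by (auto simp: E_def)
    ultimately show ?thesis using ambient_0[OF b0(1) that(1)] by simp
  qed
  have "order_type E b0 \<in> regions E (relation_space s n x) \<longleftrightarrow> 0 \<in> convex hull (signed_sum \<sigma> \<epsilon> x ` I)"
    if x: "general_position s n x" for x :: "nat \<Rightarrow> 'a"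
  proof -
    have ind: "any_d_indep (signed_sum \<sigma> \<epsilon> x) I" using x g by (auto simp: general_position_def I_def)
    have x0: "s = 1 \<Longrightarrow> (\<Sum>i\<in>{1..n}. x i) = 0" using x by (simp add: general_position_def)
    note hull = zero_in_hull_iff[OF ind I(1) dim[folded I(2)]]
    show ?thesis
    proof
      assume "order_type E b0 \<in> regions E (relation_space s n x)"
      then obtain b where b: "b \<in> relation_space s n x" "order_type E b0 = order_type E b" by (auto simp: regions_def)
      have ambient: "b \<in> ambient s" using b(1) by (simp add: relation_space_def)
      let ?j = "jump n (\<lambda>i. \<epsilon> i * b (int (\<sigma> i)))"
      have "0 < ?j k" if "k \<in> I" for k
      proof (cases "k < n")
        case True
        have "b (u (Suc k)) < b (u k)"
          using order_type_eqD[OF b(2), of "u (Suc k)" "u k"] chain0[of k] uE True I(3)[OF that] by auto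
        then show ?thesis using True by (simp add: jump_def bu[OF ambient])
      next
        case False
        then have k: "k = n" "s \<noteq> 1" using that I(3)[OF that] n by (auto simp: I_def)
        have "b 0 < b (u n)"
          using order_type_eqD[OF b(2), of 0 "u n"] pos0[of n] uE[of n] k(2) n index_set_0[OF k(2)] ambient_0[OF b0(1)]
          by (auto simp: E_def)
        then show ?thesis using k ambient_0[OF ambient] by (simp add: jump_def bu[OF ambient])
      qed
      moreover have "(\<Sum>k\<in>I. ?j k *\<^sub>R signed_sum \<sigma> \<epsilon> x k) = 0"
        using relation_space_jumps[OF s n x0 g, of b] b(1) by (simp add: relation_space_def I_def)
      ultimately show "0 \<in> convex hull (signed_sum \<sigma> \<epsilon> x ` I)"
        unfolding hull by (intro exI[of _ ?j] conjI ballI)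
    next
      assume "0 \<in> convex hull (signed_sum \<sigma> \<epsilon> x ` I)"
      then obtain c where c: "\<And>k. k \<in> I \<Longrightarrow> 0 < c k" "(\<Sum>k\<in>I. c k *\<^sub>R signed_sum \<sigma> \<epsilon> x k) = 0"
        unfolding hull by blast
      \<comment> \<open>Tail sums invert the passage to jumps. The last one is the empty sum 0 in
        type A and \<open>c n\<close> in type B.\<close>
      define \<beta> where "\<beta> i = (\<Sum>k\<in>{i..n + s - 2}. c k)" for i
      have \<beta>Suc: "\<beta> k = c k + \<beta> (Suc k)" if "k \<in> I" for k
        using that by (simp add: \<beta>_def I_def sum.atLeast_Suc_atMost)
      have chain: "\<beta> (Suc k) < \<beta> k" if "1 \<le> k" "k < n" for k
      proof -
        have "k \<in> I" using that s by (auto simp: I_def)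
        then show ?thesis using \<beta>Suc c(1) by force
      qed
      have \<beta>pos: "0 < \<beta> i" if "s \<noteq> 1" "i \<in> {1..n}" for i
        unfolding \<beta>_def using that s c(1) by (intro sum_pos) (auto simp: I_def)
      \<comment> \<open>Undoes the sorting. In type B the factor \<open>sgn q\<close> extends the
        values oddly to negative indices and gives 0 at the index 0.\<close>
      define b where "b q = (if s = 1 then \<beta> (inv \<sigma> (nat q))
        else real_of_int (sgn q) * \<epsilon> (inv \<sigma> (nat \<bar>q\<bar>)) * \<beta> (inv \<sigma> (nat \<bar>q\<bar>)))" for q
      have ambient: "b \<in> ambient s" by (auto simp: ambient_def b_def sgn_if)
      have b\<sigma>: "\<epsilon> i * b (int (\<sigma> i)) = \<beta> i" if "i \<in> {1..n}" for i
        using \<sigma>in[OF that] sgns[of i] sgn1[of i] permutes_inverses(2)[OF perm, of i]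
        by (cases "s = 1") (auto simp: b_def)
      have jump_eq: "jump n (\<lambda>i. \<epsilon> i * b (int (\<sigma> i))) k = c k" if "k \<in> I" for k
      proof (cases "k < n")
        case True
        then show ?thesis using b\<sigma>[of k] b\<sigma>[of "Suc k"] \<beta>Suc[OF that] I(3)[OF that] by (simp add: jump_def)
      next
        case False
        then have k: "k = n" "s = 2" using that I(3)[OF that] n s by (auto simp: I_def)
        then show ?thesis using b\<sigma>[of n] n by (simp add: jump_def \<beta>_def)
      qed
      have "(\<Sum>i\<in>{1..n}. b (int i) *\<^sub>R x i) = (\<Sum>k\<in>I. c k *\<^sub>R signed_sum \<sigma> \<epsilon> x k)"
        using relation_space_jumps[OF s n x0 g, of b] jump_eq by (simp add: I_def)
      then have "b \<in> relation_space s n x" using c(2) ambient by (simp add: relation_space_def)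
      moreover have "order_type E b0 = order_type E b"
        unfolding E_def
      proof (rule order_type_eq_by_chain[OF b0(1) ambient cover])
        fix i j assume ij: "i \<in> {1..n}" "j \<in> {1..n}"
        show "b0 (u i) < b0 (u j) \<longleftrightarrow> b (u i) < b (u j)"
          using decreasing_chain_less_iff[of n "\<lambda>i. b0 (u i)", OF chain0 ij]
            decreasing_chain_less_iff[of n \<beta>, OF chain ij] b\<sigma> ij by (simp add: bu[OF ambient])
      qed (use pos0 \<beta>pos b\<sigma> in \<open>auto simp: bu[OF ambient]\<close>)
      moreover from this have "inj_on b E" using order_type_inj b0(2) unfolding E_def by blast
      ultimately show "order_type E b0 \<in> regions E (relation_space s n x)" by (auto simp: regions_def)
    qed
  qed
  then show thesis using that[OF g] unfolding E_def I_def by blast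
qed

subsection \<open>The nonabsorption probability in types A and B\<close>

text \<open>
  Nonabsorption and linear independence are expressed by the existence of a vector in an open set, which can
  be taken from a countable dense set; this makes both measurable.
\<close>

lemma exists_positive_functional_iff:
  fixes D :: "'a::euclidean_space set" and w :: "'i \<Rightarrow> 'a"
  assumes D: "\<And>X. open X \<Longrightarrow> X \<noteq> {} \<Longrightarrow> \<exists>d\<in>D. d \<in> X" and I: "finite I"
  shows "(\<exists>u. \<forall>k\<in>I. 0 < w k \<bullet> u) \<longleftrightarrow> (\<exists>u\<in>D. \<forall>k\<in>I. 0 < w k \<bullet> u)"
proof
  assume "\<exists>u. \<forall>k\<in>I. 0 < w k \<bullet> u"
  then have "(\<Inter>k\<in>I. {u. 0 < w k \<bullet> u}) \<noteq> {}" by auto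
  moreover have "open (\<Inter>k\<in>I. {u. 0 < w k \<bullet> u})"
    using I by (intro open_INT ballI open_Collect_less continuous_intros)
  ultimately show "\<exists>u\<in>D. \<forall>k\<in>I. 0 < w k \<bullet> u" using D by fastforce
qed blast

lemma zero_notin_hull_iff:
  fixes w :: "'i \<Rightarrow> 'a::euclidean_space"
  assumes I: "finite I"
  shows "0 \<notin> convex hull (w ` I) \<longleftrightarrow> (\<exists>u. \<forall>k\<in>I. 0 < w k \<bullet> u)"
proof
  assume "0 \<notin> convex hull (w ` I)"
  moreover have "closed (convex hull (w ` I))"
    using I by (intro compact_imp_closed finite_imp_compact_convex_hull) simp
  ultimately obtain a b where ab: "0 < b" "\<forall>x\<in>convex hull (w ` I). b < a \<bullet> x"
    using separating_hyperplane_closed_0[OF convex_convex_hull] by blast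
  have "\<forall>k\<in>I. 0 < w k \<bullet> a"
  proof
    fix k assume "k \<in> I"
    then have "b < a \<bullet> w k" using ab(2) by (simp add: hull_inc)
    then show "0 < w k \<bullet> a" using ab(1) by (simp add: inner_commute)
  qed
  then show "\<exists>u. \<forall>k\<in>I. 0 < w k \<bullet> u" ..
next
  assume "\<exists>u. \<forall>k\<in>I. 0 < w k \<bullet> u"
  then obtain u where "\<forall>k\<in>I. 0 < w k \<bullet> u" ..
  then have "convex hull (w ` I) \<subseteq> {x. u \<bullet> x > 0}"
    by (intro hull_minimal convex_halfspace_gt) (auto simp: inner_commute)
  then show "0 \<notin> convex hull (w ` I)" by auto
qed

text \<open>On an independent family a linear functional can be prescribed to be 1 or -1 at will.
  Conversely, the sign pattern of the coefficients of a dependency would make a vanishing sum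
  positive, and two equal members exclude a pattern that separates them.\<close>

lemma independent_family_iff:
  fixes v :: "'i \<Rightarrow> 'a::euclidean_space"
  assumes K: "finite K"
  shows "inj_on v K \<and> independent (v ` K) \<longleftrightarrow>
    (\<forall>P\<in>Pow K. \<exists>u. \<forall>k\<in>K. 0 < (if k \<in> P then v k else - v k) \<bullet> u)"
proof
  assume *: "inj_on v K \<and> independent (v ` K)"
  show "\<forall>P\<in>Pow K. \<exists>u. \<forall>k\<in>K. 0 < (if k \<in> P then v k else - v k) \<bullet> u"
  proof
    fix P assume "P \<in> Pow K"
    define s :: "'a \<Rightarrow> real" where "s y = (if inv_into K v y \<in> P then 1 else -1)" for y
    obtain f where f: "linear f" "\<forall>y\<in>v ` K. f y = s y"
      using linear_independent_extend[of "v ` K" s] * by blast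
    have "v k \<bullet> adjoint f 1 = (if k \<in> P then 1 else -1)" if "k \<in> K" for k
      using adjoint_works[OF f(1), of "v k" 1] f(2) * that by (simp add: s_def)
    then show "\<exists>u. \<forall>k\<in>K. 0 < (if k \<in> P then v k else - v k) \<bullet> u"
      by (intro exI[of _ "adjoint f 1"]) auto
  qed
next
  assume *: "\<forall>P\<in>Pow K. \<exists>u. \<forall>k\<in>K. 0 < (if k \<in> P then v k else - v k) \<bullet> u"
  have inj: "inj_on v K"
  proof (rule inj_onI, rule ccontr)
    fix i j assume ij: "i \<in> K" "j \<in> K" "v i = v j" "i \<noteq> j"
    then obtain u where "\<forall>k\<in>K. 0 < (if k \<in> {i} then v k else - v k) \<bullet> u" using *[rule_format, of "{i}"] by auto
    from this[rule_format, of i] this[rule_format, of j] show False using ij by simp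
  qed
  moreover have "independent (v ` K)"
  proof
    assume "dependent (v ` K)"
    then obtain a y where y: "y \<in> v ` K" "a y \<noteq> 0" and a: "(\<Sum>y\<in>v ` K. a y *\<^sub>R y) = 0"
      using dependent_finite[of "v ` K"] K by auto
    define P where "P = {k \<in> K. 0 \<le> a (v k)}"
    obtain u where u: "\<forall>k\<in>K. 0 < (if k \<in> P then v k else - v k) \<bullet> u"
      using *[rule_format, of P] by (auto simp: P_def)
    have pos: "0 \<le> a (v k) * (v k \<bullet> u) \<and> (a (v k) \<noteq> 0 \<longrightarrow> 0 < a (v k) * (v k \<bullet> u))" if "k \<in> K" for k
    proof (cases "0 \<le> a (v k)")
      case True
      then have "0 < v k \<bullet> u" using u[rule_format, OF that] that by (simp add: P_def)
      then show ?thesis using True by simp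
    next
      case False
      then have "v k \<bullet> u < 0" using u[rule_format, OF that] that by (simp add: P_def)
      then have "0 < a (v k) * (v k \<bullet> u)" using False by (intro mult_neg_neg) auto
      then show ?thesis by simp
    qed
    obtain k where k: "k \<in> K" "y = v k" using y by blast
    have "0 < (\<Sum>k\<in>K. a (v k) * (v k \<bullet> u))"
      using pos pos[OF k(1)] y k by (intro sum_pos2[OF K k(1)]) auto
    also have "\<dots> = (\<Sum>y\<in>v ` K. a y *\<^sub>R y) \<bullet> u"
      using inj by (simp add: sum.reindex inner_sum_left)
    finally show False using a by simp
  qed
  ultimately show "inj_on v K \<and> independent (v ` K)" by simp
qed

section \<open>Measurability of the events\<close>

lemma sets_exists_positive_functional:
  fixes w :: "'i \<Rightarrow> 'w \<Rightarrow> 'a::euclidean_space"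
  assumes I: "finite I" and [measurable]: "\<And>k. k \<in> I \<Longrightarrow> w k \<in> borel_measurable M"
  shows "{\<omega> \<in> space M. \<exists>u. \<forall>k\<in>I. 0 < w k \<omega> \<bullet> u} \<in> sets M"
proof -
  obtain D :: "'a set" where D: "countable D" "\<And>X. open X \<Longrightarrow> X \<noteq> {} \<Longrightarrow> \<exists>d\<in>D. d \<in> X"
    using countable_dense_exists by blast
  have "{\<omega> \<in> space M. \<exists>u\<in>D. \<forall>k\<in>I. 0 < w k \<omega> \<bullet> u} \<in> sets M"
    by (intro sets.sets_Collect_countable_Ex' sets.sets_Collect_finite_All D(1) I) measurable
  then show ?thesis using exists_positive_functional_iff[OF D(2) I] by simp
qed

lemma sets_zero_notin_hull:
  fixes w :: "'i \<Rightarrow> 'w \<Rightarrow> 'a::euclidean_space"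
  assumes "finite I" "\<And>k. k \<in> I \<Longrightarrow> w k \<in> borel_measurable M"
  shows "{\<omega> \<in> space M. 0 \<notin> convex hull ((\<lambda>k. w k \<omega>) ` I)} \<in> sets M"
  unfolding zero_notin_hull_iff[OF assms(1)] by (rule sets_exists_positive_functional[of I w M, OF assms])

lemma sets_zero_in_hull:
  fixes w :: "'i \<Rightarrow> 'w \<Rightarrow> 'a::euclidean_space"
  assumes "finite I" "\<And>k. k \<in> I \<Longrightarrow> w k \<in> borel_measurable M"
  shows "{\<omega> \<in> space M. 0 \<in> convex hull ((\<lambda>k. w k \<omega>) ` I)} \<in> sets M"
proof -
  have "{\<omega> \<in> space M. 0 \<in> convex hull ((\<lambda>k. w k \<omega>) ` I)} =
      space M - {\<omega> \<in> space M. 0 \<notin> convex hull ((\<lambda>k. w k \<omega>) ` I)}" by blast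
  then show ?thesis using sets_zero_notin_hull[of I w M, OF assms] by simp
qed

lemma sets_any_d_indep:
  fixes w :: "nat \<Rightarrow> 'w \<Rightarrow> 'a::euclidean_space"
  assumes I: "finite I" and w: "\<And>k. k \<in> I \<Longrightarrow> w k \<in> borel_measurable M"
  shows "{\<omega> \<in> space M. any_d_indep (\<lambda>k. w k \<omega>) I} \<in> sets M"
proof -
  have eq: "any_d_indep (\<lambda>k. w k \<omega>) I \<longleftrightarrow>
      (\<forall>K\<in>{K \<in> Pow I. card K = DIM('a)}. \<forall>P\<in>Pow K. \<exists>u. \<forall>k\<in>K. 0 < (if k \<in> P then w k \<omega> else - w k \<omega>) \<bullet> u)" for \<omega>
  proof -
    have "any_d_indep (\<lambda>k. w k \<omega>) I \<longleftrightarrow>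
        (\<forall>K\<in>{K \<in> Pow I. card K = DIM('a)}. inj_on (\<lambda>k. w k \<omega>) K \<and> independent ((\<lambda>k. w k \<omega>) ` K))"
      by (auto simp: any_d_indep_def)
    also have "\<dots> \<longleftrightarrow> (\<forall>K\<in>{K \<in> Pow I. card K = DIM('a)}. \<forall>P\<in>Pow K. \<exists>u. \<forall>k\<in>K.
        0 < (if k \<in> P then w k \<omega> else - w k \<omega>) \<bullet> u)"
      using I by (intro ball_cong refl independent_family_iff) (auto intro: finite_subset)
    finally show ?thesis .
  qed
  show ?thesis
    unfolding eq
  proof (intro sets.sets_Collect_finite_All)
    fix K P assume K: "K \<in> {K \<in> Pow I. card K = DIM('a)}" and P: "P \<in> Pow K"
    have "(\<lambda>\<omega>. if k \<in> P then w k \<omega> else - w k \<omega>) \<in> borel_measurable M" if "k \<in> K" for k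
    proof -
      have [measurable]: "w k \<in> borel_measurable M" using w K that by blast
      show ?thesis by simp
    qed
    then show "{\<omega> \<in> space M. \<exists>u. \<forall>k\<in>K. 0 < (if k \<in> P then w k \<omega> else - w k \<omega>) \<bullet> u} \<in> sets M"
      using sets_exists_positive_functional[of K "\<lambda>k \<omega>. if k \<in> P then w k \<omega> else - w k \<omega>" M]
        finite_subset[OF _ I] K by simp
  qed (use I in \<open>auto intro: finite_subset\<close>)
qed

lemma any_d_indep_cong:
  fixes v w :: "nat \<Rightarrow> 'a::euclidean_space"
  assumes "\<And>k. k \<in> I \<Longrightarrow> v k = w k"
  shows "any_d_indep v I \<longleftrightarrow> any_d_indep w I"
proof -
  have "inj_on v K = inj_on w K" "v ` K = w ` K" if "K \<subseteq> I" for K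
    using assms that by (auto intro!: inj_on_cong image_cong)
  then show ?thesis unfolding any_d_indep_def by auto
qed

section \<open>Walks invariant under the Weyl group\<close>

lemma measurable_psum:
  assumes "rand_vectors M n \<xi>" "k \<le> n"
  shows "(\<lambda>\<omega>. psum \<xi> k \<omega>) \<in> borel_measurable M"
  using assms unfolding psum_def rand_vectors_def by (intro borel_measurable_sum) auto

text \<open>Common form of types A (\<open>s = 1\<close>) and B (\<open>s = 2\<close>), so that the
  formula is proved once. Type D is later reduced to two instances with
  \<open>s = 2\<close>.\<close>

definition sym_walk :: "nat \<Rightarrow> 'w measure \<Rightarrow> nat \<Rightarrow> (nat \<Rightarrow> 'w \<Rightarrow> 'a::euclidean_space) \<Rightarrow> bool" where
  "sym_walk s M n \<xi> \<longleftrightarrow> DIM('a) \<le> n + s - 2 \<and> rand_vectors M n \<xi> \<and>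
     (\<forall>(\<sigma>, \<epsilon>)\<in>signed_perms s n. joint_law M n \<xi> \<sigma> \<epsilon> = joint_law M n \<xi> id (\<lambda>_. 1)) \<and>
     (s = 1 \<longrightarrow> (AE \<omega> in M. psum \<xi> n \<omega> = 0)) \<and>
     (AE \<omega> in M. any_d_indep (\<lambda>k. psum \<xi> k \<omega>) {1..n + s - 2})"

lemma typeA_sym_walk:
  fixes \<xi> :: "nat \<Rightarrow> 'w \<Rightarrow> 'a::euclidean_space"
  assumes "typeA M n \<xi>"
  shows "sym_walk 1 M n \<xi>"
proof -
  have t: "n \<ge> DIM('a) + 1" "rand_vectors M n \<xi>"
      "\<forall>\<sigma>. \<sigma> permutes {1..n} \<longrightarrow> joint_law M n \<xi> \<sigma> (\<lambda>_. 1) = joint_law M n \<xi> id (\<lambda>_. 1)"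
      "AE \<omega> in M. psum \<xi> n \<omega> = 0" "AE \<omega> in M. any_d_indep (\<lambda>k. psum \<xi> k \<omega>) {1..n - 1}"
    using assms unfolding typeA_def by blast+
  show ?thesis
    unfolding sym_walk_def
  proof (intro conjI ballI, unfold split_paired_all prod.case)
    fix \<sigma> \<epsilon> assume g: "(\<sigma>, \<epsilon>) \<in> signed_perms 1 n"
    have "\<epsilon> = (\<lambda>_. 1)" using signed_perms_signs(3)[OF g] by auto
    then show "joint_law M n \<xi> \<sigma> \<epsilon> = joint_law M n \<xi> id (\<lambda>_. 1)"
      using t(3)[THEN spec, THEN mp, OF signed_perms_signs(1)[OF g]] by simp
  qed (use t in auto)
qed

lemma typeB_sym_walk:
  fixes \<xi> :: "nat \<Rightarrow> 'w \<Rightarrow> 'a::euclidean_space"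
  assumes "typeB M n \<xi>"
  shows "sym_walk 2 M n \<xi>"
proof -
  have t: "n \<ge> DIM('a)" "rand_vectors M n \<xi>"
      "\<forall>\<sigma> \<epsilon>. \<sigma> permutes {1..n} \<longrightarrow> (\<forall>i\<in>{1..n}. \<epsilon> i \<in> {-1, 1}) \<longrightarrow>
        joint_law M n \<xi> \<sigma> \<epsilon> = joint_law M n \<xi> id (\<lambda>_. 1)"
      "AE \<omega> in M. any_d_indep (\<lambda>k. psum \<xi> k \<omega>) {1..n}"
    using assms unfolding typeB_def by blast+
  show ?thesis
    unfolding sym_walk_def
  proof (intro conjI ballI, unfold split_paired_all prod.case)
    fix \<sigma> \<epsilon> assume g: "(\<sigma>, \<epsilon>) \<in> signed_perms 2 n"
    have "\<forall>i\<in>{1..n}. \<epsilon> i \<in> {-1, 1}" using signed_perms_signs(2)[OF g] by auto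
    then show "joint_law M n \<xi> \<sigma> \<epsilon> = joint_law M n \<xi> id (\<lambda>_. 1)"
      using t(3)[THEN spec, THEN spec, THEN mp, OF signed_perms_signs(1)[OF g]] by blast
  qed (use t(1,2,4) in auto)
qed

text \<open>With this, \<open>card_regions\<close> at codimension 0 gives the total number of
  chambers.\<close>

lemma generic_ambient:
  assumes s: "s \<in> {1, 2}"
  shows "generic s n 0 (ambient s)"
  unfolding generic_def
proof (intro conjI ballI allI impI)
  fix b i j assume b: "b \<in> ambient s" and ij: "i \<in> index_set s n" "j \<in> index_set s n" "b i \<noteq> b j"
  then show "s * 0 + s + 1 \<le> card (b ` index_set s n)" using ambient_card_image[OF s b ij] by simp
next
  fix y :: "nat \<Rightarrow> int \<Rightarrow> real" assume y: "\<forall>j\<le>0. y j \<in> ambient s"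
  show "\<exists>l. (\<exists>j\<le>0. l j \<noteq> 0) \<and> (\<exists>b\<in>ambient s. \<forall>i\<in>index_set s n. b i = (\<Sum>j\<le>0. l j * y j i))"
    by (intro exI[of _ "\<lambda>_. 1"] conjI exI[of _ 0] bexI[of _ "y 0"]) (use y in auto)
qed (use lin_closed_ambient in auto)

definition tuple :: "nat \<Rightarrow> (nat \<Rightarrow> 'w \<Rightarrow> 'a::euclidean_space) \<Rightarrow> (nat \<Rightarrow> nat) \<Rightarrow> (nat \<Rightarrow> real) \<Rightarrow> 'w \<Rightarrow> nat \<Rightarrow> 'a" where
  "tuple n \<xi> \<sigma> \<epsilon> \<omega> = (\<lambda>i\<in>{1..n}. \<epsilon> i *\<^sub>R \<xi> (\<sigma> i) \<omega>)"

lemma measurable_tuple: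
  assumes "rand_vectors M n \<xi>" "\<sigma> permutes {1..n}"
  shows "tuple n \<xi> \<sigma> \<epsilon> \<in> M \<rightarrow>\<^sub>M (\<Pi>\<^sub>M i\<in>{1..n}. borel)"
  unfolding tuple_def[abs_def]
proof (rule measurable_restrict)
  fix i assume "i \<in> {1..n}"
  then have "\<xi> (\<sigma> i) \<in> borel_measurable M"
    using assms permutes_in_image[OF assms(2), of i] by (auto simp: rand_vectors_def)
  then show "(\<lambda>\<omega>. \<epsilon> i *\<^sub>R \<xi> (\<sigma> i) \<omega>) \<in> borel_measurable M" by simp
qed

lemma signed_sum_tuple:
  "k \<le> n \<Longrightarrow> signed_sum \<sigma> \<epsilon> (\<lambda>i. \<xi> i \<omega>) k = (\<Sum>i\<in>{1..k}. tuple n \<xi> \<sigma> \<epsilon> \<omega> i)"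
  by (auto simp: signed_sum_def tuple_def intro!: sum.cong)

lemma psum_eq_signed_sum: "psum \<xi> k \<omega> = signed_sum id (\<lambda>_. 1) (\<lambda>i. \<xi> i \<omega>) k"
  by (simp add: psum_def signed_sum_def)

lemma signed_perms_id: "(id, \<lambda>_. 1) \<in> signed_perms s n"
  by (auto simp: signed_perms_def)

lemma measurable_coordinate_sum:
  fixes k n :: nat
  shows "k \<le> n \<Longrightarrow> (\<lambda>y. \<Sum>i\<in>{1..k}. y i) \<in> borel_measurable (\<Pi>\<^sub>M i\<in>{1..n}. (borel :: 'a::euclidean_space measure))"
  by (intro borel_measurable_sum measurable_component_singleton) auto

context
  fixes s n :: nat and M :: "'w measure" and \<xi> :: "nat \<Rightarrow> 'w \<Rightarrow> 'a::euclidean_space"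
  assumes s: "s \<in> {1, 2}" and walk: "sym_walk s M n \<xi>"
begin

lemma dim_le: "DIM('a) \<le> n + s - 2" and rv: "rand_vectors M n \<xi>"
  using walk by (auto simp: sym_walk_def)

lemma law_eq:
  assumes "(\<sigma>, \<epsilon>) \<in> signed_perms s n"
  shows "distr M (\<Pi>\<^sub>M i\<in>{1..n}. borel) (tuple n \<xi> \<sigma> \<epsilon>) = distr M (\<Pi>\<^sub>M i\<in>{1..n}. borel) (tuple n \<xi> id (\<lambda>_. 1))"
proof -
  have "joint_law M n \<xi> \<sigma> \<epsilon> = joint_law M n \<xi> id (\<lambda>_. 1)"
    using walk assms by (auto simp: sym_walk_def)
  then show ?thesis by (simp add: joint_law_def tuple_def[abs_def])
qed

lemma steps_le: "n + s - 2 \<le> n" using s by auto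

text \<open>Independence is assumed for the given order of steps only. Equality of laws transfers it
  to each transformed walk, and the group is finite, so it holds for all of them simultaneously
  almost surely.\<close>

lemma AE_general_position: "AE \<omega> in M. general_position s n (\<lambda>i. \<xi> i \<omega>)"
proof -
  let ?N = "\<Pi>\<^sub>M i\<in>{1..n}. (borel :: 'a measure)"
  let ?Q = "\<lambda>y. any_d_indep (\<lambda>k. \<Sum>i\<in>{1..k}. y i) {1..n + s - 2}"
  have Q: "{y \<in> space ?N. ?Q y} \<in> sets ?N"
    using steps_le by (intro sets_any_d_indep measurable_coordinate_sum) auto
  have conv: "any_d_indep (signed_sum \<sigma> \<epsilon> (\<lambda>i. \<xi> i \<omega>)) {1..n + s - 2} \<longleftrightarrow> ?Q (tuple n \<xi> \<sigma> \<epsilon> \<omega>)" for \<sigma> \<epsilon> \<omega>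
  proof -
    have "signed_sum \<sigma> \<epsilon> (\<lambda>i. \<xi> i \<omega>) k = (\<Sum>i\<in>{1..k}. tuple n \<xi> \<sigma> \<epsilon> \<omega> i)" if "k \<in> {1..n + s - 2}" for k
      using signed_sum_tuple[of k n] that steps_le by auto
    then show ?thesis by (rule any_d_indep_cong)
  qed
  have "AE \<omega> in M. ?Q (tuple n \<xi> \<sigma> \<epsilon> \<omega>)" if "(\<sigma>, \<epsilon>) \<in> signed_perms s n" for \<sigma> \<epsilon>
  proof -
    have "AE \<omega> in M. ?Q (tuple n \<xi> id (\<lambda>_. 1) \<omega>)"
      using walk unfolding sym_walk_def psum_eq_signed_sum conv by blast
    then have "AE y in distr M ?N (tuple n \<xi> id (\<lambda>_. 1)). ?Q y"
      by (rule AE_distr_iff[OF measurable_tuple[OF rv permutes_id] Q, THEN iffD2])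
    then have "AE y in distr M ?N (tuple n \<xi> \<sigma> \<epsilon>). ?Q y" unfolding law_eq[OF that] .
    then show ?thesis
      by (rule AE_distr_iff[OF measurable_tuple[OF rv signed_perms_signs(1)[OF that]] Q, THEN iffD1])
  qed
  then have "AE \<omega> in M. \<forall>g\<in>signed_perms s n. ?Q (tuple n \<xi> (fst g) (snd g) \<omega>)"
    by (intro AE_finite_allI[OF finite_signed_perms]) auto
  moreover have "AE \<omega> in M. s = 1 \<longrightarrow> psum \<xi> n \<omega> = 0"
    using walk by (cases "s = 1") (auto simp: sym_walk_def)
  ultimately show ?thesis
  proof eventually_elim
    case (elim \<omega>)
    show ?case unfolding general_position_def
    proof (intro conjI ballI, unfold split_paired_all prod.case)
      fix \<sigma> \<epsilon> assume "(\<sigma>, \<epsilon>) \<in> signed_perms s n"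
      from bspec[OF elim(1) this] show "any_d_indep (signed_sum \<sigma> \<epsilon> (\<lambda>i. \<xi> i \<omega>)) {1..n + s - 2}"
        unfolding conv fst_conv snd_conv .
    qed (use elim(2) in \<open>simp add: psum_def\<close>)
  qed
qed

lemma prob_absorb_eq:
  assumes "(\<sigma>, \<epsilon>) \<in> signed_perms s n"
  shows "measure M {\<omega> \<in> space M. 0 \<in> convex hull (signed_sum \<sigma> \<epsilon> (\<lambda>i. \<xi> i \<omega>) ` {1..n + s - 2})} =
    measure M {\<omega> \<in> space M. 0 \<in> convex hull ((\<lambda>k. psum \<xi> k \<omega>) ` {1..n + s - 2})}"
proof -
  let ?N = "\<Pi>\<^sub>M i\<in>{1..n}. (borel :: 'a measure)"
  let ?Y = "{y \<in> space ?N. 0 \<in> convex hull ((\<lambda>k. \<Sum>i\<in>{1..k}. y i) ` {1..n + s - 2})}"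
  have Y: "?Y \<in> sets ?N"
    using steps_le by (intro sets_zero_in_hull measurable_coordinate_sum) auto
  have "measure M {\<omega> \<in> space M. 0 \<in> convex hull (signed_sum \<sigma> \<epsilon> (\<lambda>i. \<xi> i \<omega>) ` {1..n + s - 2})} =
      measure (distr M ?N (tuple n \<xi> \<sigma> \<epsilon>)) ?Y" if "(\<sigma>, \<epsilon>) \<in> signed_perms s n" for \<sigma> \<epsilon>
  proof -
    have meas: "tuple n \<xi> \<sigma> \<epsilon> \<in> M \<rightarrow>\<^sub>M ?N" using measurable_tuple[OF rv signed_perms_signs(1)[OF that]] .
    have img: "signed_sum \<sigma> \<epsilon> (\<lambda>i. \<xi> i \<omega>) ` {1..n + s - 2} = (\<lambda>k. \<Sum>i\<in>{1..k}. tuple n \<xi> \<sigma> \<epsilon> \<omega> i) ` {1..n + s - 2}" for \<omega>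
      using steps_le by (intro image_cong refl signed_sum_tuple) auto
    show ?thesis unfolding measure_distr[OF meas Y] img
      by (intro arg_cong[of _ _ "measure M"]) (use measurable_space[OF meas] in auto)
  qed
  note law = this
  show ?thesis unfolding psum_eq_signed_sum law[OF assms] law[OF signed_perms_id] law_eq[OF assms] ..
qed

text \<open>The number of chambers met by the random relation space is almost surely the constant of
  \<open>card_regions\<close>. Its expectation is also \<open>C * p\<close>, since each of the
  \<open>C\<close> chambers corresponds to a walk with the same law and is met with the absorption
  probability \<open>p\<close>.\<close>

theorem prob_nonabsorption:
  "measure M {\<omega> \<in> space M. 0 \<notin> convex hull ((\<lambda>k. psum \<xi> k \<omega>) ` {1..n + s - 2})}
     = survival s n * zeros_weight s DIM('a) n"
proof -
  interpret prob_space M using rv by (simp add: rand_vectors_def)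
  have n: "3 - s \<le> n" using order_trans[OF DIM_ge_Suc0 dim_le] s by auto
  define E where "E = index_set s n"
  define I where "I = {1..n + s - 2}"
  define T where "T = regions E (ambient s)"
  define C where "C = real s ^ n * fact n"
  define p where "p = measure M {\<omega> \<in> space M. 0 \<in> convex hull ((\<lambda>k. psum \<xi> k \<omega>) ` I)}"
  have Cpos: "C > 0" using s by (auto simp: C_def)
  have finT: "finite T" by (simp add: T_def E_def finite_regions)
  have cardT: "real (card T) = C"
    using card_regions[OF s n generic_ambient[OF s]] by (simp add: T_def E_def C_def)
  \<comment> \<open>The hull criterion for meeting \<open>r\<close> holds only in general position,
    so meeting \<open>r\<close> is replaced by an almost surely equivalent measurable event whose
    indicator can be integrated.\<close>
  have "\<forall>r\<in>T. \<exists>A\<in>sets M. measure M A = p \<and>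
      (AE \<omega> in M. \<omega> \<in> A \<longleftrightarrow> r \<in> regions E (relation_space s n (\<lambda>i. \<xi> i \<omega>)))"
  proof
    fix r assume "r \<in> T"
    then obtain b where b: "b \<in> ambient s" "inj_on b E" "r = order_type E b" by (auto simp: T_def regions_def)
    obtain \<sigma> \<epsilon> where g: "(\<sigma>, \<epsilon>) \<in> signed_perms s n"
      and hit: "\<And>x :: nat \<Rightarrow> 'a. general_position s n x \<Longrightarrow> order_type (index_set s n) b \<in> regions (index_set s n) (relation_space s n x) \<longleftrightarrow>
         0 \<in> convex hull (signed_sum \<sigma> \<epsilon> x ` {1..n + s - 2})"
      using region_hit_iff[OF s dim_le b(1) b(2)[unfolded E_def]] by metis
    define A where "A = {\<omega> \<in> space M. 0 \<in> convex hull (signed_sum \<sigma> \<epsilon> (\<lambda>i. \<xi> i \<omega>) ` I)}"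
    have "A \<in> sets M"
      unfolding A_def
    proof (rule sets_zero_in_hull)
      fix k assume "k \<in> I"
      then have "\<sigma> i \<in> {1..n}" if "i \<in> {1..k}" for i
        using that steps_le permutes_in_image[OF signed_perms_signs(1)[OF g], of i] by (auto simp: I_def)
      then show "(\<lambda>\<omega>. signed_sum \<sigma> \<epsilon> (\<lambda>i. \<xi> i \<omega>) k) \<in> borel_measurable M"
        using rv unfolding signed_sum_def rand_vectors_def
        by (intro borel_measurable_sum borel_measurable_scaleR) auto
    qed (simp add: I_def)
    moreover have "measure M A = p" using prob_absorb_eq[OF g] by (simp add: A_def p_def I_def)
    moreover have "AE \<omega> in M. \<omega> \<in> A \<longleftrightarrow> r \<in> regions E (relation_space s n (\<lambda>i. \<xi> i \<omega>))"
      using AE_general_position AE_space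
    proof eventually_elim
      case (elim \<omega>)
      then show ?case using hit[OF elim(1)] unfolding A_def E_def I_def b(3) by simp
    qed
    ultimately show "\<exists>A\<in>sets M. measure M A = p \<and>
      (AE \<omega> in M. \<omega> \<in> A \<longleftrightarrow> r \<in> regions E (relation_space s n (\<lambda>i. \<xi> i \<omega>)))"
      by (intro bexI[of _ A] conjI)
  qed
  then obtain A where A: "\<And>r. r \<in> T \<Longrightarrow> A r \<in> sets M" "\<And>r. r \<in> T \<Longrightarrow> measure M (A r) = p"
      "\<And>r. r \<in> T \<Longrightarrow> AE \<omega> in M. \<omega> \<in> A r \<longleftrightarrow> r \<in> regions E (relation_space s n (\<lambda>i. \<xi> i \<omega>))"
    using bchoice[of T "\<lambda>r A. A \<in> sets M \<and> measure M A = p \<and>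
      (AE \<omega> in M. \<omega> \<in> A \<longleftrightarrow> r \<in> regions E (relation_space s n (\<lambda>i. \<xi> i \<omega>)))"] by (auto simp: Bex_def)
  have "AE \<omega> in M. \<forall>r\<in>T. \<omega> \<in> A r \<longleftrightarrow> r \<in> regions E (relation_space s n (\<lambda>i. \<xi> i \<omega>))"
    by (rule AE_finite_allI[OF finT A(3)])
  then have "AE \<omega> in M. (\<Sum>r\<in>T. indicator (A r) \<omega>) = C * (1 - survival s n * zeros_weight s DIM('a) n)"
    using AE_general_position
  proof eventually_elim
    case (elim \<omega>)
    let ?L = "relation_space s n (\<lambda>i. \<xi> i \<omega>)"
    have gen: "generic s n DIM('a) ?L" by (rule generic_relation_space[OF s dim_le elim(2)])
    have sub: "regions E ?L \<subseteq> T" using genericD(1)[OF gen] by (auto simp: T_def regions_def)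
    have "(\<Sum>r\<in>T. indicator (A r) \<omega>) = (\<Sum>r\<in>T. if r \<in> regions E ?L then 1 else (0::real))"
      using elim(1) by (intro sum.cong) (auto simp: indicator_def)
    also have "\<dots> = real (card (regions E ?L))"
      using finT sub by (simp add: sum.If_cases Int_absorb1)
    also have "\<dots> = C * (1 - survival s n * zeros_weight s DIM('a) n)"
      using card_regions[OF s n gen] by (simp add: E_def C_def)
    finally show ?case .
  qed
  then have "(\<integral>\<omega>. (\<Sum>r\<in>T. indicator (A r) \<omega>) \<partial>M) = (\<integral>\<omega>. C * (1 - survival s n * zeros_weight s DIM('a) n) \<partial>M)"
    using A(1) by (intro integral_cong_AE borel_measurable_sum borel_measurable_indicator) auto
  moreover have "(\<integral>\<omega>. (\<Sum>r\<in>T. indicator (A r) \<omega>) \<partial>M) = (\<Sum>r\<in>T. measure M (A r))"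
    using A(1) by (subst Bochner_Integration.integral_sum)
      (auto intro!: integrable_real_indicator simp: emeasure_eq_measure sets.Int_space_eq2)
  ultimately have "C * p = C * (1 - survival s n * zeros_weight s DIM('a) n)"
    using A(2) cardT by (simp add: prob_space)
  then have "p = 1 - survival s n * zeros_weight s DIM('a) n" using Cpos by simp
  moreover have "measure M {\<omega> \<in> space M. 0 \<notin> convex hull ((\<lambda>k. psum \<xi> k \<omega>) ` I)} = 1 - p"
  proof -
    have "{\<omega> \<in> space M. 0 \<in> convex hull ((\<lambda>k. psum \<xi> k \<omega>) ` I)} \<in> events"
    proof (rule sets_zero_in_hull)
      fix k assume "k \<in> I"
      then show "(\<lambda>\<omega>. psum \<xi> k \<omega>) \<in> borel_measurable M"
        using steps_le by (intro measurable_psum[OF rv]) (auto simp: I_def)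
    qed (simp add: I_def)
    moreover have "{\<omega> \<in> space M. 0 \<notin> convex hull ((\<lambda>k. psum \<xi> k \<omega>) ` I)} =
        space M - {\<omega> \<in> space M. 0 \<in> convex hull ((\<lambda>k. psum \<xi> k \<omega>) ` I)}" by blast
    ultimately show ?thesis using prob_compl unfolding p_def by simp
  qed
  ultimately show ?thesis by (simp add: I_def)
qed

end

subsection \<open>Asymptotics\<close>

text \<open>Telescoping from a suitable \<open>N\<close> on uses up half of \<open>c\<close>; the
  other half absorbs the initial value \<open>z N\<close>, because \<open>y\<close>
  diverges.\<close>

lemma smallo_of_increments:
  fixes y z :: "nat \<Rightarrow> real"
  assumes top: "filterlim y at_top sequentially"
    and inc: "eventually (\<lambda>n. y n \<le> y (Suc n)) sequentially"
    and small: "(\<lambda>n. z (Suc n) - z n) \<in> o(\<lambda>n. y (Suc n) - y n)"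
  shows "z \<in> o(y)"
proof (rule landau_o.smallI)
  fix c :: real assume c: "c > 0"
  have "eventually (\<lambda>n. norm (z (Suc n) - z n) \<le> c / 2 * norm (y (Suc n) - y n)) sequentially"
    using landau_o.smallD[OF small, of "c / 2"] c by simp
  then have "eventually (\<lambda>n. \<bar>z (Suc n) - z n\<bar> \<le> c / 2 * (y (Suc n) - y n)) sequentially"
    using inc by eventually_elim simp
  then obtain N where N: "\<And>n. n \<ge> N \<Longrightarrow> \<bar>z (Suc n) - z n\<bar> \<le> c / 2 * (y (Suc n) - y n)"
    unfolding eventually_sequentially by blast
  have tele: "\<bar>z n - z N\<bar> \<le> c / 2 * (y n - y N)" if "n \<ge> N" for n
    using that
  proof (induction n rule: dec_induct)
    case (step n)
    have "\<bar>z (Suc n) - z N\<bar> \<le> \<bar>z (Suc n) - z n\<bar> + \<bar>z n - z N\<bar>" by linarith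
    also have "\<dots> \<le> c / 2 * (y (Suc n) - y n) + c / 2 * (y n - y N)"
      using step N[of n] by (intro add_mono) auto
    also have "\<dots> = c / 2 * (y (Suc n) - y N)" by (simp add: field_simps)
    finally show ?case .
  qed simp
  \<comment> \<open>The threshold is \<open>\<bar>z N\<bar> \<le> c / 2 * (y n + y N)\<close> solved
    for \<open>y n\<close>; the terms in \<open>y N\<close> then cancel.\<close>
  have "eventually (\<lambda>n. y n \<ge> 0 \<and> y n \<ge> 2 / c * \<bar>z N\<bar> - y N) sequentially"
    using top by (intro eventually_conj) (simp_all add: filterlim_at_top)
  then show "eventually (\<lambda>n. norm (z n) \<le> c * norm (y n)) sequentially"
    using eventually_ge_at_top[of N]
  proof eventually_elim
    case (elim n)
    have "\<bar>z N\<bar> \<le> c / 2 * (y n + y N)" using elim(1) c by (simp add: field_simps)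
    then have "\<bar>z n - z N\<bar> + \<bar>z N\<bar> \<le> c / 2 * (y n - y N) + c / 2 * (y n + y N)"
      using tele[OF elim(2)] by (rule add_mono[rotated])
    also have "\<dots> = c * y n" by (simp add: field_simps)
    finally have "\<bar>z n\<bar> \<le> c * y n" by linarith
    then show ?case using elim(1) by simp
  qed
qed

lemma stolz_cesaro:
  fixes x y :: "nat \<Rightarrow> real"
  assumes "filterlim y at_top sequentially" "eventually (\<lambda>n. y n \<le> y (Suc n)) sequentially"
    and "(\<lambda>n. x (Suc n) - x n) \<sim>[sequentially] (\<lambda>n. y (Suc n) - y n)"
  shows "x \<sim>[sequentially] y"
proof -
  have "(\<lambda>n. (x (Suc n) - y (Suc n)) - (x n - y n)) \<in> o(\<lambda>n. y (Suc n) - y n)"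
    using assms(3) unfolding asymp_equiv_altdef by (simp add: algebra_simps)
  then show ?thesis
    unfolding asymp_equiv_altdef by (intro smallo_of_increments[OF assms(1,2)]) simp
qed

text \<open>A difference of powers factors into the difference of logarithms, asymptotic to
  \<open>1 / n\<close>, and \<open>d + 1\<close> products that are each asymptotic to
  \<open>ln n ^ d\<close>.\<close>

lemma ln_power_increment:
  "(\<lambda>n. ln (real (Suc n)) ^ Suc d - ln (real n) ^ Suc d) \<sim>[sequentially] (\<lambda>n. real (Suc d) * ln (real n) ^ d / real n)"
proof -
  have eq: "(\<lambda>n. ln (real (Suc n)) ^ Suc d - ln (real n) ^ Suc d) =
      (\<lambda>n. (ln (real (Suc n)) - ln (real n)) * (\<Sum>i<Suc d. ln (real (Suc n)) ^ i * ln (real n) ^ (d - i)))"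
    by (intro ext diff_power_eq_sum)
  have "(\<lambda>n. (ln (real (Suc n)) - ln (real n)) * (\<Sum>i<Suc d. ln (real (Suc n)) ^ i * ln (real n) ^ (d - i)))
      \<sim>[sequentially] (\<lambda>n. (1 / real n) * (real (Suc d) * ln (real n) ^ d))"
  proof (rule asymp_equiv_mult)
    show "(\<lambda>n. ln (real (Suc n)) - ln (real n)) \<sim>[sequentially] (\<lambda>n. 1 / real n)"
      by real_asymp
    have ratio: "(\<lambda>n. ln (real (Suc n)) / ln (real n)) \<longlonglongrightarrow> 1" by real_asymp
    have "(\<lambda>n. \<Sum>i<Suc d. (ln (real (Suc n)) / ln (real n)) ^ i) \<longlonglongrightarrow> (\<Sum>i<Suc d. 1 ^ i)"
      by (intro tendsto_sum tendsto_power ratio)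
    then have "(\<lambda>n. (\<Sum>i<Suc d. (ln (real (Suc n)) / ln (real n)) ^ i) / real (Suc d)) \<longlonglongrightarrow> real (Suc d) / real (Suc d)"
      by (intro tendsto_divide) auto
    then have lim: "(\<lambda>n. (\<Sum>i<Suc d. (ln (real (Suc n)) / ln (real n)) ^ i) / real (Suc d)) \<longlonglongrightarrow> 1" by simp
    show "(\<lambda>n. \<Sum>i<Suc d. ln (real (Suc n)) ^ i * ln (real n) ^ (d - i)) \<sim>[sequentially]
        (\<lambda>n. real (Suc d) * ln (real n) ^ d)"
    proof (rule asymp_equivI'[OF Lim_transform_eventually[OF lim]])
      show "eventually (\<lambda>n. (\<Sum>i<Suc d. (ln (real (Suc n)) / ln (real n)) ^ i) / real (Suc d) =
          (\<Sum>i<Suc d. ln (real (Suc n)) ^ i * ln (real n) ^ (d - i)) / (real (Suc d) * ln (real n) ^ d)) sequentially"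
        using eventually_gt_at_top[of 1]
      proof eventually_elim
        case (elim n)
        then have pos: "ln (real n) > 0" by simp
        have "(ln (real (Suc n)) / ln (real n)) ^ i * ln (real n) ^ d = ln (real (Suc n)) ^ i * ln (real n) ^ (d - i)"
          if "i < Suc d" for i
        proof -
          have "ln (real n) ^ d = ln (real n) ^ i * ln (real n) ^ (d - i)"
            using that by (simp add: power_add[symmetric])
          then show ?thesis using pos by (simp add: power_divide)
        qed
        then have "(\<Sum>i<Suc d. ln (real (Suc n)) ^ i * ln (real n) ^ (d - i)) =
            (\<Sum>i<Suc d. (ln (real (Suc n)) / ln (real n)) ^ i) * ln (real n) ^ d"
          unfolding sum_distrib_right by (intro sum.cong) auto
        then show ?case using pos by simp
      qed
    qed
  qed
  then show ?thesis unfolding eq by simp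
qed

text \<open>The increments of the next weight are asymptotic to
  \<open>(ln n / s) ^ d / (fact d * s * n)\<close>, a discrete derivative of
  \<open>(ln n / s) ^ (d + 1) / fact (d + 1)\<close>; Stolz-Cesaro integrates it.\<close>

lemma zeros_weight_asymp:
  assumes s: "s \<in> {1, 2}"
  shows "zeros_weight s (Suc d) \<sim>[sequentially] (\<lambda>n. (ln (real n) / real s) ^ d / fact d)"
proof (induction d)
  case 0
  have "zeros_weight s (Suc 0) = (\<lambda>n. 1)" by (auto simp: fun_eq_iff)
  then show ?case by simp
next
  case (Suc d)
  have spos: "real s > 0" using s by auto
  define y where "y n = (ln (real n) / real s) ^ Suc d / fact (Suc d)" for n
  define x where "x = zeros_weight s (Suc (Suc d))"
  have "x \<sim>[sequentially] y"
  proof (rule stolz_cesaro)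
    have "filterlim (\<lambda>n. ln (real n) / real s) at_top sequentially"
      using s by (elim insertE) (simp_all, real_asymp+)
    then have "filterlim (\<lambda>n. (ln (real n) / real s) ^ Suc d) at_top sequentially"
      by (intro filterlim_pow_at_top) auto
    then have "filterlim (\<lambda>n. (1 / fact (Suc d)) * (ln (real n) / real s) ^ Suc d) at_top sequentially"
      by (intro filterlim_tendsto_pos_mult_at_top[OF tendsto_const]) auto
    then show "filterlim y at_top sequentially"
      unfolding y_def[abs_def] times_divide_eq_left mult_1_left .
    show "eventually (\<lambda>n. y n \<le> y (Suc n)) sequentially"
      using eventually_gt_at_top[of 1]
    proof eventually_elim
      case (elim n)
      then show ?case unfolding y_def by (intro divide_right_mono power_mono) auto
    qed
    have "(\<lambda>n. x (Suc n) - x n) \<sim>[sequentially] (\<lambda>n. zeros_weight s (Suc d) n * (1 / (real s * real (Suc n) - 1)))"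
    proof (rule asymp_equiv_refl_ev)
      show "eventually (\<lambda>n. x (Suc n) - x n = zeros_weight s (Suc d) n * (1 / (real s * real (Suc n) - 1))) sequentially"
        using eventually_ge_at_top[of "3 - s"]
      proof eventually_elim
        case (elim n)
        then have "{3 - s<..Suc n} = insert (Suc n) {3 - s<..n}" by auto
        then show ?case by (simp add: x_def del: zeros_weight.simps(2)) (simp add: zeros_weight.simps(2)[of s "Suc d"] del: zeros_weight.simps(2))
      qed
    qed
    also have "\<dots> \<sim>[sequentially] (\<lambda>n. ((ln (real n) / real s) ^ d / fact d) * (1 / (real s * real n)))"
    proof (rule asymp_equiv_mult[OF Suc])
      show "(\<lambda>n. 1 / (real s * real (Suc n) - 1)) \<sim>[sequentially] (\<lambda>n. 1 / (real s * real n))"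
        using s by (elim insertE) (simp_all, real_asymp+)
    qed
    also have "\<dots> = (\<lambda>n. (1 / (real s ^ Suc d * fact (Suc d))) * (real (Suc d) * ln (real n) ^ d / real n))"
      by (intro ext) (simp add: power_divide mult_ac del: of_nat_Suc)
    also have "\<dots> \<sim>[sequentially] (\<lambda>n. (1 / (real s ^ Suc d * fact (Suc d))) * (ln (real (Suc n)) ^ Suc d - ln (real n) ^ Suc d))"
      by (intro asymp_equiv_mult asymp_equiv_refl asymp_equiv_symI[OF ln_power_increment])
    also have "\<dots> = (\<lambda>n. y (Suc n) - y n)"
      by (simp add: fun_eq_iff y_def power_divide diff_divide_distrib algebra_simps)
    finally show "(\<lambda>n. x (Suc n) - x n) \<sim>[sequentially] (\<lambda>n. y (Suc n) - y n)" .
  qed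
  then show ?case unfolding x_def y_def[abs_def] .
qed

section \<open>Asymptotics of the product factor\<close>

lemma survival_1: "n \<ge> 2 \<Longrightarrow> survival 1 n = 2 / real n"
proof (induction n rule: dec_induct)
  case base
  show ?case by (simp add: survival_def)
next
  case (step n)
  have "{3 - 1<..Suc n} = insert (Suc n) {3 - 1<..n}" using step by auto
  then have "survival 1 (Suc n) = (1 - 1 / real (Suc n)) * survival 1 n" by (simp add: survival_def)
  then show ?case using step by (simp add: field_simps)
qed

text \<open>The squared factor \<open>((2 k - 1) / (2 k)) ^ 2\<close> times the Wallis factor is
  \<open>(2 k - 1) / (2 k + 1)\<close>, which telescopes against \<open>2 n + 1\<close>. The
  constant 4 compensates the factor \<open>1 / 2\<close> at \<open>k = 1\<close>, which
  \<open>survival\<close> omits.\<close>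

lemma survival_2_wallis:
  "n \<ge> 1 \<Longrightarrow> (survival 2 n)\<^sup>2 * (2 * real n + 1) * (\<Prod>k=1..n. (4 * real k ^ 2) / (4 * real k ^ 2 - 1)) = 4"
proof (induction n rule: dec_induct)
  case base
  show ?case by (simp add: survival_def)
next
  case (step n)
  define W where "W = (\<Prod>k=1..n. (4 * real k ^ 2) / (4 * real k ^ 2 - 1))"
  have "{3 - 2<..Suc n} = insert (Suc n) {3 - 2<..n}" using step by auto
  then have surv: "survival 2 (Suc n) = (1 - 1 / (2 * real (Suc n))) * survival 2 n" by (simp add: survival_def)
  define m where "m = real (Suc n)"
  have m: "m \<ge> 2" using step by (simp add: m_def)
  have A: "(1 - 1 / (2 * m))\<^sup>2 * (2 * m + 1) * ((4 * m\<^sup>2) / (4 * m\<^sup>2 - 1)) = 2 * m - 1"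
  proof -
    have "4 * m\<^sup>2 - 1 = (2 * m - 1) * (2 * m + 1)" by (simp add: algebra_simps power2_eq_square)
    moreover have "(1 - 1 / (2 * m))\<^sup>2 = (2 * m - 1)\<^sup>2 / (4 * m\<^sup>2)"
      using m by (simp add: field_simps power2_eq_square)
    ultimately show ?thesis using m by (simp add: power2_eq_square)
  qed
  have "2 * real n + 1 = 2 * m - 1" by (simp add: m_def)
  then have IH: "(survival 2 n)\<^sup>2 * (2 * m - 1) * W = 4" using step.IH by (simp only: W_def)
  have "(survival 2 (Suc n))\<^sup>2 * (2 * m + 1) * (W * ((4 * m\<^sup>2) / (4 * m\<^sup>2 - 1))) =
      (survival 2 n)\<^sup>2 * W * ((1 - 1 / (2 * m))\<^sup>2 * (2 * m + 1) * ((4 * m\<^sup>2) / (4 * m\<^sup>2 - 1)))"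
    unfolding surv m_def[symmetric] power_mult_distrib by (simp only: mult_ac)
  also have "\<dots> = (survival 2 n)\<^sup>2 * (2 * m - 1) * W" unfolding A by (simp only: mult_ac)
  finally have "(survival 2 (Suc n))\<^sup>2 * (2 * m + 1) * (W * ((4 * m\<^sup>2) / (4 * m\<^sup>2 - 1))) = 4"
    unfolding IH .
  then show ?case by (simp add: W_def m_def)
qed

lemma survival_2_asymp: "survival 2 \<sim>[sequentially] (\<lambda>n. 2 / sqrt (pi * real n))"
proof -
  define W where "W n = (\<Prod>k=1..n. (4 * real k ^ 2) / (4 * real k ^ 2 - 1))" for n
  have W: "W \<longlonglongrightarrow> pi / 2" using wallis unfolding W_def .
  have nonneg: "survival 2 n \<ge> 0" for n
    unfolding survival_def by (intro prod_nonneg) (auto simp: field_simps)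
  \<comment> \<open>This is the quotient of the two sides, rewritten through the Wallis
    product.\<close>
  have "(\<lambda>n. sqrt (pi / 2 / W n * (2 * real n / (2 * real n + 1)))) \<longlonglongrightarrow> sqrt (pi / 2 / (pi / 2) * 1)"
  proof (intro tendsto_real_sqrt tendsto_mult tendsto_divide tendsto_const W)
    show "(\<lambda>n. 2 * real n / (2 * real n + 1)) \<longlonglongrightarrow> 1" by real_asymp
  qed auto
  then have lim: "(\<lambda>n. sqrt (pi / 2 / W n * (2 * real n / (2 * real n + 1)))) \<longlonglongrightarrow> 1" by simp
  show ?thesis
  proof (rule asymp_equivI'[OF Lim_transform_eventually[OF lim]])
    show "eventually (\<lambda>n. sqrt (pi / 2 / W n * (2 * real n / (2 * real n + 1))) =
        survival 2 n / (2 / sqrt (pi * real n))) sequentially"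
      using eventually_ge_at_top[of 1]
    proof eventually_elim
      case (elim n)
      have eq: "(survival 2 n)\<^sup>2 * (2 * real n + 1) * W n = 4"
        using survival_2_wallis[OF elim] by (simp add: W_def)
      then have W0: "W n \<noteq> 0" by auto
      have "2 * real n + 1 \<noteq> 0" by linarith
      then have "(2 * real n + 1) * W n \<noteq> 0" using W0 by simp
      then have sq: "(survival 2 n)\<^sup>2 = 4 / ((2 * real n + 1) * W n)"
        using eq by (simp only: nonzero_eq_divide_eq mult.assoc simp_thms)
      have "sqrt (pi / 2 / W n * (2 * real n / (2 * real n + 1))) = sqrt ((survival 2 n)\<^sup>2 * (pi * real n) / 4)"
      proof -
        have "pi / 2 / W n * (2 * real n / a) = 4 / (a * W n) * (pi * real n) / 4" for a by simp
        then show ?thesis unfolding sq by (rule arg_cong)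
      qed
      also have "\<dots> = survival 2 n / (2 / sqrt (pi * real n))"
        using nonneg[of n] by (simp add: real_sqrt_mult real_sqrt_divide)
      finally show ?case .
    qed
  qed
qed

lemma type_A_asymp:
  "(\<lambda>n. survival 1 n * zeros_weight 1 (Suc d) n) \<sim>[sequentially] (\<lambda>n. 2 * ln (real n) ^ d / (fact d * real n))"
proof -
  have "survival 1 \<sim>[sequentially] (\<lambda>n. 2 / real n)"
    by (rule asymp_equiv_refl_ev, rule eventually_mono[OF eventually_ge_at_top[of 2]], rule survival_1)
  from asymp_equiv_mult[OF this zeros_weight_asymp[of 1 d]]
  show ?thesis by (simp add: mult_ac)
qed

lemma type_B_asymp:
  assumes "d \<ge> 1"
  shows "(\<lambda>n. survival 2 n * zeros_weight 2 (Suc d) n) \<sim>[sequentially]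
    (\<lambda>n. ln (real n) ^ d / (2 ^ (d - 1) * fact d * sqrt (pi * real n)))"
proof -
  \<comment> \<open>The factor 2 of \<open>survival 2\<close> cancels one of the \<open>d\<close>
    factors 2 coming from \<open>1 / s ^ d\<close>; this is the origin of the exponent
    \<open>d - 1\<close>.\<close>
  have "(2::real) ^ d = 2 * 2 ^ (d - 1)" using assms by (cases d) auto
  then show ?thesis
    using asymp_equiv_mult[OF survival_2_asymp zeros_weight_asymp[of 2 d]]
    by (simp add: power_divide mult_ac)
qed

lemma typeB_nonabsorption:
  fixes \<xi> :: "nat \<Rightarrow> 'w \<Rightarrow> 'a::euclidean_space"
  assumes "sym_walk 2 M n \<xi>"
  shows "measure M {\<omega> \<in> space M. 0 \<notin> convex hull ((\<lambda>k. psum \<xi> k \<omega>) ` {1..n})}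
    = survival 2 n * zeros_weight 2 DIM('a) n"
  using prob_nonabsorption[OF _ assms] by simp

subsection \<open>Type D\<close>

text \<open>
  The directions \<open>U1\<close>, \<open>U2\<close> positive on \<open>S\<^sub>n\<close> and on \<open>S\<^sub>n\<^sup>*\<close> cover the convex cone \<open>U0\<close> of directions positive
  on the other partial sums, because \<open>S\<^sub>n + S\<^sub>n\<^sup>* = 2 S\<^bsub>n-1\<^esub>\<close>; by connectedness they meet inside \<open>U0\<close> as soon as
  both do.
\<close>

lemma hullD_avoids_zero_iff:
  fixes \<xi> :: "nat \<Rightarrow> 'w \<Rightarrow> 'a::euclidean_space" and \<omega> :: 'w
  assumes n: "n \<ge> 2"
  defines "S \<equiv> \<lambda>k. psum \<xi> k \<omega>" and "T \<equiv> psum_star \<xi> n \<omega>"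
  shows "0 \<notin> hullD n \<xi> \<omega> \<longleftrightarrow> 0 \<notin> convex hull (S ` {1..n}) \<and> 0 \<notin> convex hull ((S(n := T)) ` {1..n})"
    and "0 \<notin> convex hull (S ` {1..n - 1}) \<longleftrightarrow>
      0 \<notin> convex hull (S ` {1..n}) \<or> 0 \<notin> convex hull ((S(n := T)) ` {1..n})"
proof -
  define U0 where "U0 = {u. \<forall>k\<in>{1..n - 1}. 0 < S k \<bullet> u}"
  define U1 where "U1 = {u. 0 < S n \<bullet> u}"
  define U2 where "U2 = {u. 0 < T \<bullet> u}"
  have split: "{1..n} = insert n {1..n - 1}" "n \<notin> {1..n - 1}" using n by auto
  have h0: "0 \<notin> convex hull (S ` {1..n - 1}) \<longleftrightarrow> U0 \<noteq> {}"
    unfolding zero_notin_hull_iff[OF finite_atLeastAtMost] U0_def by blast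
  have h1: "0 \<notin> convex hull (S ` {1..n}) \<longleftrightarrow> U1 \<inter> U0 \<noteq> {}"
  proof -
    have "(\<exists>u. \<forall>k\<in>{1..n}. 0 < S k \<bullet> u) \<longleftrightarrow> U1 \<inter> U0 \<noteq> {}"
      unfolding split(1) U0_def U1_def by auto
    then show ?thesis unfolding zero_notin_hull_iff[OF finite_atLeastAtMost] .
  qed
  have h2: "0 \<notin> convex hull ((S(n := T)) ` {1..n}) \<longleftrightarrow> U2 \<inter> U0 \<noteq> {}"
  proof -
    have "(\<exists>u. \<forall>k\<in>{1..n}. 0 < (S(n := T)) k \<bullet> u) \<longleftrightarrow> U2 \<inter> U0 \<noteq> {}"
      unfolding split(1) U0_def U2_def using split(2) by auto
    then show ?thesis unfolding zero_notin_hull_iff[OF finite_atLeastAtMost] .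
  qed
  have hD: "0 \<notin> hullD n \<xi> \<omega> \<longleftrightarrow> U1 \<inter> U2 \<inter> U0 \<noteq> {}"
  proof -
    have "hullD n \<xi> \<omega> = convex hull ((S(Suc n := T)) ` {1..Suc n})"
    proof -
      have "{1..Suc n} = insert (Suc n) {1..n}" by auto
      then have "(S(Suc n := T)) ` {1..Suc n} = insert T (S ` {1..n})" by auto
      then show ?thesis by (simp add: hullD_def S_def T_def)
    qed
    moreover have "(\<forall>k\<in>{1..Suc n}. 0 < (S(Suc n := T)) k \<bullet> u) \<longleftrightarrow> u \<in> U1 \<inter> U2 \<inter> U0" for u
    proof -
      have "{1..Suc n} = insert (Suc n) (insert n {1..n - 1})" using n by auto
      moreover have "(\<forall>k\<in>{1..n - 1}. 0 < (S(Suc n := T)) k \<bullet> u) \<longleftrightarrow> (\<forall>k\<in>{1..n - 1}. 0 < S k \<bullet> u)"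
        by (intro ball_cong refl) auto
      ultimately show ?thesis unfolding U0_def U1_def U2_def by (simp add: conj_ac)
    qed
    then have "(\<exists>u. \<forall>k\<in>{1..Suc n}. 0 < (S(Suc n := T)) k \<bullet> u) \<longleftrightarrow> U1 \<inter> U2 \<inter> U0 \<noteq> {}"
      by blast
    ultimately show ?thesis using zero_notin_hull_iff[of "{1..Suc n}" "S(Suc n := T)"] by simp
  qed
  have "S n + T = 2 *\<^sub>R S (n - 1)"
  proof -
    have "S n = S (n - 1) + \<xi> n \<omega>" using split by (simp add: S_def psum_def add.commute)
    then show ?thesis by (simp add: S_def T_def psum_star_def scaleR_2)
  qed
  then have "S n \<bullet> u + T \<bullet> u = 2 * (S (n - 1) \<bullet> u)" for u
    by (metis inner_add_left inner_scaleR_left)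
  moreover have "0 < S (n - 1) \<bullet> u" if "u \<in> U0" for u using that n by (auto simp: U0_def)
  ultimately have cover: "U0 \<subseteq> U1 \<union> U2" unfolding U1_def U2_def by (smt (verit) UnI1 UnI2 mem_Collect_eq subsetI)
  have "convex U0"
  proof -
    have "U0 = (\<Inter>k\<in>{1..n - 1}. {u. S k \<bullet> u > 0})" by (auto simp: U0_def)
    then show ?thesis by (auto intro!: convex_INT convex_halfspace_gt)
  qed
  then have conn: "connected U0" by (rule convex_connected)
  have op: "open U1" "open U2" unfolding U1_def U2_def by (intro open_Collect_less continuous_intros)+
  show "0 \<notin> hullD n \<xi> \<omega> \<longleftrightarrow> 0 \<notin> convex hull (S ` {1..n}) \<and> 0 \<notin> convex hull ((S(n := T)) ` {1..n})"
    unfolding hD h1 h2 using connectedD[OF conn op _ cover] by blast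
  show "0 \<notin> convex hull (S ` {1..n - 1}) \<longleftrightarrow>
      0 \<notin> convex hull (S ` {1..n}) \<or> 0 \<notin> convex hull ((S(n := T)) ` {1..n})"
    unfolding h0 h1 h2 using cover by blast
qed

section \<open>Randomising the sign of the last step\<close>

lemma prod_signs:
  fixes \<epsilon> :: "'i \<Rightarrow> real"
  shows "\<forall>i\<in>A. \<epsilon> i \<in> {-1, 1} \<Longrightarrow> prod \<epsilon> A = 1 \<or> prod \<epsilon> A = -1"
  by (induction A rule: infinite_finite_induct) auto

definition coin :: "bool measure" where "coin = measure_pmf (bernoulli_pmf (1 / 2))"

text \<open>The outcome \<open>False\<close> reverses step \<open>n\<close> and so turns the
  endpoint from \<open>psum\<close> into \<open>psum_star\<close>.\<close>

definition flip_last :: "nat \<Rightarrow> (nat \<Rightarrow> 'w \<Rightarrow> 'a::euclidean_space) \<Rightarrow> nat \<Rightarrow> 'w \<times> bool \<Rightarrow> 'a" where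
  "flip_last n \<xi> i x = (if i = n \<and> \<not> snd x then - \<xi> i (fst x) else \<xi> i (fst x))"

text \<open>A representative of the odd sign vectors, the coset missing in type D.\<close>

definition flip_sign :: "nat \<Rightarrow> nat \<Rightarrow> real" where
  "flip_sign n i = (if i = n then -1 else 1)"

lemma emeasure_coin:
  assumes "prob_space M" "A \<in> sets (M \<Otimes>\<^sub>M coin)"
  shows "emeasure (M \<Otimes>\<^sub>M coin) A =
    emeasure M {\<omega> \<in> space M. (\<omega>, True) \<in> A} * ennreal (1 / 2) + emeasure M {\<omega> \<in> space M. (\<omega>, False) \<in> A} * ennreal (1 / 2)"
proof -
  interpret M: prob_space M by (rule assms(1))
  interpret C: prob_space coin unfolding coin_def by (rule prob_space_measure_pmf)
  interpret pair_sigma_finite M coin ..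
  have sub: "A \<subseteq> space M \<times> UNIV"
    using sets.sets_into_space[OF assms(2)] by (simp add: space_pair_measure coin_def)
  have "emeasure (M \<Otimes>\<^sub>M coin) A = (\<integral>\<^sup>+y. emeasure M ((\<lambda>x. (x, y)) -` A) \<partial>coin)"
    by (rule emeasure_pair_measure_alt2[OF assms(2)])
  also have "\<dots> = emeasure M ((\<lambda>x. (x, True)) -` A) * ennreal (1 / 2) + emeasure M ((\<lambda>x. (x, False)) -` A) * ennreal (1 / 2)"
    unfolding coin_def by simp
  also have "(\<lambda>x. (x, True)) -` A = {\<omega> \<in> space M. (\<omega>, True) \<in> A}" using sub by auto
  also have "(\<lambda>x. (x, False)) -` A = {\<omega> \<in> space M. (\<omega>, False) \<in> A}" using sub by auto
  finally show ?thesis .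
qed

lemma rand_vectors_flip_last:
  assumes "rand_vectors M n \<xi>"
  shows "rand_vectors (M \<Otimes>\<^sub>M coin) n (flip_last n \<xi>)"
  unfolding rand_vectors_def
proof
  interpret M: prob_space M using assms by (simp add: rand_vectors_def)
  interpret C: prob_space coin unfolding coin_def by (rule prob_space_measure_pmf)
  interpret pair_prob_space M coin ..
  show "prob_space (M \<Otimes>\<^sub>M coin)" by (rule prob_space_axioms)
  show "\<forall>i\<in>{1..n}. flip_last n \<xi> i \<in> borel_measurable (M \<Otimes>\<^sub>M coin)"
  proof
    fix i assume "i \<in> {1..n}"
    then have [measurable]: "\<xi> i \<in> borel_measurable M" using assms by (simp add: rand_vectors_def)
    have [measurable]: "Measurable.pred coin (\<lambda>b. \<not> b)" by (simp add: coin_def)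
    have "(\<lambda>x. if i = n \<and> \<not> snd x then - \<xi> i (fst x) else \<xi> i (fst x)) \<in> borel_measurable (M \<Otimes>\<^sub>M coin)"
      by measurable
    then show "flip_last n \<xi> i \<in> borel_measurable (M \<Otimes>\<^sub>M coin)"
      by (simp add: flip_last_def[abs_def])
  qed
qed

text \<open>The reversed step carries the label \<open>n\<close> and stands at the position
  \<open>i\<close> with \<open>\<sigma> i = n\<close>, hence the factor
  \<open>flip_sign n (\<sigma> i)\<close>.\<close>

lemma tuple_flip_last:
  "tuple n (flip_last n \<xi>) \<sigma> \<epsilon> (\<omega>, True) = tuple n \<xi> \<sigma> \<epsilon> \<omega>"
  "tuple n (flip_last n \<xi>) \<sigma> \<epsilon> (\<omega>, False) = tuple n \<xi> \<sigma> (\<lambda>i. \<epsilon> i * flip_sign n (\<sigma> i)) \<omega>"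
  by (auto simp: tuple_def flip_last_def flip_sign_def)

lemma psum_flip_last:
  assumes "n \<ge> 1"
  shows "k \<le> n \<Longrightarrow> psum (flip_last n \<xi>) k (\<omega>, True) = psum \<xi> k \<omega>"
    and "k \<le> n \<Longrightarrow> psum (flip_last n \<xi>) k (\<omega>, False) = (if k = n then psum_star \<xi> n \<omega> else psum \<xi> k \<omega>)"
proof -
  show "psum (flip_last n \<xi>) k (\<omega>, True) = psum \<xi> k \<omega>" by (simp add: psum_def flip_last_def)
  have low: "psum (flip_last n \<xi>) k (\<omega>, False) = psum \<xi> k \<omega>" if "k < n" for k
    unfolding psum_def using that by (intro sum.cong) (auto simp: flip_last_def)
  have split: "{1..n} = insert n {1..n - 1}" using assms by auto
  have "psum (flip_last n \<xi>) n (\<omega>, False) = psum (flip_last n \<xi>) (n - 1) (\<omega>, False) - \<xi> n \<omega>"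
    unfolding psum_def split using assms by (simp add: flip_last_def)
  then have "psum (flip_last n \<xi>) n (\<omega>, False) = psum_star \<xi> n \<omega>"
    using low[of "n - 1"] assms by (simp add: psum_star_def)
  then show "k \<le> n \<Longrightarrow> psum (flip_last n \<xi>) k (\<omega>, False) = (if k = n then psum_star \<xi> n \<omega> else psum \<xi> k \<omega>)"
    using low by simp
qed

context
  fixes n :: nat and M :: "'w measure" and \<xi> :: "nat \<Rightarrow> 'w \<Rightarrow> 'a::euclidean_space"
  assumes typeD: "typeD M n \<xi>"
begin

lemma typeD_props:
  shows "n \<ge> 2" "n \<ge> DIM('a)" "rand_vectors M n \<xi>"
    "\<And>\<sigma> \<epsilon>. \<sigma> permutes {1..n} \<Longrightarrow> (\<forall>i\<in>{1..n}. \<epsilon> i \<in> {-1, 1}) \<Longrightarrow> (\<Prod>i\<in>{1..n}. \<epsilon> i) = 1 \<Longrightarrow>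
        joint_law M n \<xi> \<sigma> \<epsilon> = joint_law M n \<xi> id (\<lambda>_. 1)"
    "AE \<omega> in M. any_d_indep (\<lambda>k. psum \<xi> k \<omega>) {1..n}"
    "AE \<omega> in M. any_d_indep (\<lambda>k. if k = n then psum_star \<xi> n \<omega> else psum \<xi> k \<omega>) {1..n}"
proof -
  note t = typeD[unfolded typeD_def]
  from t have "n \<ge> max 2 DIM('a)" by blast
  then show "n \<ge> 2" "n \<ge> DIM('a)" by auto
  from t show "rand_vectors M n \<xi>" by blast
  from t show "AE \<omega> in M. any_d_indep (\<lambda>k. psum \<xi> k \<omega>) {1..n}" by blast
  from t show "AE \<omega> in M. any_d_indep (\<lambda>k. if k = n then psum_star \<xi> n \<omega> else psum \<xi> k \<omega>) {1..n}" by blast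
  from t have "\<forall>\<sigma> \<epsilon>. \<sigma> permutes {1..n} \<longrightarrow> (\<forall>i\<in>{1..n}. \<epsilon> i \<in> {-1, 1}) \<longrightarrow>
        (\<Prod>i\<in>{1..n}. \<epsilon> i) = 1 \<longrightarrow> joint_law M n \<xi> \<sigma> \<epsilon> = joint_law M n \<xi> id (\<lambda>_. 1)"
    by (elim conjE)
  then show "\<And>\<sigma> \<epsilon>. \<sigma> permutes {1..n} \<Longrightarrow> (\<forall>i\<in>{1..n}. \<epsilon> i \<in> {-1, 1}) \<Longrightarrow> (\<Prod>i\<in>{1..n}. \<epsilon> i) = 1 \<Longrightarrow>
        joint_law M n \<xi> \<sigma> \<epsilon> = joint_law M n \<xi> id (\<lambda>_. 1)"
    by (elim allE impE) 
qed

lemma joint_law_distr: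
  "joint_law M n \<xi> \<sigma> \<epsilon> = distr M (\<Pi>\<^sub>M i\<in>{1..n}. borel) (tuple n \<xi> \<sigma> \<epsilon>)"
  by (simp add: joint_law_def tuple_def[abs_def])

lemma prod_flip_sign:
  assumes "\<sigma> permutes {1..n}"
  shows "(\<Prod>i\<in>{1..n}. flip_sign n (\<sigma> i)) = -1"
proof -
  have "(\<Prod>i\<in>{1..n}. flip_sign n (\<sigma> i)) = (\<Prod>i\<in>{1..n}. flip_sign n i)"
    using prod.permute[OF assms, of "flip_sign n"] by (simp add: o_def)
  also have "\<dots> = -1" using typeD_props(1) unfolding flip_sign_def by (simp add: prod.delta)
  finally show ?thesis .
qed

text \<open>An odd sign vector is \<open>flip_sign n\<close> times an even one, so the type D
  invariance can be pushed forward under the map that reverses the last coordinate.\<close>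

lemma law_odd:
  assumes \<sigma>: "\<sigma> permutes {1..n}" and \<epsilon>: "\<forall>i\<in>{1..n}. \<epsilon> i \<in> {-1, 1}" and odd: "(\<Prod>i\<in>{1..n}. \<epsilon> i) = -1"
  shows "joint_law M n \<xi> \<sigma> \<epsilon> = joint_law M n \<xi> id (flip_sign n)"
proof -
  let ?N = "\<Pi>\<^sub>M i\<in>{1..n}. (borel :: 'a measure)"
  define F where "F y = (\<lambda>i\<in>{1..n}. flip_sign n i *\<^sub>R y i)" for y :: "nat \<Rightarrow> 'a"
  have F: "F \<in> ?N \<rightarrow>\<^sub>M ?N" unfolding F_def[abs_def]
    by (intro measurable_restrict borel_measurable_scaleR measurable_component_singleton) auto
  have law: "joint_law M n \<xi> \<sigma> (\<lambda>i. flip_sign n i * \<delta> i) = distr (joint_law M n \<xi> \<sigma> \<delta>) ?N F"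
    if "\<sigma> permutes {1..n}" for \<sigma> \<delta>
  proof -
    have "F \<circ> tuple n \<xi> \<sigma> \<delta> = tuple n \<xi> \<sigma> (\<lambda>i. flip_sign n i * \<delta> i)"
      by (auto simp: F_def tuple_def fun_eq_iff)
    then show ?thesis
      unfolding joint_law_distr using distr_distr[OF F measurable_tuple[OF typeD_props(3) that]] by simp
  qed
  define \<delta> where "\<delta> i = flip_sign n i * \<epsilon> i" for i
  have sq: "flip_sign n i * (flip_sign n i * c) = c" for i c by (simp add: flip_sign_def)
  have "(\<Prod>i\<in>{1..n}. \<delta> i) = 1"
    using odd prod_flip_sign[OF permutes_id] by (simp add: \<delta>_def prod.distrib)
  moreover have "\<forall>i\<in>{1..n}. \<delta> i \<in> {-1, 1}" using \<epsilon> by (auto simp: \<delta>_def flip_sign_def)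
  ultimately have "joint_law M n \<xi> \<sigma> \<delta> = joint_law M n \<xi> id (\<lambda>_. 1)" using typeD_props(4)[OF \<sigma>] by simp
  then have "joint_law M n \<xi> \<sigma> (\<lambda>i. flip_sign n i * \<delta> i) = joint_law M n \<xi> id (\<lambda>i. flip_sign n i * 1)"
    unfolding law[OF \<sigma>] law[OF permutes_id] by simp
  then show ?thesis by (simp add: \<delta>_def sq)
qed

lemma emeasure_flip_last_law:
  assumes \<sigma>: "\<sigma> permutes {1..n}" and A: "A \<in> sets (\<Pi>\<^sub>M i\<in>{1..n}. (borel :: 'a measure))"
  shows "emeasure (joint_law (M \<Otimes>\<^sub>M coin) n (flip_last n \<xi>) \<sigma> \<epsilon>) A =
    emeasure (joint_law M n \<xi> \<sigma> \<epsilon>) A * ennreal (1 / 2) +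
    emeasure (joint_law M n \<xi> \<sigma> (\<lambda>i. \<epsilon> i * flip_sign n (\<sigma> i))) A * ennreal (1 / 2)"
proof -
  let ?N = "\<Pi>\<^sub>M i\<in>{1..n}. (borel :: 'a measure)"
  have ps: "prob_space M" using typeD_props(3) by (simp add: rand_vectors_def)
  have mt: "tuple n (flip_last n \<xi>) \<sigma> \<epsilon> \<in> M \<Otimes>\<^sub>M coin \<rightarrow>\<^sub>M ?N"
    by (rule measurable_tuple[OF rand_vectors_flip_last[OF typeD_props(3)] \<sigma>])
  let ?B = "tuple n (flip_last n \<xi>) \<sigma> \<epsilon> -` A \<inter> space (M \<Otimes>\<^sub>M coin)"
  have B: "?B \<in> sets (M \<Otimes>\<^sub>M coin)" using measurable_sets[OF mt A] .
  have sp: "(\<omega>, e) \<in> space (M \<Otimes>\<^sub>M coin) \<longleftrightarrow> \<omega> \<in> space M" for \<omega> e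
    by (simp add: space_pair_measure coin_def)
  have "emeasure (joint_law (M \<Otimes>\<^sub>M coin) n (flip_last n \<xi>) \<sigma> \<epsilon>) A = emeasure (M \<Otimes>\<^sub>M coin) ?B"
    using emeasure_distr[OF mt A] by (simp add: joint_law_def tuple_def[abs_def])
  also have "\<dots> = emeasure M {\<omega> \<in> space M. (\<omega>, True) \<in> ?B} * ennreal (1 / 2)
      + emeasure M {\<omega> \<in> space M. (\<omega>, False) \<in> ?B} * ennreal (1 / 2)"
    by (rule emeasure_coin[OF ps B])
  also have "{\<omega> \<in> space M. (\<omega>, True) \<in> ?B} = tuple n \<xi> \<sigma> \<epsilon> -` A \<inter> space M"
    by (auto simp: sp tuple_flip_last)
  also have "{\<omega> \<in> space M. (\<omega>, False) \<in> ?B} = tuple n \<xi> \<sigma> (\<lambda>i. \<epsilon> i * flip_sign n (\<sigma> i)) -` A \<inter> space M"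
    by (auto simp: sp tuple_flip_last)
  finally show ?thesis
    unfolding joint_law_distr emeasure_distr[OF measurable_tuple[OF typeD_props(3) \<sigma>] A] .
qed

text \<open>For every signed permutation exactly one coin outcome yields an even sign vector, so the
  transformed law is always the same half-half mixture of the even and the odd law. The two
  independence assumptions of type D cover the two outcomes.\<close>

lemma sym_walk_flip_last: "sym_walk 2 (M \<Otimes>\<^sub>M coin) n (flip_last n \<xi>)"
  unfolding sym_walk_def
proof (intro conjI ballI, unfold split_paired_all prod.case)
  show "DIM('a) \<le> n + 2 - 2" using typeD_props(2) by simp
  show "rand_vectors (M \<Otimes>\<^sub>M coin) n (flip_last n \<xi>)"
    by (rule rand_vectors_flip_last[OF typeD_props(3)])
  show "2 = (1::nat) \<longrightarrow> (AE \<omega> in M \<Otimes>\<^sub>M coin. psum (flip_last n \<xi>) n \<omega> = 0)" by simp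
next
  fix \<sigma> \<epsilon> assume g: "(\<sigma>, \<epsilon>) \<in> signed_perms 2 n"
  let ?N = "\<Pi>\<^sub>M i\<in>{1..n}. (borel :: 'a measure)"
  have mix: "emeasure (joint_law (M \<Otimes>\<^sub>M coin) n (flip_last n \<xi>) \<sigma> \<epsilon>) A =
      emeasure (joint_law M n \<xi> id (\<lambda>_. 1)) A * ennreal (1 / 2) +
      emeasure (joint_law M n \<xi> id (flip_sign n)) A * ennreal (1 / 2)"
    if g: "(\<sigma>, \<epsilon>) \<in> signed_perms 2 n" and A: "A \<in> sets ?N" for \<sigma> \<epsilon> A
  proof -
    have \<sigma>: "\<sigma> permutes {1..n}" by (rule signed_perms_signs(1)[OF g])
    have \<epsilon>: "\<forall>i\<in>{1..n}. \<epsilon> i \<in> {-1, 1}" using signed_perms_signs(2)[OF g] by auto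
    have \<epsilon>': "\<forall>i\<in>{1..n}. \<epsilon> i * flip_sign n (\<sigma> i) \<in> {-1, 1}" using \<epsilon> by (auto simp: flip_sign_def)
    have prod: "(\<Prod>i\<in>{1..n}. \<epsilon> i * flip_sign n (\<sigma> i)) = - (\<Prod>i\<in>{1..n}. \<epsilon> i)"
      using prod_flip_sign[OF \<sigma>] by (simp add: prod.distrib)
    consider "(\<Prod>i\<in>{1..n}. \<epsilon> i) = 1" | "(\<Prod>i\<in>{1..n}. \<epsilon> i) = -1"
      using prod_signs[of "{1..n}" \<epsilon>] \<epsilon> by blast
    then show ?thesis
    proof cases
      case 1
      show ?thesis unfolding emeasure_flip_last_law[OF \<sigma> A] typeD_props(4)[OF \<sigma> \<epsilon> 1]
          law_odd[OF \<sigma> \<epsilon>' prod[unfolded 1]] ..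
    next
      case 2
      have "(\<Prod>i\<in>{1..n}. \<epsilon> i * flip_sign n (\<sigma> i)) = 1" using prod 2 by simp
      from typeD_props(4)[OF \<sigma> \<epsilon>' this] show ?thesis
        unfolding emeasure_flip_last_law[OF \<sigma> A] law_odd[OF \<sigma> \<epsilon> 2] by (simp add: add.commute)
    qed
  qed
  show "joint_law (M \<Otimes>\<^sub>M coin) n (flip_last n \<xi>) \<sigma> \<epsilon> = joint_law (M \<Otimes>\<^sub>M coin) n (flip_last n \<xi>) id (\<lambda>_. 1)"
  proof (rule measure_eqI)
    fix A assume "A \<in> sets (joint_law (M \<Otimes>\<^sub>M coin) n (flip_last n \<xi>) \<sigma> \<epsilon>)"
    then have "A \<in> sets ?N" by (simp add: joint_law_def)
    then show "emeasure (joint_law (M \<Otimes>\<^sub>M coin) n (flip_last n \<xi>) \<sigma> \<epsilon>) A =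
        emeasure (joint_law (M \<Otimes>\<^sub>M coin) n (flip_last n \<xi>) id (\<lambda>_. 1)) A"
      using mix[OF g] mix[OF signed_perms_id] by simp
  qed (simp add: joint_law_def)
next
  interpret M: prob_space M using typeD_props(3) by (simp add: rand_vectors_def)
  interpret C: prob_space coin unfolding coin_def by (rule prob_space_measure_pmf)
  interpret pair_sigma_finite M coin ..
  have cong: "any_d_indep v {1..n} \<longleftrightarrow> any_d_indep w {1..n}"
    if "\<And>k. k \<in> {1..n} \<Longrightarrow> v k = w k" for v w :: "nat \<Rightarrow> 'a"
    by (rule any_d_indep_cong[OF that])
  have "AE x in M \<Otimes>\<^sub>M coin. any_d_indep (\<lambda>k. psum (flip_last n \<xi>) k x) {1..n}"
  proof (rule AE_pair_measure)
    show "{x \<in> space (M \<Otimes>\<^sub>M coin). any_d_indep (\<lambda>k. psum (flip_last n \<xi>) k x) {1..n}} \<in> sets (M \<Otimes>\<^sub>M coin)"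
      by (intro sets_any_d_indep measurable_psum[OF rand_vectors_flip_last[OF typeD_props(3)]]) auto
    show "AE \<omega> in M. AE e in coin. any_d_indep (\<lambda>k. psum (flip_last n \<xi>) k (\<omega>, e)) {1..n}"
      using typeD_props(5,6)
    proof eventually_elim
      case (elim \<omega>)
      have n: "1 \<le> n" using typeD_props(1) by simp
      have "any_d_indep (\<lambda>k. psum (flip_last n \<xi>) k (\<omega>, e)) {1..n}" for e
      proof (cases e)
        case True
        show ?thesis by (rule cong[THEN iffD2, OF _ elim(1)]) (simp add: True psum_flip_last(1)[OF n])
      next
        case False
        show ?thesis by (rule cong[THEN iffD2, OF _ elim(2)]) (simp add: False psum_flip_last(2)[OF n])
      qed
      then show ?case by simp
    qed
  qed
  then show "AE x in M \<Otimes>\<^sub>M coin. any_d_indep (\<lambda>k. psum (flip_last n \<xi>) k x) {1..n + 2 - 2}" by simp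
qed

text \<open>Arbitrary signs on the first \<open>n - 1\<close> steps extend to an even sign vector on
  all \<open>n\<close> steps, and the last step is projected away.\<close>

lemma sym_walk_initial:
  assumes dim: "DIM('a) \<le> n - 1"
  shows "sym_walk 2 M (n - 1) \<xi>"
  unfolding sym_walk_def
proof (intro conjI ballI, unfold split_paired_all prod.case)
  show "DIM('a) \<le> n - 1 + 2 - 2" using dim by simp
  show "rand_vectors M (n - 1) \<xi>" using typeD_props(3) by (auto simp: rand_vectors_def)
  show "2 = (1::nat) \<longrightarrow> (AE \<omega> in M. psum \<xi> (n - 1) \<omega> = 0)" by simp
  show "AE \<omega> in M. any_d_indep (\<lambda>k. psum \<xi> k \<omega>) {1..n - 1 + 2 - 2}"
    using typeD_props(5)
  proof eventually_elim
    case (elim \<omega>)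
    have "{1..n - 1 + 2 - 2} \<subseteq> {1..n}" by auto
    then show ?case using elim unfolding any_d_indep_def by (meson subset_trans)
  qed
next
  fix \<sigma> \<epsilon> assume g: "(\<sigma>, \<epsilon>) \<in> signed_perms 2 (n - 1)"
  let ?N = "\<Pi>\<^sub>M i\<in>{1..n}. (borel :: 'a measure)"
  let ?N' = "\<Pi>\<^sub>M i\<in>{1..n - 1}. (borel :: 'a measure)"
  have n: "{1..n} = insert n {1..n - 1}" "n \<notin> {1..n - 1}" using typeD_props(1) by auto
  have \<sigma>: "\<sigma> permutes {1..n}" by (rule permutes_subset[OF signed_perms_signs(1)[OF g]]) auto
  \<comment> \<open>The sign given to step \<open>n\<close>, equal to the product of the others and
    hence repairing the parity.\<close>
  define P where "P = (\<Prod>i\<in>{1..n - 1}. \<epsilon> i)"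
  define \<delta> where "\<delta> = \<epsilon>(n := P)"
  have P: "P = 1 \<or> P = -1" unfolding P_def using signed_perms_signs(2)[OF g] by (intro prod_signs ballI) auto
  have "(\<Prod>i\<in>{1..n - 1}. \<delta> i) = P" unfolding P_def \<delta>_def by (intro prod.cong) auto
  then have prod: "(\<Prod>i\<in>{1..n}. \<delta> i) = 1" using P n(2) unfolding n(1) by (auto simp: \<delta>_def)
  have signs: "\<forall>i\<in>{1..n}. \<delta> i \<in> {-1, 1}" using P signed_perms_signs(2)[OF g] by (auto simp: \<delta>_def)
  have restr: "(\<lambda>y. restrict y {1..n - 1}) \<in> ?N \<rightarrow>\<^sub>M ?N'"
    by (rule measurable_restrict_subset) auto
  have law: "joint_law M (n - 1) \<xi> \<sigma> \<gamma> = distr (joint_law M n \<xi> \<sigma> \<delta>) ?N' (\<lambda>y. restrict y {1..n - 1})"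
    if "\<sigma> permutes {1..n}" "\<And>i. i \<in> {1..n - 1} \<Longrightarrow> \<delta> i = \<gamma> i" for \<sigma> \<gamma> \<delta>
  proof -
    have "(\<lambda>y. restrict y {1..n - 1}) \<circ> tuple n \<xi> \<sigma> \<delta> = tuple (n - 1) \<xi> \<sigma> \<gamma>"
      using that(2) by (auto simp: tuple_def fun_eq_iff restrict_def)
    then show ?thesis
      unfolding joint_law_distr using distr_distr[OF restr measurable_tuple[OF typeD_props(3) that(1)]]
      by (simp add: joint_law_def tuple_def[abs_def])
  qed
  have "joint_law M (n - 1) \<xi> \<sigma> \<epsilon> = distr (joint_law M n \<xi> \<sigma> \<delta>) ?N' (\<lambda>y. restrict y {1..n - 1})"
    using n(2) by (intro law \<sigma>) (auto simp: \<delta>_def)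
  also have "\<dots> = distr (joint_law M n \<xi> id (\<lambda>_. 1)) ?N' (\<lambda>y. restrict y {1..n - 1})"
    unfolding typeD_props(4)[OF \<sigma> signs prod] ..
  also have "\<dots> = joint_law M (n - 1) \<xi> id (\<lambda>_. 1)"
    by (intro law[symmetric] permutes_id) auto
  finally show "joint_law M (n - 1) \<xi> \<sigma> \<epsilon> = joint_law M (n - 1) \<xi> id (\<lambda>_. 1)" .
qed

text \<open>Inclusion-exclusion for the two endpoints: the coin walk gives the mean of their
  nonabsorption probabilities, the initial walk the probability of the union. The bound on the
  dimension is the type B size condition for \<open>n - 1\<close> steps.\<close>

theorem typeD_nonabsorption:
  assumes dim: "DIM('a) \<le> n - 1"
  shows "measure M {\<omega> \<in> space M. 0 \<notin> hullD n \<xi> \<omega>} =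
    2 * (survival 2 n * zeros_weight 2 DIM('a) n) - survival 2 (n - 1) * zeros_weight 2 DIM('a) (n - 1)"
proof -
  interpret prob_space M using typeD_props(3) by (simp add: rand_vectors_def)
  have n: "n \<ge> 2" "n \<ge> 1" using typeD_props(1) by auto
  let ?S = "\<lambda>\<omega> k. psum \<xi> k \<omega>" and ?T = "\<lambda>\<omega>. (\<lambda>k. psum \<xi> k \<omega>)(n := psum_star \<xi> n \<omega>)"
  define C1 where "C1 = {\<omega> \<in> space M. 0 \<notin> convex hull (?S \<omega> ` {1..n})}"
  define C2 where "C2 = {\<omega> \<in> space M. 0 \<notin> convex hull (?T \<omega> ` {1..n})}"
  have mp: "(\<lambda>\<omega>. psum \<xi> k \<omega>) \<in> borel_measurable M" if "k \<le> n" for k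
    using measurable_psum[OF typeD_props(3) that] .
  have "\<xi> n \<in> borel_measurable M" using typeD_props(3) n by (auto simp: rand_vectors_def)
  then have ms: "(\<lambda>\<omega>. ?T \<omega> k) \<in> borel_measurable M" if "k \<le> n" for k
    using mp[OF that] mp[of "n - 1"] by (cases "k = n") (simp_all add: psum_star_def)
  have C1: "C1 \<in> events" unfolding C1_def by (intro sets_zero_notin_hull mp) auto
  have C2: "C2 \<in> events" unfolding C2_def by (intro sets_zero_notin_hull ms) auto
  have D: "{\<omega> \<in> space M. 0 \<notin> hullD n \<xi> \<omega>} = C1 \<inter> C2"
    unfolding C1_def C2_def hullD_avoids_zero_iff(1)[OF n(1)] by blast
  have U: "{\<omega> \<in> space M. 0 \<notin> convex hull (?S \<omega> ` {1..n - 1})} = C1 \<union> C2"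
    unfolding C1_def C2_def hullD_avoids_zero_iff(2)[OF n(1)] by blast
  have sum: "(prob C1 + prob C2) / 2 = survival 2 n * zeros_weight 2 DIM('a) n"
  proof -
    interpret Q: prob_space "M \<Otimes>\<^sub>M coin"
      using rand_vectors_flip_last[OF typeD_props(3)] by (simp add: rand_vectors_def)
    let ?A = "{x \<in> space (M \<Otimes>\<^sub>M coin). 0 \<notin> convex hull ((\<lambda>k. psum (flip_last n \<xi>) k x) ` {1..n})}"
    have A: "?A \<in> sets (M \<Otimes>\<^sub>M coin)"
      by (intro sets_zero_notin_hull measurable_psum[OF rand_vectors_flip_last[OF typeD_props(3)]]) auto
    have sp: "(\<omega>, e) \<in> space (M \<Otimes>\<^sub>M coin) \<longleftrightarrow> \<omega> \<in> space M" for \<omega> e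
      by (simp add: space_pair_measure coin_def)
    have "(\<lambda>k. psum (flip_last n \<xi>) k (\<omega>, True)) ` {1..n} = ?S \<omega> ` {1..n}" for \<omega>
      by (intro image_cong refl psum_flip_last(1)[OF n(2)]) auto
    then have AT: "{\<omega> \<in> space M. (\<omega>, True) \<in> ?A} = C1" by (auto simp: sp C1_def)
    have "(\<lambda>k. psum (flip_last n \<xi>) k (\<omega>, False)) ` {1..n} = ?T \<omega> ` {1..n}" for \<omega>
      by (intro image_cong refl) (auto simp: psum_flip_last(2)[OF n(2)])
    then have AF: "{\<omega> \<in> space M. (\<omega>, False) \<in> ?A} = C2" by (auto simp: sp C2_def)
    have "ennreal (Q.prob ?A) = ennreal (prob C1) * ennreal (1 / 2) + ennreal (prob C2) * ennreal (1 / 2)"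
      using emeasure_coin[OF prob_space_axioms A] unfolding AT AF
      by (simp add: emeasure_eq_measure Q.emeasure_eq_measure)
    also have "\<dots> = ennreal (prob C1 * (1 / 2)) + ennreal (prob C2 * (1 / 2))"
      by (intro arg_cong2[of _ _ _ _ "(+)"] ennreal_mult[symmetric]) auto
    also have "\<dots> = ennreal (prob C1 * (1 / 2) + prob C2 * (1 / 2))"
      by (intro ennreal_plus[symmetric]) auto
    also have "prob C1 * (1 / 2) + prob C2 * (1 / 2) = (prob C1 + prob C2) / 2" by simp
    finally have "Q.prob ?A = (prob C1 + prob C2) / 2" by (simp add: ennreal_inj)
    then show ?thesis using typeB_nonabsorption[OF sym_walk_flip_last] by simp
  qed
  have "prob (C1 \<union> C2) = survival 2 (n - 1) * zeros_weight 2 DIM('a) (n - 1)"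
    using typeB_nonabsorption[OF sym_walk_initial[OF dim]] U by simp
  moreover have "prob (C1 \<union> C2) = prob C1 + prob C2 - prob (C1 \<inter> C2)"
    using C1 C2 by (intro measure_Un3) (auto simp: fmeasurable_eq_sets)
  ultimately show ?thesis using sum D by simp
qed

end

text \<open>Asymptotic equivalence does not pass through differences in general. Here both type B
  terms are \<open>y + o(y)\<close>, and \<open>2 y - y = y\<close> leaves a main term that
  dominates the errors.\<close>

lemma type_D_asymp:
  assumes "d \<ge> 1"
  shows "(\<lambda>n. 2 * (survival 2 n * zeros_weight 2 (Suc d) n) - survival 2 (n - 1) * zeros_weight 2 (Suc d) (n - 1))
    \<sim>[sequentially] (\<lambda>n. ln (real n) ^ d / (2 ^ (d - 1) * fact d * sqrt (pi * real n)))"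
proof -
  define p where "p n = survival 2 n * zeros_weight 2 (Suc d) n" for n
  define y where "y n = ln (real n) ^ d / (2 ^ (d - 1) * fact d * sqrt (pi * real n))" for n :: nat
  have py: "p \<sim>[sequentially] y" using type_B_asymp[OF assms] unfolding p_def y_def .
  have shift: "filterlim (\<lambda>n::nat. n - 1) sequentially sequentially"
    by (rule filterlim_minus_const_nat_at_top)
  have "(\<lambda>n. p (n - 1)) \<sim>[sequentially] (\<lambda>n. y (n - 1))"
    by (rule asymp_equiv_compose'[OF py shift])
  also have "(\<lambda>n. y (n - 1)) \<sim>[sequentially] y"
  proof -
    have "(\<lambda>n. ln (real (n - 1)) ^ d / (2 ^ (d - 1) * fact d * sqrt (pi * real (n - 1)))) \<sim>[sequentially]
        (\<lambda>n. ln (real n) ^ d / (2 ^ (d - 1) * fact d * sqrt (pi * real n)))"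
    proof (intro asymp_equiv_divide asymp_equiv_mult asymp_equiv_power asymp_equiv_refl)
      have ev: "eventually (\<lambda>n. real (n - 1) = real n - 1) sequentially"
        using eventually_ge_at_top[of 1] by eventually_elim simp
      have "(\<lambda>n. ln (real n - 1)) \<sim>[sequentially] (\<lambda>n. ln (real n))" by real_asymp
      moreover have "(\<lambda>n. ln (real (n - 1))) \<sim>[sequentially] (\<lambda>n. ln (real n - 1))"
        by (rule asymp_equiv_refl_ev, rule eventually_mono[OF ev], simp only:)
      ultimately show "(\<lambda>n. ln (real (n - 1))) \<sim>[sequentially] (\<lambda>n. ln (real n))"
        by (rule asymp_equiv_trans[rotated])
      have "(\<lambda>n. sqrt (pi * (real n - 1))) \<sim>[sequentially] (\<lambda>n. sqrt (pi * real n))" by real_asymp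
      moreover have "(\<lambda>n. sqrt (pi * real (n - 1))) \<sim>[sequentially] (\<lambda>n. sqrt (pi * (real n - 1)))"
        by (rule asymp_equiv_refl_ev, rule eventually_mono[OF ev], simp only:)
      ultimately show "(\<lambda>n. sqrt (pi * real (n - 1))) \<sim>[sequentially] (\<lambda>n. sqrt (pi * real n))"
        by (rule asymp_equiv_trans[rotated])
    qed
    then show ?thesis unfolding y_def .
  qed
  finally have py': "(\<lambda>n. p (n - 1)) \<sim>[sequentially] y" .
  have "(\<lambda>n. 2 * (p n - y n)) \<in> o(y)" using py unfolding asymp_equiv_altdef
    by (subst landau_o.small.cmult_in_iff) auto
  then have "(\<lambda>n. 2 * (p n - y n) - (p (n - 1) - y n)) \<in> o(y)"
    using py' unfolding asymp_equiv_altdef by (rule sum_in_smallo(2))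
  moreover have "2 * (p n - y n) - (p (n - 1) - y n) = 2 * p n - p (n - 1) - y n" for n by simp
  ultimately have "(\<lambda>n. 2 * p n - p (n - 1)) \<sim>[sequentially] y"
    unfolding asymp_equiv_altdef by (simp only:)
  then show ?thesis unfolding p_def y_def .
qed

theorem theorem5p1:
  fixes MA MB MD :: "nat \<Rightarrow> 'w measure"
    and \<xi>A \<xi>B \<xi>D :: "nat \<Rightarrow> nat \<Rightarrow> 'w \<Rightarrow> 'a::euclidean_space"
  assumes "DIM('a) \<ge> 2"
  shows
   "((\<forall>n\<ge>DIM('a) + 1. typeA (MA n) n (\<xi>A n)) \<longrightarrow>
      (\<lambda>n. measure (MA n) {\<omega>\<in>space (MA n). 0 \<notin> hullA n (\<xi>A n) \<omega>})
        \<sim>[at_top] (\<lambda>n. 2 * ln (real n) ^ (DIM('a) - 1) / (fact (DIM('a) - 1) * real n)))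
    \<and> ((\<forall>n\<ge>DIM('a). typeB (MB n) n (\<xi>B n)) \<longrightarrow>
      (\<lambda>n. measure (MB n) {\<omega>\<in>space (MB n). 0 \<notin> hullB n (\<xi>B n) \<omega>})
        \<sim>[at_top] (\<lambda>n. ln (real n) ^ (DIM('a) - 1) /
                     (2 ^ (DIM('a) - 2) * fact (DIM('a) - 1) * sqrt (pi * real n))))
    \<and> ((\<forall>n\<ge>max 2 DIM('a). typeD (MD n) n (\<xi>D n)) \<longrightarrow>
      (\<lambda>n. measure (MD n) {\<omega>\<in>space (MD n). 0 \<notin> hullD n (\<xi>D n) \<omega>})
        \<sim>[at_top] (\<lambda>n. ln (real n) ^ (DIM('a) - 1) /
                     (2 ^ (DIM('a) - 2) * fact (DIM('a) - 1) * sqrt (pi * real n))))"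
proof (intro conjI impI)
  define d where "d = DIM('a) - 1"
  have d: "DIM('a) = Suc d" "DIM('a) - 1 = d" "DIM('a) - 2 = d - 1" "d \<ge> 1"
    using assms by (auto simp: d_def)
  {
    assume A: "\<forall>n\<ge>DIM('a) + 1. typeA (MA n) n (\<xi>A n)"
    have "eventually (\<lambda>n. measure (MA n) {\<omega> \<in> space (MA n). 0 \<notin> hullA n (\<xi>A n) \<omega>} =
        survival 1 n * zeros_weight 1 (Suc d) n) at_top"
      using eventually_ge_at_top[of "DIM('a) + 1"]
    proof eventually_elim
      case (elim n)
      have "sym_walk 1 (MA n) n (\<xi>A n)" using A elim by (intro typeA_sym_walk) blast
      from prob_nonabsorption[OF _ this] show ?case by (simp add: hullA_def d(1))
    qed
    from asymp_equiv_trans[OF asymp_equiv_refl_ev[OF this] type_A_asymp]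
    show "(\<lambda>n. measure (MA n) {\<omega> \<in> space (MA n). 0 \<notin> hullA n (\<xi>A n) \<omega>})
        \<sim>[at_top] (\<lambda>n. 2 * ln (real n) ^ (DIM('a) - 1) / (fact (DIM('a) - 1) * real n))"
      unfolding d(2) .
  }
  {
    assume B: "\<forall>n\<ge>DIM('a). typeB (MB n) n (\<xi>B n)"
    have "eventually (\<lambda>n. measure (MB n) {\<omega> \<in> space (MB n). 0 \<notin> hullB n (\<xi>B n) \<omega>} =
        survival 2 n * zeros_weight 2 (Suc d) n) at_top"
      using eventually_ge_at_top[of "DIM('a)"]
    proof eventually_elim
      case (elim n)
      have "sym_walk 2 (MB n) n (\<xi>B n)" using B elim by (intro typeB_sym_walk) blast
      from typeB_nonabsorption[OF this] show ?case unfolding hullB_def d(1) .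
    qed
    from asymp_equiv_trans[OF asymp_equiv_refl_ev[OF this] type_B_asymp[OF d(4)]]
    show "(\<lambda>n. measure (MB n) {\<omega> \<in> space (MB n). 0 \<notin> hullB n (\<xi>B n) \<omega>})
        \<sim>[at_top] (\<lambda>n. ln (real n) ^ (DIM('a) - 1) /
                     (2 ^ (DIM('a) - 2) * fact (DIM('a) - 1) * sqrt (pi * real n)))"
      unfolding d(2,3) .
  }
  {
    assume D: "\<forall>n\<ge>max 2 DIM('a). typeD (MD n) n (\<xi>D n)"
    have "eventually (\<lambda>n. measure (MD n) {\<omega> \<in> space (MD n). 0 \<notin> hullD n (\<xi>D n) \<omega>} =
        2 * (survival 2 n * zeros_weight 2 (Suc d) n) - survival 2 (n - 1) * zeros_weight 2 (Suc d) (n - 1)) at_top"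
      \<comment> \<open>One more step than type D demands, so that the walk without its last step is
        still long enough.\<close>
      using eventually_ge_at_top[of "DIM('a) + 1"]
    proof eventually_elim
      case (elim n)
      have "typeD (MD n) n (\<xi>D n)" "DIM('a) \<le> n - 1" using D elim assms by auto
      from typeD_nonabsorption[OF this] show ?case unfolding d(1) .
    qed
    from asymp_equiv_trans[OF asymp_equiv_refl_ev[OF this] type_D_asymp[OF d(4)]]
    show "(\<lambda>n. measure (MD n) {\<omega> \<in> space (MD n). 0 \<notin> hullD n (\<xi>D n) \<omega>})
        \<sim>[at_top] (\<lambda>n. ln (real n) ^ (DIM('a) - 1) /
                     (2 ^ (DIM('a) - 2) * fact (DIM('a) - 1) * sqrt (pi * real n)))"
      unfolding d(2,3) .
  }
qed

end
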